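(* Let $\gamma>0$ and let $\phi:\mathbb{R}_+\to\mathbb{R}$ satisfy $\phi(1)=-1$ and $\phi(z)\ge-z^{1+\gamma}$ for all $z\ge0$. Suppose that $\phi$ is twice continuously differentiable around $z=1$. Let $S$ be the Hölder score with parameter $\gamma$ and function $\phi$. Consider parametric statistical models $\{p_\theta:\theta\in\Theta\}$, $\Theta\subset\mathbb{R}^k$, of probability densities on $\mathbb{R}^d$, with score function $s_\theta(x)\in\mathbb{R}^k$, $(s_\theta(x))_i=\frac{\partial}{\partial\theta_i}\log p_\theta(x)$, $i=1,\dots,k$, satisfying the following conditions: 1. $\lim_{\|z\|\to\infty}p_\theta(z)=0$ for all $\theta\in\Theta$. 2. For the given $\gamma>0$: (a) $p_\theta\in L_{1+\gamma}^+$ for all $\theta$; (b) $\lim_{\|z\|\to\infty}p_\theta(z)^\gamma s_\theta(z)=0$ for all $\theta$; (c) for every $\theta^*\in\Theta$ the Hessian matrix $I\in\mathbb{R}^{k\times k}$ with entries $$I_{ij}=\frac{\partial^2}{\partial\theta_i\partial\theta_j}\left\{\phi\!\left(\frac{\langle p_{\theta^*}p_\theta^\gamma\rangle}{\langle p_\theta^{1+\gamma}\rangle}\right)\langle p_\theta^{1+\gamma}\rangle\right\}\bigg|_{\theta=\theta^*}$$ is invertible; (d) for every $\theta^*\in\Theta$, integration under $m$ and differentiation with respect to $\theta$ are interchangeable in the vicinity of $\theta=\theta^*$ for the functions $\langle p_\theta^{1+\gamma}\rangle$ and $\langle p_{\theta^*}p_\theta^\gamma\rangle$; in addition, there exists a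 parameter $\theta$ such that the integral $\langle p_\theta^{1+\gamma}s_\theta\rangle$ is not the zero vector. Then the optimum score estimator using the Hölder score $S$ satisfies the redescending property for every statistical model $\{p_\theta:\theta\in\Theta\}$ satisfying conditions 1 and 2(a)–(d) if and only if $\phi''(1)=-\gamma(1+\gamma)$. Moreover, all such estimators (for the given model and $\gamma$, as $\phi$ ranges over functions with $\phi''(1)=-\gamma(1+\gamma)$) have the same asymptotic variance.
   Context: Notation: $\mathbb{R}_+=[0,\infty)$; $m$ is the base (Lebesgue) measure on $\mathbb{R}^d$; $\langle f\rangle=\int f\,dm$; $L_{1+\gamma}^+$ is the set of non-negative, non-zero measurable functions $f$ with $\langle f^{1+\gamma}\rangle<\infty$; $\|\cdot\|$ is the Euclidean norm. Hölder score with $\gamma>0$ and $\phi$: $S(f,g)=\phi\big(\langle fg^\gamma\rangle/\langle g^{1+\gamma}\rangle\big)\langle g^{1+\gamma}\rangle$ for $f,g\in L_{1+\gamma}^+$. The optimum score estimator is obtained by minimizing $q\mapsto S(\widetilde p,q)$ over the model, where $\widetilde p$ is the empirical distribution of the i.i.d. sample; the first argument of $S$ enters only through $\langle fg^\gamma\rangle$, so it may be replaced by any probability distribution $P$, with $\langle fg^\gamma\rangle$ replaced by $\int g^\gamma\,dP$. Influence function: for $\theta\in\Theta$ and $z\in\mathbb{R}^d$, let $p_\varepsilon=(1-\varepsilon)p_\theta+\varepsilon\delta_z$, where $\delta_z$ is the point mass at $z$, and let $\theta_\varepsilon$ be the minimizer of $\bar\theta\mapsto S(p_\varepsilon,p_{\bar\theta})$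 over $\bar\theta\in\Theta$ (so $\theta_0=\theta$). Then $\mathrm{IF}(z;\theta,S)=\lim_{\varepsilon\to+0}(\theta_\varepsilon-\theta)/\varepsilon$. The estimator is redescending (has the redescending property) if $\lim_{\|z\|\to\infty}\|\mathrm{IF}(z;\theta,S)\|=0$ for all $\theta\in\Theta$. The asymptotic variance at $\theta$ is the one determined by the influence function, $\int \mathrm{IF}(z;\theta,S)\,\mathrm{IF}(z;\theta,S)^{\top}p_\theta(z)\,dm(z)$.
   Formalization: Models are also assumed to have an open parameter set, positive densities differentiable in θ, and, for each θ and z and all small ε>0, a unique minimizer θ_ε tending to θ as ε→0; without this the score or influence function may be undefined. *)

theory Defs
  imports "HOL-Probability.Probability"
begin

text \<open>
  \<open>\<phi>\<close> is a function on \<open>[0, \<infinity>)\<close>; its values at negative arguments are never used.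
\<close>

definition holder_generator :: "real \<Rightarrow> (real \<Rightarrow> real) \<Rightarrow> bool" where
  "holder_generator \<gamma> \<phi> \<longleftrightarrow>
     \<phi> 1 = - 1 \<and>
     (\<forall>z\<ge>0. \<phi> z \<ge> - (z powr (1 + \<gamma>))) \<and>
     (\<forall>\<^sub>F z in nhds 1. \<phi> differentiable (at z) \<and> deriv \<phi> differentiable (at z) \<and>
                      isCont (deriv (deriv \<phi>)) z)"

definition holder_score ::
  "(real \<Rightarrow> real) \<Rightarrow> real \<Rightarrow> ('a::euclidean_space \<Rightarrow> real) \<Rightarrow> ('a \<Rightarrow> real) \<Rightarrow> real" where
  "holder_score \<phi> \<gamma> f g =
     \<phi> ((\<integral>x. f x * g x powr \<gamma> \<partial>lborel) / (\<integral>x. g x powr (1 + \<gamma>) \<partial>lborel))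
       * (\<integral>x. g x powr (1 + \<gamma>) \<partial>lborel)"

definition holder_score_distr ::
  "(real \<Rightarrow> real) \<Rightarrow> real \<Rightarrow> 'a::euclidean_space measure \<Rightarrow> ('a \<Rightarrow> real) \<Rightarrow> real" where
  "holder_score_distr \<phi> \<gamma> P g =
     \<phi> ((\<integral>x. g x powr \<gamma> \<partial>P) / (\<integral>x. g x powr (1 + \<gamma>) \<partial>lborel))
       * (\<integral>x. g x powr (1 + \<gamma>) \<partial>lborel)"

lemma holder_score_distr_density:
  assumes "f \<in> borel_measurable borel" "g \<in> borel_measurable borel" "\<And>x. 0 \<le> f x"
  shows "holder_score_distr \<phi> \<gamma> (density lborel (\<lambda>x. ennreal (f x))) g = holder_score \<phi> \<gamma> f g"
  unfolding holder_score_distr_def holder_score_def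
  using assms by (subst integral_density) auto

text \<open>
  Non-zero is meant in the sense of the function space: not almost everywhere zero.
\<close>

definition L_plus :: "real \<Rightarrow> ('a::euclidean_space \<Rightarrow> real) set" where
  "L_plus \<gamma> = {f. f \<in> borel_measurable borel \<and> (\<forall>x. 0 \<le> f x) \<and>
                  integrable lborel (\<lambda>x. f x powr (1 + \<gamma>)) \<and> \<not> (AE x in lborel. f x = 0)}"

definition partial_deriv :: "'k \<Rightarrow> (real ^ 'k \<Rightarrow> real) \<Rightarrow> real ^ 'k \<Rightarrow> real" where
  "partial_deriv i f \<theta> = deriv (\<lambda>t. f (\<theta> + t *\<^sub>R axis i 1)) 0"

definition hessian :: "(real ^ 'k \<Rightarrow> real) \<Rightarrow> real ^ 'k \<Rightarrow> real ^ 'k ^ 'k" where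
  "hessian f \<theta> = (\<chi> i j. partial_deriv i (partial_deriv j f) \<theta>)"

definition twice_differentiable_at :: "(real ^ 'k \<Rightarrow> real) \<Rightarrow> real ^ 'k \<Rightarrow> bool" where
  "twice_differentiable_at f \<theta> \<longleftrightarrow>
     (\<forall>\<^sub>F t in nhds \<theta>. f differentiable (at t)) \<and>
     (\<forall>j. partial_deriv j f differentiable (at \<theta>))"

definition score_function ::
  "(real ^ 'k \<Rightarrow> real ^ 'd \<Rightarrow> real) \<Rightarrow> real ^ 'k \<Rightarrow> real ^ 'd \<Rightarrow> real ^ 'k" where
  "score_function p \<theta> x = (\<chi> i. partial_deriv i (\<lambda>t. ln (p t x)) \<theta>)"

text \<open>The derivative at \<open>\<theta>\<close> of \<open>t \<mapsto> \<integral>x. F t x\<close> exists and is computed under the integral.\<close>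

definition differentiable_under_integral_at ::
  "(real ^ 'k \<Rightarrow> real ^ 'd \<Rightarrow> real) \<Rightarrow> real ^ 'k \<Rightarrow> bool" where
  "differentiable_under_integral_at F \<theta> \<longleftrightarrow>
     (\<forall>x. (\<lambda>t. F t x) differentiable (at \<theta>)) \<and>
     (\<forall>h. integrable lborel (\<lambda>x. frechet_derivative (\<lambda>t. F t x) (at \<theta>) h)) \<and>
     ((\<lambda>t. \<integral>x. F t x \<partial>lborel) has_derivative
        (\<lambda>h. \<integral>x. frechet_derivative (\<lambda>t. F t x) (at \<theta>) h \<partial>lborel)) (at \<theta>)"

text \<open>
  Positivity and differentiability of \<open>t \<mapsto> p t x\<close> are what makes \<open>score_function\<close> meaningful
  at every point \<open>x\<close>; openness of \<open>\<Theta>\<close> is what makes derivatives at all parameters meaningful.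
\<close>

definition statistical_model ::
  "(real ^ 'k) set \<Rightarrow> (real ^ 'k \<Rightarrow> real ^ 'd \<Rightarrow> real) \<Rightarrow> bool" where
  "statistical_model \<Theta> p \<longleftrightarrow>
     open \<Theta> \<and>
     (\<forall>\<theta>\<in>\<Theta>. p \<theta> \<in> borel_measurable borel \<and> (\<forall>x. 0 < p \<theta> x) \<and>
            prob_space (density lborel (\<lambda>x. ennreal (p \<theta> x))) \<and>
            (\<forall>x. (\<lambda>t. p t x) differentiable (at \<theta>)))"

definition model_conditions ::
  "(real \<Rightarrow> real) \<Rightarrow> real \<Rightarrow> (real ^ 'k) set \<Rightarrow> (real ^ 'k \<Rightarrow> real ^ 'd \<Rightarrow> real) \<Rightarrow> bool" where
  "model_conditions \<phi> \<gamma> \<Theta> p \<longleftrightarrow>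
     (\<forall>\<theta>\<in>\<Theta>. (p \<theta> \<longlongrightarrow> 0) at_infinity) \<and>
     (\<forall>\<theta>\<in>\<Theta>. p \<theta> \<in> L_plus \<gamma>) \<and>
     (\<forall>\<theta>\<in>\<Theta>. ((\<lambda>z. (p \<theta> z powr \<gamma>) *\<^sub>R score_function p \<theta> z) \<longlongrightarrow> 0) at_infinity) \<and>
     (\<forall>\<theta>'\<in>\<Theta>. twice_differentiable_at (\<lambda>\<theta>. holder_score \<phi> \<gamma> (p \<theta>') (p \<theta>)) \<theta>' \<and>
              invertible (hessian (\<lambda>\<theta>. holder_score \<phi> \<gamma> (p \<theta>') (p \<theta>)) \<theta>')) \<and>
     (\<forall>\<theta>'\<in>\<Theta>. \<forall>\<^sub>F \<theta> in nhds \<theta>'.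
        differentiable_under_integral_at (\<lambda>t x. p t x powr (1 + \<gamma>)) \<theta> \<and>
        differentiable_under_integral_at (\<lambda>t x. p \<theta>' x * p t x powr \<gamma>) \<theta>) \<and>
     (\<exists>\<theta>\<in>\<Theta>. (\<integral>x. (p \<theta> x powr (1 + \<gamma>)) *\<^sub>R score_function p \<theta> x \<partial>lborel) \<noteq> 0)"

text \<open>For \<open>0 \<le> \<epsilon> \<le> 1\<close> this is the mixture \<open>(1 - \<epsilon>) P + \<epsilon> \<delta>\<^sub>z\<close>.\<close>

definition contaminate ::
  "real \<Rightarrow> 'a::euclidean_space \<Rightarrow> 'a measure \<Rightarrow> 'a measure" where
  "contaminate \<epsilon> z P =
     measure_pmf (bernoulli_pmf \<epsilon>) \<bind> (\<lambda>b. if b then return borel z else P)"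

lemma integral_contaminate:
  fixes h :: "'a::euclidean_space \<Rightarrow> real"
  assumes P: "prob_space P" "sets P = sets borel" and \<epsilon>: "0 \<le> \<epsilon>" "\<epsilon> \<le> 1"
    and h: "h \<in> borel_measurable borel" "\<And>x. 0 \<le> h x" "integrable P h"
  shows "(\<integral>x. h x \<partial>contaminate \<epsilon> z P) = (1 - \<epsilon>) * (\<integral>x. h x \<partial>P) + \<epsilon> * h z"
proof -
  let ?K = "\<lambda>b. if b then return borel z else P"
  have K: "?K \<in> measurable (measure_pmf (bernoulli_pmf \<epsilon>)) (subprob_algebra borel)"
    using P by (auto simp: space_subprob_algebra prob_space_return prob_space_imp_subprob_space)
  have s: "sets (contaminate \<epsilon> z P) = sets borel"
    unfolding contaminate_def by (rule sets_bind) (use P in auto)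
  have hc: "h \<in> borel_measurable (contaminate \<epsilon> z P)"
    using h(1) measurable_cong_sets[OF s refl] by blast
  have "(\<integral>\<^sup>+x. ennreal (h x) \<partial>contaminate \<epsilon> z P)
      = (\<integral>\<^sup>+b. (\<integral>\<^sup>+x. ennreal (h x) \<partial>?K b) \<partial>measure_pmf (bernoulli_pmf \<epsilon>))"
    unfolding contaminate_def by (rule nn_integral_bind[OF _ K]) (use h in auto)
  also have "\<dots> = ennreal (h z) * ennreal \<epsilon> + (\<integral>\<^sup>+x. ennreal (h x) \<partial>P) * ennreal (1 - \<epsilon>)"
    using \<epsilon> h(1) by (simp add: nn_integral_return)
  also have "(\<integral>\<^sup>+x. ennreal (h x) \<partial>P) = ennreal (\<integral>x. h x \<partial>P)"
    by (rule nn_integral_eq_integral) (use h in auto)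
  also have "ennreal (h z) * ennreal \<epsilon> + ennreal (\<integral>x. h x \<partial>P) * ennreal (1 - \<epsilon>)
      = ennreal ((1 - \<epsilon>) * (\<integral>x. h x \<partial>P) + \<epsilon> * h z)"
    using \<epsilon> h(2) by (simp add: ennreal_mult'[symmetric] ennreal_plus[symmetric] mult.commute add.commute
          del: ennreal_plus)
  finally have n: "(\<integral>\<^sup>+x. ennreal (h x) \<partial>contaminate \<epsilon> z P)
      = ennreal ((1 - \<epsilon>) * (\<integral>x. h x \<partial>P) + \<epsilon> * h z)" .
  have "0 \<le> (1 - \<epsilon>) * (\<integral>x. h x \<partial>P) + \<epsilon> * h z"
    using \<epsilon> h(2) by simp
  then show ?thesis
    using hc h(2) by (subst integral_eq_nn_integral) (auto simp: n)
qed

definition contaminated_score ::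
  "(real \<Rightarrow> real) \<Rightarrow> real \<Rightarrow> (real ^ 'k \<Rightarrow> real ^ 'd \<Rightarrow> real) \<Rightarrow>
   real ^ 'k \<Rightarrow> real ^ 'd \<Rightarrow> real \<Rightarrow> real ^ 'k \<Rightarrow> real" where
  "contaminated_score \<phi> \<gamma> p \<theta> z \<epsilon> t =
     holder_score_distr \<phi> \<gamma> (contaminate \<epsilon> z (density lborel (\<lambda>x. ennreal (p \<theta> x)))) (p t)"

definition perturbed_parameter ::
  "(real \<Rightarrow> real) \<Rightarrow> real \<Rightarrow> (real ^ 'k) set \<Rightarrow> (real ^ 'k \<Rightarrow> real ^ 'd \<Rightarrow> real) \<Rightarrow>
   real ^ 'k \<Rightarrow> real ^ 'd \<Rightarrow> real \<Rightarrow> real ^ 'k" where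
  "perturbed_parameter \<phi> \<gamma> \<Theta> p \<theta> z \<epsilon> = arg_min_on (contaminated_score \<phi> \<gamma> p \<theta> z \<epsilon>) \<Theta>"

text \<open>
  The minimizer defining the perturbed parameter exists, is unique, and tends to the unperturbed
  parameter as the contamination vanishes. Uniqueness justifies the choice in \<open>arg_min_on\<close>, and
  the convergence is necessary for the influence function to exist.
\<close>

definition perturbation_well_defined ::
  "(real \<Rightarrow> real) \<Rightarrow> real \<Rightarrow> (real ^ 'k) set \<Rightarrow> (real ^ 'k \<Rightarrow> real ^ 'd \<Rightarrow> real) \<Rightarrow> bool" where
  "perturbation_well_defined \<phi> \<gamma> \<Theta> p \<longleftrightarrow>
     (\<forall>\<theta>\<in>\<Theta>. \<forall>z.
        (\<forall>\<^sub>F \<epsilon> in at_right 0. \<exists>!t. is_arg_min (contaminated_score \<phi> \<gamma> p \<theta> z \<epsilon>) (\<lambda>t. t \<in> \<Theta>) t) \<and>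
        (perturbed_parameter \<phi> \<gamma> \<Theta> p \<theta> z \<longlongrightarrow> \<theta>) (at_right 0))"

definition has_influence_function ::
  "(real \<Rightarrow> real) \<Rightarrow> real \<Rightarrow> (real ^ 'k) set \<Rightarrow> (real ^ 'k \<Rightarrow> real ^ 'd \<Rightarrow> real) \<Rightarrow>
   real ^ 'k \<Rightarrow> (real ^ 'd \<Rightarrow> real ^ 'k) \<Rightarrow> bool" where
  "has_influence_function \<phi> \<gamma> \<Theta> p \<theta> IF \<longleftrightarrow>
     (\<forall>z. ((\<lambda>\<epsilon>. (perturbed_parameter \<phi> \<gamma> \<Theta> p \<theta> z \<epsilon> - \<theta>) /\<^sub>R \<epsilon>) \<longlongrightarrow> IF z) (at_right 0))"

definition redescending ::
  "(real \<Rightarrow> real) \<Rightarrow> real \<Rightarrow> (real ^ 'k) set \<Rightarrow> (real ^ 'k \<Rightarrow> real ^ 'd \<Rightarrow> real) \<Rightarrow> bool" where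
  "redescending \<phi> \<gamma> \<Theta> p \<longleftrightarrow>
     (\<forall>\<theta>\<in>\<Theta>. \<exists>IF. has_influence_function \<phi> \<gamma> \<Theta> p \<theta> IF \<and>
                 ((\<lambda>z. norm (IF z)) \<longlongrightarrow> 0) at_infinity)"

definition has_asymptotic_variance ::
  "(real \<Rightarrow> real) \<Rightarrow> real \<Rightarrow> (real ^ 'k) set \<Rightarrow> (real ^ 'k \<Rightarrow> real ^ 'd \<Rightarrow> real) \<Rightarrow>
   real ^ 'k \<Rightarrow> real ^ 'k ^ 'k \<Rightarrow> bool" where
  "has_asymptotic_variance \<phi> \<gamma> \<Theta> p \<theta> V \<longleftrightarrow>
     (\<exists>IF. has_influence_function \<phi> \<gamma> \<Theta> p \<theta> IF \<and>
           has_bochner_integral lborel (\<lambda>z. p \<theta> z *\<^sub>R (\<chi> i j. IF z $ i * IF z $ j)) V)"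

end

theory Submission
  imports Defs
begin

text \<open>
  Fix a parameter \<open>\<theta>\<close> and a contamination point \<open>z\<close>. With \<open>u t = \<langle>p\<^sub>\<theta> p\<^sub>t\<^sup>\<gamma>\<rangle>\<close>,
  \<open>v t = \<langle>p\<^sub>t\<^sup>1\<^sup>+\<^sup>\<gamma>\<rangle>\<close> and \<open>g t = p\<^sub>t(z)\<^sup>\<gamma>\<close> the contaminated objective is
  \<open>F\<^sub>\<epsilon> = \<phi> (((1 - \<epsilon>) u + \<epsilon> g) / v) v\<close>. Since \<open>\<phi>\<close> lies above \<open>-z\<^sup>1\<^sup>+\<^sup>\<gamma>\<close> and touches it at 1,
  \<open>\<phi>' 1 = -(1 + \<gamma>)\<close>, and Young's inequality shows that \<open>F\<^sub>0\<close> is minimal at \<open>\<theta>\<close>. Its Hessian \<open>I\<close>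
  at \<open>\<theta>\<close> is therefore positive semidefinite, and positive definite because it is invertible.

  Jointly in \<open>\<epsilon>\<close> and \<open>h = t - \<theta>\<close>, the objective changes by
  \<open>h \<bullet> I h / 2 + \<epsilon> (b z \<bullet> h) + o(|h|\<^sup>2 + \<epsilon>\<^sup>2)\<close> when \<open>t\<close> moves away from \<open>\<theta>\<close>
  (\<open>contaminated_score_expansion\<close>), where with \<open>w = \<langle>p\<^sub>\<theta>\<^sup>1\<^sup>+\<^sup>\<gamma> s\<^sub>\<theta>\<rangle>\<close>
  \<open>b z = -\<gamma> (1 + \<gamma>) (p\<^sub>\<theta>(z)\<^sup>\<gamma> s\<^sub>\<theta>(z) - w) - \<phi>'' 1 (p\<^sub>\<theta>(z)\<^sup>\<gamma> - v \<theta>) / v \<theta> w\<close>.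
  Comparing the value at the minimizer with the value at \<open>\<theta> - \<epsilon> I\<^sup>-\<^sup>1 b z\<close> shows that the
  minimizer leaves \<open>\<theta>\<close> with velocity \<open>- I\<^sup>-\<^sup>1 b z\<close> (\<open>perturbed_minimizer_derivative\<close>); this is
  the influence function. The argument works with values instead of stationarity equations because
  the gradients of \<open>u\<close> and \<open>v\<close> exist near \<open>\<theta>\<close> but may be discontinuous there.

  As \<open>z\<close> tends to infinity, \<open>b z\<close> tends to \<open>(\<phi>'' 1 + \<gamma> (1 + \<gamma>)) w\<close>. As \<open>w\<close> is non-zero for some
  parameter, the influence function vanishes at infinity for every parameter if and only if
  \<open>\<phi>'' 1 = -\<gamma> (1 + \<gamma>)\<close> (\<open>redescending_iff\<close>). Moreover \<open>b\<close> depends on \<open>\<phi>\<close> only through \<open>\<phi>'' 1\<close>, and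
  so does the quadratic part of the expansion; hence two generators with the same second derivative
  at 1 have the same influence function and the same asymptotic variance.

  Since \<open>redescending_iff\<close> decides each single model, the equivalence over all models only needs that
  some model satisfies the conditions, in every dimension and for every \<open>\<phi>\<close>
  (\<open>regular_model_exists\<close>). The difficulty lies in the global minimizers of the contaminated scores,
  as away from 1 only a lower bound of \<open>\<phi>\<close> is known. The model used here divides the sample space into
  finitely many cells, fixes the shape of the density on each cell and lets the parameter be the
  vector of cell masses, restricted to a small ball. Contamination by a point mass then only shifts
  the mass vector of the first argument, so that all scores are values of one explicit function of
  two vectors. At the diagonal its second derivative is positive definite by a strict
  Cauchy--Schwarz inequality and \<open>\<phi>'' 1 \<ge> -\<gamma> (1 + \<gamma>)\<close>; by compactness it stays so nearby, which
  makes the scores strictly convex on the ball and their minimizers unique and continuous.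
\<close>

section \<open>Second-order expansions\<close>

lemma has_derivative_imp_line_derivative:
  fixes f :: "'a::real_normed_vector \<Rightarrow> real"
  assumes "(f has_derivative D) (at (x + \<tau> *\<^sub>R h))"
  shows "((\<lambda>s. f (x + s *\<^sub>R h)) has_real_derivative D h) (at \<tau>)"
proof -
  have "((\<lambda>s. x + s *\<^sub>R h) has_derivative (\<lambda>s. s *\<^sub>R h)) (at \<tau>)"
    by (auto intro!: derivative_eq_intros)
  from has_derivative_compose[OF this assms]
  have "((\<lambda>s. f (x + s *\<^sub>R h)) has_derivative (\<lambda>s. D (s *\<^sub>R h))) (at \<tau>)" by simp
  moreover have "(\<lambda>s. D (s *\<^sub>R h)) = (*) (D h)"
    using has_derivative_linear[OF assms] by (auto simp: linear_scale fun_eq_iff)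
  ultimately show ?thesis
    by (simp add: has_field_derivative_def)
qed

lemma partial_deriv_eq:
  assumes "(f has_derivative D) (at t)"
  shows "partial_deriv j f t = D (axis j 1)"
  unfolding partial_deriv_def
  using has_derivative_imp_line_derivative[of f D t 0 "axis j 1"] assms by (auto intro: DERIV_imp_deriv)

text \<open>
  Directional derivatives in coordinates: the link between Frechet derivatives and the partial
  derivatives in which gradients and Hessians are written.
\<close>

lemma has_derivative_partial_derivs:
  assumes "(f has_derivative D) (at t)"
  shows "D k = (\<Sum>j\<in>UNIV. k $ j * partial_deriv j f t)"
proof -
  have "D k = D (\<Sum>j\<in>UNIV. k $ j *\<^sub>R axis j 1)"
    using basis_expansion[of k] by (simp add: scalar_mult_eq_scaleR)
  also have "\<dots> = (\<Sum>j\<in>UNIV. k $ j * D (axis j 1))"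
    using has_derivative_linear[OF assms] by (simp add: linear_sum linear_scale)
  finally show ?thesis by (simp add: partial_deriv_eq[OF assms])
qed

definition gradient :: "(real ^ 'k \<Rightarrow> real) \<Rightarrow> real ^ 'k \<Rightarrow> real ^ 'k" where
  "gradient F \<theta> = (\<chi> j. partial_deriv j F \<theta>)"

lemma inner_gradient:
  assumes "(f has_derivative D) (at t)"
  shows "gradient f t \<bullet> k = D k"
  using has_derivative_partial_derivs[OF assms, of k]
  by (simp add: gradient_def inner_vec_def mult.commute)

lemma hessian_bilinear:
  assumes "\<And>j. (partial_deriv j F has_derivative D j) (at \<theta>)"
  shows "x \<bullet> (hessian F \<theta> *v k) = (\<Sum>j\<in>UNIV. k $ j * D j x)"
proof -
  have "x \<bullet> (hessian F \<theta> *v k)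
      = (\<Sum>i\<in>UNIV. \<Sum>j\<in>UNIV. k $ j * (x $ i * partial_deriv i (partial_deriv j F) \<theta>))"
    by (simp add: inner_vec_def matrix_vector_mult_def hessian_def sum_distrib_left mult_ac)
  also have "\<dots> = (\<Sum>j\<in>UNIV. k $ j * (\<Sum>i\<in>UNIV. x $ i * partial_deriv i (partial_deriv j F) \<theta>))"
    by (subst sum.swap) (simp add: sum_distrib_left)
  also have "\<dots> = (\<Sum>j\<in>UNIV. k $ j * D j x)"
    by (simp add: has_derivative_partial_derivs[OF assms])
  finally show ?thesis .
qed

text \<open>
  Taylor's formula in Peano's form with a displaced base point \<open>\<theta> + x\<close>. Subtracting the quadratic
  model along the segment from \<open>\<theta> + x\<close> to \<open>\<theta> + x + k\<close> leaves a function of one variable whose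
  derivative is small by differentiability of the partial derivatives at the single point \<open>\<theta>\<close>, and
  the mean value theorem integrates this bound. The case \<open>x = 0\<close> is the usual expansion; the general
  case also yields the symmetry of the Hessian.
\<close>

lemma twice_differentiable_increment:
  fixes F :: "real ^ 'k \<Rightarrow> real"
  assumes F: "twice_differentiable_at F \<theta>" and e: "e > 0"
  obtains d where "d > 0"
    "\<And>x k. norm x + norm k < d \<Longrightarrow>
       \<bar>F (\<theta> + x + k) - F (\<theta> + x) - gradient F \<theta> \<bullet> k - x \<bullet> (hessian F \<theta> *v k)
         - k \<bullet> (hessian F \<theta> *v k) / 2\<bar> \<le> e * norm k * (norm x + norm k)"
proof -
  define H where "H = hessian F \<theta>"
  define e' where "e' = e / CARD('k)"
  have e': "e' > 0" using e by (simp add: e'_def)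
  have "\<forall>j. \<exists>D. (partial_deriv j F has_derivative D) (at \<theta>)"
    using F by (auto simp: twice_differentiable_at_def differentiable_def)
  then obtain D where D: "\<And>j. (partial_deriv j F has_derivative D j) (at \<theta>)" by metis
  note H = hessian_bilinear[OF D, folded H_def]
  have "\<forall>\<^sub>F y in nhds \<theta>. norm (partial_deriv j F y - partial_deriv j F \<theta> - D j (y - \<theta>)) \<le> e' * norm (y - \<theta>)"
    for j
    using D[of j] e' unfolding has_derivative_within_alt2
    by (auto simp: eventually_at_filter linear_simps(3)
        elim!: allE[of _ e'] eventually_mono)
  then have "\<forall>\<^sub>F y in nhds \<theta>. \<forall>j. norm (partial_deriv j F y - partial_deriv j F \<theta> - D j (y - \<theta>)) \<le> e' * norm (y - \<theta>)"
    by (rule eventually_all_finite)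
  moreover have "\<forall>\<^sub>F y in nhds \<theta>. F differentiable (at y)"
    using F by (simp add: twice_differentiable_at_def)
  ultimately have "\<forall>\<^sub>F y in nhds \<theta>. F differentiable (at y) \<and>
      (\<forall>j. norm (partial_deriv j F y - partial_deriv j F \<theta> - D j (y - \<theta>)) \<le> e' * norm (y - \<theta>))"
    by eventually_elim auto
  then obtain d where d: "d > 0" and dd: "\<And>y. dist y \<theta> < d \<Longrightarrow> F differentiable (at y) \<and>
      (\<forall>j. norm (partial_deriv j F y - partial_deriv j F \<theta> - D j (y - \<theta>)) \<le> e' * norm (y - \<theta>))"
    by (auto simp: eventually_nhds_metric)
  show thesis
  proof (rule that[OF d], fold H_def)
    fix x k :: "real ^ 'k" assume xk: "norm x + norm k < d"
    \<comment> \<open>the increment along the segment, with the quadratic model subtracted\<close>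
    define G where "G s = F ((\<theta> + x) + s *\<^sub>R k) - s * (gradient F \<theta> \<bullet> k) - s * (x \<bullet> (H *v k))
        - s\<^sup>2 * (k \<bullet> (H *v k)) / 2" for s
    define G' where "G' s = (\<Sum>j\<in>UNIV. k $ j * partial_deriv j F ((\<theta> + x) + s *\<^sub>R k))
       - gradient F \<theta> \<bullet> k - x \<bullet> (H *v k) - s * (k \<bullet> (H *v k))" for s
    have nb: "norm (x + s *\<^sub>R k) \<le> norm x + norm k" if "0 \<le> s" "s \<le> 1" for s
    proof -
      have "norm (x + s *\<^sub>R k) \<le> norm x + \<bar>s\<bar> * norm k"
        by (metis norm_scaleR norm_triangle_ineq)
      also have "\<bar>s\<bar> * norm k \<le> 1 * norm k" using that by (intro mult_right_mono) auto
      finally show ?thesis by simp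
    qed
    have "\<exists>z>0. z < 1 \<and> G 1 - G 0 = (1 - 0) * G' z"
    proof (rule MVT2)
      fix s :: real assume s: "0 \<le> s" "s \<le> 1"
      have "dist ((\<theta> + x) + s *\<^sub>R k) \<theta> < d"
        using nb[OF s] xk by (simp add: dist_norm algebra_simps)
      with dd obtain DF where DF: "(F has_derivative DF) (at ((\<theta> + x) + s *\<^sub>R k))"
        by (auto simp: differentiable_def)
      show "(G has_real_derivative G' s) (at s)"
        unfolding G_def G'_def has_derivative_partial_derivs[OF DF, symmetric]
        by (auto intro!: derivative_eq_intros has_derivative_imp_line_derivative[OF DF])
    qed simp
    then obtain s where s: "0 < s" "s < 1" and GG: "G 1 - G 0 = G' s" by auto
    define y where "y = (\<theta> + x) + s *\<^sub>R k"
    have y: "dist y \<theta> < d" using nb[of s] xk s by (simp add: y_def dist_norm algebra_simps)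
    have "G' s = (\<Sum>j\<in>UNIV. k $ j * (partial_deriv j F y - partial_deriv j F \<theta> - D j (y - \<theta>)))"
    proof -
      have "D j (y - \<theta>) = D j x + s * D j k" for j
        using has_derivative_linear[OF D[of j]] by (simp add: y_def linear_add linear_scale)
      then have "(\<Sum>j\<in>UNIV. k $ j * D j (y - \<theta>)) = x \<bullet> (H *v k) + s * (k \<bullet> (H *v k))"
        by (simp add: H sum_distrib_left sum.distrib algebra_simps)
      then show ?thesis
        unfolding G'_def y_def[symmetric]
        by (simp add: algebra_simps sum.distrib sum_subtractf gradient_def inner_vec_def[of "\<chi> j. partial_deriv j F \<theta>"])
    qed
    also have "\<bar>\<dots>\<bar> \<le> (\<Sum>j\<in>(UNIV :: 'k set). norm k * (e' * (norm x + norm k)))"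
    proof (rule order.trans[OF sum_abs], rule sum_mono)
      fix j :: 'k
      have "\<bar>partial_deriv j F y - partial_deriv j F \<theta> - D j (y - \<theta>)\<bar> \<le> e' * norm (y - \<theta>)"
        using dd[OF y] by simp
      also have "\<dots> \<le> e' * (norm x + norm k)"
        using nb[of s] s e' by (simp add: y_def)
      finally show "\<bar>k $ j * (partial_deriv j F y - partial_deriv j F \<theta> - D j (y - \<theta>))\<bar>
          \<le> norm k * (e' * (norm x + norm k))"
        unfolding abs_mult using component_le_norm_cart[of k j] by (intro mult_mono) auto
    qed
    also have "\<dots> = e * norm k * (norm x + norm k)"
      by (simp add: e'_def)
    finally have "\<bar>G 1 - G 0\<bar> \<le> e * norm k * (norm x + norm k)" using GG by simp
    then show "\<bar>F (\<theta> + x + k) - F (\<theta> + x) - gradient F \<theta> \<bullet> k - x \<bullet> (H *v k)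
         - k \<bullet> (H *v k) / 2\<bar> \<le> e * norm k * (norm x + norm k)"
      by (simp add: G_def algebra_simps)
  qed
qed

text \<open>
  The increment from \<open>\<theta>\<close> to \<open>\<theta> + s (x + k)\<close> can be expanded at once or with a stop at \<open>\<theta> + s x\<close>.
  The two expansions differ by half of the antisymmetric part of the Hessian, times \<open>s\<^sup>2\<close>, so this
  part is zero.
\<close>

lemma hessian_symmetric:
  fixes F :: "real ^ 'k \<Rightarrow> real"
  assumes F: "twice_differentiable_at F \<theta>"
  shows "x \<bullet> (hessian F \<theta> *v k) = k \<bullet> (hessian F \<theta> *v x)"
proof -
  define H where "H = hessian F \<theta>"
  define N where "N = norm x + norm k"
  have N: "N \<ge> 0" by (simp add: N_def)
  define A where "A = x \<bullet> (H *v k) - k \<bullet> (H *v x)"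
  have "\<bar>A\<bar> \<le> e * (12 * N\<^sup>2)" if e: "e > 0" for e
  proof -
    obtain d where d: "d > 0" and dd: "\<And>x k. norm x + norm k < d \<Longrightarrow>
       \<bar>F (\<theta> + x + k) - F (\<theta> + x) - gradient F \<theta> \<bullet> k - x \<bullet> (H *v k)
         - k \<bullet> (H *v k) / 2\<bar> \<le> e * norm k * (norm x + norm k)"
      using twice_differentiable_increment[OF F e] unfolding H_def by metis
    \<comment> \<open>small enough for all increments to stay within distance \<open>d\<close>\<close>
    define s where "s = d / (2 * (N + 1))"
    have s: "s > 0" using d N by (simp add: s_def)
    have "s * N < s * (2 * (N + 1))" using s N by (intro mult_strict_left_mono) auto
    then have s: "s > 0" "s * N < d" using s N by (auto simp: s_def)
    have ns: "norm (s *\<^sub>R x) + norm (s *\<^sub>R k) = s * N" using s by (simp add: N_def algebra_simps)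
    have nn: "norm (s *\<^sub>R x) \<le> s * N" "norm (s *\<^sub>R k) \<le> s * N" "norm (s *\<^sub>R (x + k)) \<le> s * N"
      using s by (auto simp: N_def norm_triangle_ineq)
    have bnd: "e * norm b * (norm a + norm b) \<le> e * (s * N)\<^sup>2 * 2" 
      if "norm a \<le> s * N" "norm b \<le> s * N" for a b :: "real ^ 'k"
    proof -
      have "norm b * (norm a + norm b) \<le> (s * N) * (s * N + s * N)"
        using that s N by (intro mult_mono add_mono) auto
      then show ?thesis using e by (simp add: power2_eq_square mult.assoc) argo
    qed
    let ?Q = "\<lambda>a b. F (\<theta> + a + b) - F (\<theta> + a) - gradient F \<theta> \<bullet> b - a \<bullet> (H *v b) - b \<bullet> (H *v b) / 2"
    have 1: "\<bar>?Q (s *\<^sub>R x) (s *\<^sub>R k)\<bar> \<le> e * (s * N)\<^sup>2 * 2"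
      by (rule order.trans[OF dd bnd]) (use ns s N nn in auto)
    have 2: "\<bar>?Q 0 (s *\<^sub>R x)\<bar> \<le> e * (s * N)\<^sup>2 * 2"
      by (rule order.trans[OF dd bnd]) (use nn(1) s N in \<open>auto simp del: norm_scaleR\<close>)
    have 3: "\<bar>?Q 0 (s *\<^sub>R (x + k))\<bar> \<le> e * (s * N)\<^sup>2 * 2"
      by (rule order.trans[OF dd bnd]) (use nn(3) s N in \<open>auto simp del: norm_scaleR\<close>)
    have "?Q 0 (s *\<^sub>R (x + k)) - ?Q (s *\<^sub>R x) (s *\<^sub>R k) - ?Q 0 (s *\<^sub>R x) = s\<^sup>2 * A / 2"
      by (simp add: A_def algebra_simps inner_add_left inner_add_right matrix_vector_right_distrib
          matrix_vector_mult_scaleR power2_eq_square add_divide_distrib)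
    then have "\<bar>s\<^sup>2 * A / 2\<bar> \<le> e * (s * N)\<^sup>2 * 6"
      using 1 2 3 by argo
    then have "s\<^sup>2 * \<bar>A\<bar> \<le> s\<^sup>2 * (e * (12 * N\<^sup>2))"
      by (simp add: abs_mult power_mult_distrib algebra_simps)
    then have "\<bar>A\<bar> \<le> e * (12 * N\<^sup>2)" using s by (simp add: mult_le_cancel_left_pos)
    then show ?thesis .
  qed
  then have "\<forall>\<^sub>F e in at_right 0. \<bar>A\<bar> \<le> e * (12 * N\<^sup>2)"
    by (auto simp: eventually_at_filter)
  moreover have "((\<lambda>e. e * (12 * N\<^sup>2)) \<longlongrightarrow> 0 * (12 * N\<^sup>2)) (at_right 0)"
    by (intro tendsto_intros)
  ultimately have "\<bar>A\<bar> \<le> 0"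
    using tendsto_lowerbound[OF _ _ trivial_limit_at_right_real] by fastforce
  then show ?thesis by (simp add: A_def H_def)
qed

lemma has_derivative_increment:
  fixes f :: "'a::real_normed_vector \<Rightarrow> real"
  assumes "(f has_derivative D) (at \<theta>)" "e > 0"
  shows "\<forall>\<^sub>F h in nhds 0. \<bar>f (\<theta> + h) - f \<theta> - D h\<bar> \<le> e * norm h"
proof -
  obtain d where "d > 0" "\<And>y. norm (y - \<theta>) < d \<Longrightarrow> norm (f y - f \<theta> - D (y - \<theta>)) \<le> e * norm (y - \<theta>)"
    using assms unfolding has_derivative_at_alt by blast
  from this(1) this(2)[of "\<theta> + _"] show ?thesis
    by (auto simp: eventually_nhds_metric)
qed

lemma has_derivative_lipschitz:
  fixes f :: "'a::real_normed_vector \<Rightarrow> real"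
  assumes D: "(f has_derivative D) (at \<theta>)"
  obtains C where "C > 0" "\<forall>\<^sub>F h in nhds 0. \<bar>f (\<theta> + h) - f \<theta>\<bar> \<le> C * norm h"
proof -
  obtain K where K: "K > 0" "\<And>h. norm (D h) \<le> norm h * K"
    using bounded_linear.pos_bounded[OF has_derivative_bounded_linear[OF D]] by blast
  show thesis
  proof (rule that[of "K + 1"])
    show "\<forall>\<^sub>F h in nhds 0. \<bar>f (\<theta> + h) - f \<theta>\<bar> \<le> (K + 1) * norm h"
      using has_derivative_increment[OF D zero_less_one]
    proof eventually_elim
      case (elim h)
      then show ?case using K(2)[of h] by (simp add: algebra_simps)
    qed
  qed (use K in simp)
qed

section \<open>Minimizers of perturbed functions\<close>

text \<open>
  If \<open>x\<close> minimizes the quadratic form with value zero, the first-order term of the form at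
  \<open>x - s (H x)\<close> cannot be negative for small \<open>s\<close>; this term is \<open>-2 s |H x|\<^sup>2\<close>. This upgrades an invertible
  positive semidefinite matrix to a positive definite one.
\<close>

lemma psd_inner_zero_imp_kernel:
  fixes H :: "real ^ 'k ^ 'k"
  assumes sym: "\<And>x y. x \<bullet> (H *v y) = y \<bullet> (H *v x)"
    and psd: "\<And>x. 0 \<le> x \<bullet> (H *v x)" and x: "x \<bullet> (H *v x) = 0"
  shows "H *v x = 0"
proof -
  define y where "y = H *v x"
  define a where "a = y \<bullet> (H *v y)"
  have q: "0 \<le> - (2 * s * (y \<bullet> y)) + s\<^sup>2 * a" for s
  proof -
    have "0 \<le> (x - s *\<^sub>R y) \<bullet> (H *v (x - s *\<^sub>R y))" by (rule psd)
    also have "\<dots> = - (2 * s * (y \<bullet> y)) + s\<^sup>2 * a"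
      using x sym[of x y]
      by (simp add: matrix_vector_mult_diff_distrib matrix_vector_mult_scaleR inner_diff_left
          inner_diff_right a_def y_def[symmetric] power2_eq_square algebra_simps)
    finally show ?thesis .
  qed
  have a: "a \<ge> 0" unfolding a_def by (rule psd)
  \<comment> \<open>the denominator \<open>a + 1\<close> makes the quadratic term \<open>s\<^sup>2 a\<close> at most \<open>s (y \<bullet> y)\<close>\<close>
  define s where "s = (y \<bullet> y) / (a + 1)"
  have "a * s \<le> y \<bullet> y" using a by (simp add: s_def field_simps)
  then have "s * (s * a) \<le> s * (y \<bullet> y)"
    using a by (intro mult_left_mono) (auto simp: s_def mult.commute)
  with q[of s] have "s * (y \<bullet> y) \<le> 0" by (simp add: power2_eq_square algebra_simps)
  then have "(y \<bullet> y) * (y \<bullet> y) \<le> 0" using a by (simp add: s_def divide_le_0_iff)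
  then have "y \<bullet> y = 0" by (metis inner_ge_zero mult_le_0_iff order.antisym)
  then show ?thesis by (simp add: y_def)
qed

lemma positive_definite_coercive:
  fixes H :: "real ^ 'k ^ 'k"
  assumes "\<And>x. x \<noteq> 0 \<Longrightarrow> 0 < x \<bullet> (H *v x)"
  obtains m where "m > 0" "\<And>x. m * (norm x)\<^sup>2 \<le> x \<bullet> (H *v x)"
proof -
  let ?S = "sphere (0 :: real ^ 'k) 1"
  have "continuous_on ?S (\<lambda>x. x \<bullet> (H *v x))"
    by (intro continuous_intros linear_continuous_on matrix_vector_mul_bounded_linear)
  moreover have "?S \<noteq> {}" by simp
  ultimately obtain x0 where x0: "x0 \<in> ?S" "\<And>x. x \<in> ?S \<Longrightarrow> x0 \<bullet> (H *v x0) \<le> x \<bullet> (H *v x)"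
    using continuous_attains_inf[OF compact_sphere, of "0 :: real ^ 'k" 1 "\<lambda>x. x \<bullet> (H *v x)"] by blast
  show thesis
  proof (rule that[of "x0 \<bullet> (H *v x0)"])
    show "0 < x0 \<bullet> (H *v x0)" by (rule assms) (use x0(1) in auto)
    fix x :: "real ^ 'k"
    show "x0 \<bullet> (H *v x0) * (norm x)\<^sup>2 \<le> x \<bullet> (H *v x)"
    proof (cases "x = 0")
      case False
      have "x0 \<bullet> (H *v x0) \<le> (x /\<^sub>R norm x) \<bullet> (H *v (x /\<^sub>R norm x))"
        using False by (intro x0) simp
      also have "\<dots> = x \<bullet> (H *v x) / (norm x)\<^sup>2"
        by (simp add: matrix_vector_mult_scaleR power2_eq_square divide_inverse)
      finally show ?thesis using False by (simp add: pos_le_divide_eq)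
    qed simp
  qed
qed

text \<open>
  Minimizers of \<open>F \<epsilon>\<close> move with velocity \<open>x = - H\<^sup>-\<^sup>1 b\<close>. With \<open>h = T \<epsilon> - \<theta>\<close> and the candidate
  \<open>k = \<epsilon> x\<close>, completing the square turns \<open>F \<epsilon> (\<theta> + h) \<le> F \<epsilon> (\<theta> + k)\<close> into
  \<open>(h - k) \<bullet> H (h - k) \<le> o(|h|\<^sup>2 + |k|\<^sup>2 + \<epsilon>\<^sup>2)\<close>. Coercivity of \<open>H\<close> absorbs \<open>|h|\<^sup>2\<close> into the left-hand
  side, which leaves \<open>h - k = o(\<epsilon>)\<close>.
\<close>

lemma perturbed_minimizer_derivative:
  fixes H :: "real ^ 'k ^ 'k" and F :: "real \<Rightarrow> real ^ 'k \<Rightarrow> real"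
  assumes sym: "\<And>x y. x \<bullet> (H *v y) = y \<bullet> (H *v x)"
    and pd: "\<And>x. x \<noteq> 0 \<Longrightarrow> 0 < x \<bullet> (H *v x)"
    and expansion: "\<And>e. e > 0 \<Longrightarrow> \<forall>\<^sub>F (\<epsilon>, h) in at_right 0 \<times>\<^sub>F nhds 0.
        \<bar>F \<epsilon> (\<theta> + h) - F \<epsilon> \<theta> - h \<bullet> (H *v h) / 2 - \<epsilon> * (b \<bullet> h)\<bar> \<le> e * ((norm h)\<^sup>2 + \<epsilon>\<^sup>2)"
    and T: "(T \<longlongrightarrow> \<theta>) (at_right 0)"
    and min: "\<forall>\<^sub>F (\<epsilon>, h) in at_right 0 \<times>\<^sub>F nhds 0. F \<epsilon> (T \<epsilon>) \<le> F \<epsilon> (\<theta> + h)"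
    and x: "H *v x = - b"
  shows "((\<lambda>\<epsilon>. (T \<epsilon> - \<theta>) /\<^sub>R \<epsilon>) \<longlongrightarrow> x) (at_right 0)"
proof -
  obtain m where m: "m > 0" "\<And>x. m * (norm x)\<^sup>2 \<le> x \<bullet> (H *v x)"
    using positive_definite_coercive[OF pd] by metis
  define K where "K = 3 * (norm x)\<^sup>2 + 2"
  have K: "K > 0" by (simp add: K_def add_nonneg_pos)
  have key: "\<forall>\<^sub>F \<epsilon> in at_right 0. (norm ((T \<epsilon> - \<theta>) /\<^sub>R \<epsilon> - x))\<^sup>2 \<le> 4 * e * K / m"
    if e: "e > 0" "e \<le> m / 8" for e
  proof -
    let ?L = "at_right (0::real) \<times>\<^sub>F nhds (0 :: real ^ 'k)"
    have "((\<lambda>\<epsilon>. T \<epsilon> - \<theta>) \<longlongrightarrow> 0) (at_right 0)"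
      using tendsto_diff[OF T tendsto_const, of \<theta>] by simp
    then have t1: "filterlim (\<lambda>\<epsilon>. (\<epsilon>, T \<epsilon> - \<theta>)) ?L (at_right 0)"
      by (intro filterlim_Pair filterlim_ident)
    have "((\<lambda>\<epsilon>. \<epsilon> *\<^sub>R x) \<longlongrightarrow> 0 *\<^sub>R x) (at_right 0)"
      by (intro tendsto_intros)
    then have t2: "filterlim (\<lambda>\<epsilon>. (\<epsilon>, \<epsilon> *\<^sub>R x)) ?L (at_right 0)"
      by (intro filterlim_Pair filterlim_ident) simp
    note E = expansion[OF e(1), unfolded case_prod_unfold]
    from eventually_compose_filterlim[OF E t1] eventually_compose_filterlim[OF E t2]
      eventually_compose_filterlim[OF min[unfolded case_prod_unfold] t2] eventually_at_right_less[of 0]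
    show ?thesis
    proof eventually_elim
      case (elim \<epsilon>)
      define h where "h = T \<epsilon> - \<theta>"
      define k where "k = \<epsilon> *\<^sub>R x"
      have Hk: "y \<bullet> (H *v k) = - (\<epsilon> * (b \<bullet> y))" for y
        by (simp add: k_def matrix_vector_mult_scaleR x inner_commute)
      have *: "h \<bullet> (H *v h) / 2 + \<epsilon> * (b \<bullet> h) - (k \<bullet> (H *v k) / 2 + \<epsilon> * (b \<bullet> k))
         \<le> e * ((norm h)\<^sup>2 + \<epsilon>\<^sup>2) + e * ((norm k)\<^sup>2 + \<epsilon>\<^sup>2)"
        using elim by (simp add: h_def k_def)
      have "(h - k) \<bullet> (H *v (h - k)) / 2
          = h \<bullet> (H *v h) / 2 + \<epsilon> * (b \<bullet> h) - (k \<bullet> (H *v k) / 2 + \<epsilon> * (b \<bullet> k))"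
        using sym[of k h] Hk[of h] Hk[of k]
        by (simp add: matrix_vector_mult_diff_distrib inner_diff_left inner_diff_right field_simps)
      also note *
      finally have "m * (norm (h - k))\<^sup>2 / 2 \<le> e * ((norm h)\<^sup>2 + \<epsilon>\<^sup>2) + e * ((norm k)\<^sup>2 + \<epsilon>\<^sup>2)"
        using m(2)[of "h - k"] by linarith
      also have "\<dots> = e * ((norm h)\<^sup>2 + (norm k)\<^sup>2 + 2 * \<epsilon>\<^sup>2)"
        by (simp add: algebra_simps)
      also have "(norm h)\<^sup>2 \<le> 2 * (norm (h - k))\<^sup>2 + 2 * (norm k)\<^sup>2"
      proof -
        have "norm h \<le> norm (h - k) + norm k" using norm_triangle_ineq[of "h - k" k] by simp
        then have "(norm h)\<^sup>2 \<le> (norm (h - k) + norm k)\<^sup>2" by (intro power_mono) auto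
        also have "\<dots> \<le> 2 * (norm (h - k))\<^sup>2 + 2 * (norm k)\<^sup>2"
          using sum_squares_bound[of "norm (h-k)" "norm k"] by (simp add: power2_sum)
        finally show ?thesis .
      qed
      finally have "m * (norm (h - k))\<^sup>2 / 2 \<le> 2 * e * (norm (h - k))\<^sup>2 + e * (3 * (norm k)\<^sup>2 + 2 * \<epsilon>\<^sup>2)"
        using e by (simp add: algebra_simps)
      moreover have "2 * e * (norm (h - k))\<^sup>2 \<le> m / 4 * (norm (h - k))\<^sup>2"
        using e by (intro mult_right_mono) auto
      ultimately have "m / 4 * (norm (h - k))\<^sup>2 \<le> e * (3 * (norm k)\<^sup>2 + 2 * \<epsilon>\<^sup>2)"
        by argo
      moreover have "3 * (norm k)\<^sup>2 + 2 * \<epsilon>\<^sup>2 = K * \<epsilon>\<^sup>2"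
        by (simp add: K_def k_def power_mult_distrib algebra_simps)
      moreover have "h - k = \<epsilon> *\<^sub>R ((T \<epsilon> - \<theta>) /\<^sub>R \<epsilon> - x)"
        using elim by (simp add: h_def k_def scaleR_diff_right)
      then have "(norm (h - k))\<^sup>2 = \<epsilon>\<^sup>2 * (norm ((T \<epsilon> - \<theta>) /\<^sub>R \<epsilon> - x))\<^sup>2"
        by (simp only: norm_scaleR power_mult_distrib power2_abs)
      ultimately have "\<epsilon>\<^sup>2 * (m / 4 * (norm ((T \<epsilon> - \<theta>) /\<^sub>R \<epsilon> - x))\<^sup>2) \<le> \<epsilon>\<^sup>2 * (e * K)"
        by (simp only: mult_ac)
      then have "m / 4 * (norm ((T \<epsilon> - \<theta>) /\<^sub>R \<epsilon> - x))\<^sup>2 \<le> e * K"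
        using elim(4) by (simp add: mult_le_cancel_left_pos)
      then show ?case using m by (simp add: field_simps)
    qed
  qed
  show ?thesis
  proof (rule tendstoI)
    fix r :: real assume r: "r > 0"
    \<comment> \<open>\<open>m / 8\<close> allows the absorption, the other bound gives accuracy \<open>r\<close>\<close>
    define e where "e = min (m / 8) (m * r\<^sup>2 / (8 * K))"
    have e: "e > 0" "e \<le> m / 8" using m K r by (auto simp: e_def)
    have "4 * e * K / m \<le> 4 * (m * r\<^sup>2 / (8 * K)) * K / m"
      using m K by (intro divide_right_mono mult_right_mono mult_left_mono) (auto simp: e_def)
    also have "\<dots> < r\<^sup>2" using m K r by simp
    finally have *: "4 * e * K / m < r\<^sup>2" .
    show "\<forall>\<^sub>F \<epsilon> in at_right 0. dist ((T \<epsilon> - \<theta>) /\<^sub>R \<epsilon>) x < r"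
      using key[OF e]
    proof eventually_elim
      case (elim \<epsilon>)
      then have "(norm ((T \<epsilon> - \<theta>) /\<^sub>R \<epsilon> - x))\<^sup>2 < r\<^sup>2" using * by simp
      then show ?case using r by (simp add: dist_norm power_less_imp_less_base less_imp_le)
    qed
  qed
qed

section \<open>Generators near 1\<close>

lemma holder_generator_near_1:
  assumes "holder_generator \<gamma> \<phi>"
  shows "\<forall>\<^sub>F z in nhds 1. (\<phi> has_real_derivative deriv \<phi> z) (at z) \<and>
      (deriv \<phi> has_real_derivative deriv (deriv \<phi>) z) (at z) \<and> isCont (deriv (deriv \<phi>)) z"
proof -
  have "\<forall>\<^sub>F z in nhds 1. \<phi> differentiable (at z) \<and> deriv \<phi> differentiable (at z) \<and> isCont (deriv (deriv \<phi>)) z"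
    using assms by (simp add: holder_generator_def)
  then show ?thesis
    by eventually_elim (auto simp: DERIV_deriv_iff_real_differentiable)
qed

lemmas holder_generator_at_1 = eventually_nhds_x_imp_x[OF holder_generator_near_1]

text \<open>
  \<open>\<phi> z + z\<^sup>1\<^sup>+\<^sup>\<gamma>\<close> is non-negative and vanishes at 1, so 1 is a critical point of it.
\<close>

lemma holder_generator_deriv_1:
  assumes "holder_generator \<gamma> \<phi>"
  shows "deriv \<phi> 1 = - (1 + \<gamma>)"
proof -
  have "((\<lambda>z. \<phi> z + z powr (1 + \<gamma>)) has_real_derivative deriv \<phi> 1 + (1 + \<gamma>)) (at 1)"
    using holder_generator_at_1[OF assms] by (auto intro!: derivative_eq_intros)
  then have "deriv \<phi> 1 + (1 + \<gamma>) = 0"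
  proof (rule DERIV_local_min[where d = 1])
    show "\<forall>y. \<bar>1 - y\<bar> < 1 \<longrightarrow> \<phi> 1 + 1 powr (1 + \<gamma>) \<le> \<phi> y + y powr (1 + \<gamma>)"
    proof (intro allI impI)
      fix y :: real assume "\<bar>1 - y\<bar> < 1"
      then have "y \<ge> 0" by auto
      then have "- (y powr (1 + \<gamma>)) \<le> \<phi> y" using assms by (auto simp: holder_generator_def)
      then show "\<phi> 1 + 1 powr (1 + \<gamma>) \<le> \<phi> y + y powr (1 + \<gamma>)"
        using assms by (simp add: holder_generator_def)
    qed
  qed simp
  then show ?thesis by simp
qed

text \<open>
  Otherwise \<open>\<phi> z + z\<^sup>1\<^sup>+\<^sup>\<gamma>\<close>, which vanishes to first order at 1, would be negative just to the right
  of 1.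
\<close>

lemma holder_generator_second_deriv_ge:
  assumes \<gamma>: "\<gamma> > 0" and \<phi>: "holder_generator \<gamma> \<phi>"
  shows "deriv (deriv \<phi>) 1 \<ge> - \<gamma> * (1 + \<gamma>)"
proof (rule ccontr)
  assume "\<not> ?thesis"
  then have neg: "deriv (deriv \<phi>) 1 + (1 + \<gamma>) * \<gamma> < 0" by (simp add: algebra_simps)
  define G where "G z = \<phi> z + z powr (1 + \<gamma>)" for z
  define G' where "G' z = deriv \<phi> z + (1 + \<gamma>) * z powr \<gamma>" for z
  have G'1: "G' 1 = 0" by (simp add: G'_def holder_generator_deriv_1[OF \<phi>])
  have "(G' has_real_derivative deriv (deriv \<phi>) 1 + (1 + \<gamma>) * \<gamma>) (at 1)"
    unfolding G'_def using holder_generator_at_1[OF \<phi>] by (auto intro!: derivative_eq_intros)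
  from DERIV_neg_dec_right[OF this neg]
  obtain d where d: "d > 0" "\<And>h. 0 < h \<Longrightarrow> h < d \<Longrightarrow> G' (1 + h) < 0" using G'1 by auto
  obtain e where e: "e > 0" "\<And>z. dist z 1 < e \<Longrightarrow> (\<phi> has_real_derivative deriv \<phi> z) (at z)"
    using holder_generator_near_1[OF \<phi>] by (auto simp: eventually_nhds_metric)
  define h where "h = min d e / 2"
  have h: "0 < h" "h < d" "h < e" using d(1) e(1) by (auto simp: h_def)
  have "\<exists>z>1. z < 1 + h \<and> G (1 + h) - G 1 = (1 + h - 1) * G' z"
  proof (rule MVT2)
    fix z assume z: "1 \<le> z" "z \<le> 1 + h"
    have "(\<phi> has_real_derivative deriv \<phi> z) (at z)" using z h by (intro e) (auto simp: dist_real_def)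
    then show "(G has_real_derivative G' z) (at z)"
      unfolding G_def G'_def using z by (auto intro!: derivative_eq_intros)
  qed (use h in simp)
  then obtain z where z: "1 < z" "z < 1 + h" "G (1 + h) - G 1 = h * G' z" by auto
  have "G' z < 0" using d(2)[of "z - 1"] z h by simp
  then have "h * G' z < 0" using h by (simp add: mult_pos_neg)
  moreover have "G 1 = 0" using \<phi> by (simp add: G_def holder_generator_def)
  moreover have "- ((1 + h) powr (1 + \<gamma>)) \<le> \<phi> (1 + h)"
    using \<phi> h by (simp add: holder_generator_def)
  then have "G (1 + h) \<ge> 0" by (simp add: G_def)
  ultimately show False using z(3) by linarith
qed

text \<open>
  The base point \<open>y\<close> varies, but the second derivative is taken at 1. This uniformity, due to the
  continuity of the second derivative, is what expansions of the score around nearby parameters need.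
\<close>

lemma holder_generator_taylor:
  assumes \<phi>: "holder_generator \<gamma> \<phi>" and e: "e > 0"
  shows "\<forall>\<^sub>F (y, s) in nhds 1 \<times>\<^sub>F nhds 0.
    \<bar>\<phi> (y + s) - \<phi> y - s * deriv \<phi> y - deriv (deriv \<phi>) 1 / 2 * s\<^sup>2\<bar> \<le> e * s\<^sup>2"
proof -
  let ?D2 = "deriv (deriv \<phi>)"
  have "isCont ?D2 1" using holder_generator_at_1[OF \<phi>] by simp
  then have "\<forall>\<^sub>F z in nhds 1. dist (?D2 z) (?D2 1) < e"
    using e by (auto simp: continuous_at_eps_delta eventually_nhds_metric)
  with holder_generator_near_1[OF \<phi>]
  have "\<forall>\<^sub>F z in nhds 1. (\<phi> has_real_derivative deriv \<phi> z) (at z) \<and>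
      (deriv \<phi> has_real_derivative ?D2 z) (at z) \<and> dist (?D2 z) (?D2 1) < e"
    by eventually_elim auto
  then obtain d where d: "d > 0" and dd: "\<And>z. dist z 1 < d \<Longrightarrow> (\<phi> has_real_derivative deriv \<phi> z) (at z) \<and>
      (deriv \<phi> has_real_derivative ?D2 z) (at z) \<and> dist (?D2 z) (?D2 1) < e"
    by (auto simp: eventually_nhds_metric)
  have main: "\<bar>\<phi> (y + s) - \<phi> y - s * deriv \<phi> y - ?D2 1 / 2 * s\<^sup>2\<bar> \<le> e * s\<^sup>2"
    if y: "dist y 1 < d / 2" and s: "dist s 0 < d / 2" for y s
  proof -
    let ?S = "cball (0 :: real) \<bar>s\<bar>"
    have near: "dist (y + t) 1 < d" if "t \<in> ?S" for t
      using that y s unfolding dist_real_def mem_cball by arith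
    have 1: "\<bar>deriv \<phi> (y + t) - deriv \<phi> y - t * ?D2 1\<bar> \<le> e * \<bar>s\<bar>" if t: "t \<in> ?S" for t
    proof -
      have "norm ((deriv \<phi> (y + t) - t * ?D2 1) - (deriv \<phi> (y + 0) - 0 * ?D2 1)) \<le> e * norm (t - 0)"
      proof (rule field_differentiable_bound[where S = ?S and f' = "\<lambda>t. ?D2 (y + t) - ?D2 1"])
        fix t assume t: "t \<in> ?S"
        have *: "(deriv \<phi> has_real_derivative ?D2 (t + y)) (at (t + y))"
          using dd near[OF t] by (simp add: add.commute)
        have "((\<lambda>t. deriv \<phi> (y + t)) has_real_derivative ?D2 (y + t)) (at t)"
          using DERIV_shift[of "deriv \<phi>" _ t y] * by (simp add: add.commute)
        from this[THEN has_field_derivative_at_within]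
        show "((\<lambda>t. deriv \<phi> (y + t) - t * ?D2 1) has_real_derivative ?D2 (y + t) - ?D2 1) (at t within ?S)"
          by (auto intro!: derivative_eq_intros)
        show "norm (?D2 (y + t) - ?D2 1) \<le> e" using dd[OF near[OF t]] by (simp add: dist_real_def)
      qed (use t in auto)
      also have "e * norm (t - 0) \<le> e * \<bar>s\<bar>" using t e by (intro mult_left_mono) auto
      finally show ?thesis by simp
    qed
    have "norm ((\<phi> (y + s) - s * deriv \<phi> y - ?D2 1 / 2 * s\<^sup>2) - (\<phi> (y + 0) - 0 * deriv \<phi> y - ?D2 1 / 2 * 0\<^sup>2))
        \<le> (e * \<bar>s\<bar>) * norm (s - 0)"
    proof (rule field_differentiable_bound[where S = ?S and f' = "\<lambda>t. deriv \<phi> (y + t) - deriv \<phi> y - t * ?D2 1"])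
      fix t assume t: "t \<in> ?S"
      have *: "(\<phi> has_real_derivative deriv \<phi> (t + y)) (at (t + y))"
        using dd near[OF t] by (simp add: add.commute)
      have "((\<lambda>t. \<phi> (y + t)) has_real_derivative deriv \<phi> (y + t)) (at t)"
        using DERIV_shift[of \<phi> _ t y] * by (simp add: add.commute)
      from this[THEN has_field_derivative_at_within]
      show "((\<lambda>t. \<phi> (y + t) - t * deriv \<phi> y - ?D2 1 / 2 * t\<^sup>2) has_real_derivative
          deriv \<phi> (y + t) - deriv \<phi> y - t * ?D2 1) (at t within ?S)"
        by (auto intro!: derivative_eq_intros)
      show "norm (deriv \<phi> (y + t) - deriv \<phi> y - t * ?D2 1) \<le> e * \<bar>s\<bar>" using 1[OF t] by simp
    qed auto
    then show ?thesis by (simp add: power2_eq_square algebra_simps abs_mult_self_eq)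
  qed
  have a: "\<forall>\<^sub>F y in nhds (1::real). dist y 1 < d / 2" "\<forall>\<^sub>F s in nhds (0::real). dist s 0 < d / 2"
    using d by (auto simp: eventually_nhds_metric intro: exI[of _ "d/2"])
  show ?thesis
    using eventually_prodI[OF a] by (rule eventually_mono) (use main in auto)
qed

section \<open>The contaminated score to second order\<close>

lemma eventually_prod_fst:
  "eventually P F \<Longrightarrow> \<forall>\<^sub>F z in F \<times>\<^sub>F G. P (fst z)"
  by (rule eventually_compose_filterlim[OF _ filterlim_fst])

lemma eventually_prod_snd:
  "eventually P G \<Longrightarrow> \<forall>\<^sub>F z in F \<times>\<^sub>F G. P (snd z)"
  by (rule eventually_compose_filterlim[OF _ filterlim_snd])

text \<open>
  With \<open>r = u / v\<close> and \<open>q = (g - u) / v\<close> the contaminated score is \<open>\<phi> (r + \<epsilon> q) v\<close>, so Taylor's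
  formula for \<open>\<phi>\<close> gives \<open>\<phi> (r) v + \<epsilon> M + \<epsilon>\<^sup>2 N + o(\<epsilon>\<^sup>2)\<close> with \<open>M = (g - u) \<phi>' (r)\<close> and
  \<open>N = \<phi>'' 1 q\<^sup>2 v / 2\<close>. Differentiability of \<open>M\<close> at \<open>\<theta>\<close> yields the mixed term \<open>b\<close>, and mere continuity of
  \<open>N\<close> makes the increment of \<open>\<epsilon>\<^sup>2 N\<close> negligible.
  
  The quadratic part is assumed for a generator \<open>\<psi>\<close> that may differ from \<open>\<phi>\<close>: as both agree to second
  order at 1 and \<open>r - 1 = O(|h|)\<close>, the uncontaminated scores of \<open>\<phi>\<close> and \<open>\<psi>\<close> agree up to \<open>o(|h|\<^sup>2)\<close>. This
  is the source of the equality of asymptotic variances.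
\<close>

lemma contaminated_score_expansion:
  fixes u v g :: "real ^ 'k \<Rightarrow> real" and H :: "real ^ 'k ^ 'k"
  defines "S \<equiv> \<lambda>\<zeta> \<epsilon> t. \<zeta> (((1 - \<epsilon>) * u t + \<epsilon> * g t) / v t) * v t"
  assumes \<phi>: "holder_generator \<gamma> \<phi>" and \<psi>: "holder_generator \<gamma> \<psi>"
    and \<kappa>: "deriv (deriv \<phi>) 1 = \<kappa>" "deriv (deriv \<psi>) 1 = \<kappa>"
    and Du: "(u has_derivative Du) (at \<theta>)" and Dv: "(v has_derivative Dv) (at \<theta>)"
    and Dg: "(g has_derivative Dg) (at \<theta>)"
    and uv: "u \<theta> = v \<theta>" "v \<theta> > 0"
    and b: "\<And>h. b \<bullet> h = - (1 + \<gamma>) * (Dg h - Du h) + \<kappa> * (g \<theta> - v \<theta>) * ((Du h - Dv h) / v \<theta>)"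
    and quad: "\<And>e. e > 0 \<Longrightarrow>
      \<forall>\<^sub>F h in nhds 0. \<bar>S \<psi> 0 (\<theta> + h) - S \<psi> 0 \<theta> - h \<bullet> (H *v h) / 2\<bar> \<le> e * (norm h)\<^sup>2"
    and e: "e > 0"
  shows "\<forall>\<^sub>F (\<epsilon>, h) in at_right 0 \<times>\<^sub>F nhds 0.
      \<bar>S \<phi> \<epsilon> (\<theta> + h) - S \<phi> \<epsilon> \<theta> - h \<bullet> (H *v h) / 2 - \<epsilon> * (b \<bullet> h)\<bar> \<le> e * ((norm h)\<^sup>2 + \<epsilon>\<^sup>2)"
proof -
  let ?L = "at_right (0::real) \<times>\<^sub>F nhds (0 :: real ^ 'k)"
  define V where "V = v \<theta>"
  have V: "V > 0" "v \<theta> = V" "u \<theta> = V" using uv by (auto simp: V_def)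
  define r where "r t = u t / v t" for t
  define q where "q t = (g t - u t) / v t" for t
  have r1: "r \<theta> = 1" using V by (simp add: r_def)
  have Dr: "(r has_derivative (\<lambda>h. (Du h - Dv h) / V)) (at \<theta>)"
    unfolding r_def using V
    by (auto intro!: derivative_eq_intros Du Dv simp: fun_eq_iff field_simps)
  have \<phi>1: "\<phi> 1 = - 1" "\<psi> 1 = - 1" using \<phi> \<psi> by (auto simp: holder_generator_def)
  have d\<phi>: "deriv \<phi> 1 = - (1 + \<gamma>)" "deriv \<psi> 1 = - (1 + \<gamma>)"
    by (rule holder_generator_deriv_1[OF \<phi>], rule holder_generator_deriv_1[OF \<psi>])
  define M where "M t = (g t - u t) * deriv \<phi> (r t)" for t
  define N where "N t = \<kappa> / 2 * (v t * (q t)\<^sup>2)" for t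
  have "(deriv \<phi> has_real_derivative \<kappa>) (at (r \<theta>))"
    using holder_generator_at_1[OF \<phi>] by (simp add: \<kappa> r1)
  then have "((\<lambda>t. deriv \<phi> (r t)) has_derivative (\<lambda>h. \<kappa> * ((Du h - Dv h) / V))) (at \<theta>)"
    unfolding has_field_derivative_def by (rule has_derivative_compose[OF Dr])
  then have DM: "(M has_derivative (\<lambda>h. b \<bullet> h)) (at \<theta>)"
    unfolding M_def
    by (auto intro!: derivative_eq_intros Du Dg simp: fun_eq_iff b r1 d\<phi> V algebra_simps)
  have cont: "isCont u \<theta>" "isCont v \<theta>" "isCont g \<theta>" "isCont r \<theta>"
    using Du Dv Dg Dr by (auto intro: has_derivative_continuous)
  then have contq: "isCont q \<theta>" "isCont N \<theta>" "isCont (\<lambda>t. v t * (q t)\<^sup>2) \<theta>"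
    unfolding q_def N_def using V by (auto intro!: continuous_intros)
  have shift: "((\<lambda>h. f (\<theta> + h)) \<longlongrightarrow> f \<theta>) (nhds 0)" if "isCont f \<theta>" for f :: "real ^ 'k \<Rightarrow> real"
  proof -
    have "filterlim (\<lambda>h. \<theta> + h) (nhds \<theta>) (nhds 0)"
      using tendsto_add[OF tendsto_const[of \<theta>] filterlim_ident[of "nhds (0 :: real ^ 'k)"]] by simp
    moreover have "filterlim f (nhds (f \<theta>)) (nhds \<theta>)"
      using that by (simp add: continuous_at tendsto_at_iff_tendsto_nhds)
    ultimately show ?thesis by (rule filterlim_compose[rotated])
  qed
  \<comment> \<open>exchanging the generators costs \<open>o((r - 1)\<^sup>2)\<close>, which is \<open>o(|h|\<^sup>2)\<close>\<close>
  obtain C where C: "C > 0" "\<forall>\<^sub>F h in nhds 0. \<bar>r (\<theta> + h) - r \<theta>\<bar> \<le> C * norm h"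
    using has_derivative_lipschitz[OF Dr] by blast
  define e1 where "e1 = e / (16 * V * C\<^sup>2)"
  have e1: "e1 > 0" using e V C by (simp add: e1_def)
  have vb: "\<forall>\<^sub>F h in nhds 0. 0 < v (\<theta> + h) \<and> v (\<theta> + h) < 2 * V"
    using order_tendstoD[OF shift[OF cont(2)]] V by (auto intro: eventually_conj)
  have T: "\<forall>\<^sub>F h in nhds 0. \<bar>\<zeta> (r (\<theta> + h)) + 1 - (r (\<theta> + h) - 1) * (- (1 + \<gamma>)) - \<kappa> / 2 * (r (\<theta> + h) - 1)\<^sup>2\<bar>
      \<le> e1 * (r (\<theta> + h) - 1)\<^sup>2"
    if \<zeta>: "holder_generator \<gamma> \<zeta>" "deriv (deriv \<zeta>) 1 = \<kappa>" for \<zeta>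
  proof -
    have "((\<lambda>h. r (\<theta> + h) - 1) \<longlongrightarrow> 1 - 1) (nhds 0)"
      using shift[OF cont(4)] r1 by (intro tendsto_intros) simp
    then have "filterlim (\<lambda>h. (1, r (\<theta> + h) - 1)) (nhds 1 \<times>\<^sub>F nhds 0) (nhds 0)"
      by (intro filterlim_Pair tendsto_const) simp
    from eventually_compose_filterlim[OF holder_generator_taylor[OF \<zeta>(1) e1] this]
    show ?thesis
    proof (rule eventually_mono)
      fix h
      assume *: "case (1, r (\<theta> + h) - 1) of (y, s) \<Rightarrow>
          \<bar>\<zeta> (y + s) - \<zeta> y - s * deriv \<zeta> y - deriv (deriv \<zeta>) 1 / 2 * s\<^sup>2\<bar> \<le> e1 * s\<^sup>2"
      have "\<zeta> 1 = - 1" using \<zeta>(1) by (simp add: holder_generator_def)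
      then show "\<bar>\<zeta> (r (\<theta> + h)) + 1 - (r (\<theta> + h) - 1) * (- (1 + \<gamma>)) - \<kappa> / 2 * (r (\<theta> + h) - 1)\<^sup>2\<bar>
          \<le> e1 * (r (\<theta> + h) - 1)\<^sup>2"
        using * holder_generator_deriv_1[OF \<zeta>(1)] unfolding prod.case \<zeta>(2) by simp
    qed
  qed
  have change: "\<forall>\<^sub>F h in nhds 0. \<bar>S \<phi> 0 (\<theta> + h) - S \<psi> 0 (\<theta> + h)\<bar> \<le> e / 4 * (norm h)\<^sup>2"
    using T[OF \<phi> \<kappa>(1)] T[OF \<psi> \<kappa>(2)] C(2) vb
  proof eventually_elim
    case (elim h)
    have "\<bar>\<phi> (r (\<theta> + h)) - \<psi> (r (\<theta> + h))\<bar> \<le> 2 * e1 * (r (\<theta> + h) - 1)\<^sup>2"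
      using elim(1,2) by linarith
    also have "(r (\<theta> + h) - 1)\<^sup>2 \<le> (C * norm h)\<^sup>2"
      using elim(3) r1 by (intro power2_le_iff_abs_le[THEN iffD2]) (use C in auto)
    finally have "\<bar>\<phi> (r (\<theta> + h)) - \<psi> (r (\<theta> + h))\<bar> * v (\<theta> + h) \<le> (2 * e1 * (C * norm h)\<^sup>2) * (2 * V)"
      using elim(4) e1 by (intro mult_mono) auto
    also have "\<dots> = e / 4 * (norm h)\<^sup>2"
      using V C by (simp add: e1_def power_mult_distrib)
    also have "\<bar>\<phi> (r (\<theta> + h)) - \<psi> (r (\<theta> + h))\<bar> * v (\<theta> + h) = \<bar>S \<phi> 0 (\<theta> + h) - S \<psi> 0 (\<theta> + h)\<bar>"
      using elim(4) by (simp add: S_def r_def abs_mult left_diff_distrib[symmetric])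
    finally show ?case .
  qed
  have S\<theta>: "S \<phi> 0 \<theta> = S \<psi> 0 \<theta>" using V by (simp add: S_def \<phi>1)
  \<comment> \<open>an upper bound of \<open>v q\<^sup>2\<close> near \<open>\<theta>\<close>\<close>
  define B where "B = V * (q \<theta>)\<^sup>2 + 1"
  have B: "B > 0" using V by (simp add: B_def add_nonneg_pos)
  define e2 where "e2 = e / (8 * B)"
  have e2: "e2 > 0" using e B by (simp add: e2_def)
  have Bb: "\<forall>\<^sub>F h in nhds 0. v (\<theta> + h) * (q (\<theta> + h))\<^sup>2 < B"
    using order_tendstoD(2)[OF shift[OF contq(3)], of B] V by (simp add: B_def)
  define R where "R \<epsilon> t = S \<phi> \<epsilon> t - S \<phi> 0 t - \<epsilon> * M t - \<epsilon>\<^sup>2 * N t" for \<epsilon> t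
  have R: "\<forall>\<^sub>F z in ?L. \<bar>R (fst z) (\<theta> + snd z)\<bar> \<le> e / 8 * (fst z)\<^sup>2"
  proof -
    have a: "filterlim fst (nhds 0) ?L"
      by (rule filterlim_mono[OF filterlim_fst at_within_le_nhds order_refl])
    have "((\<lambda>z. fst z * q (\<theta> + snd z)) \<longlongrightarrow> 0 * q \<theta>) ?L"
      by (intro tendsto_mult a filterlim_compose[OF shift[OF contq(1)] filterlim_snd])
    then have "filterlim (\<lambda>z. (r (\<theta> + snd z), fst z * q (\<theta> + snd z))) (nhds 1 \<times>\<^sub>F nhds 0) ?L"
      using filterlim_compose[OF shift[OF cont(4)] filterlim_snd] r1 by (intro filterlim_Pair) auto
    from eventually_compose_filterlim[OF holder_generator_taylor[OF \<phi> e2] this]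
      eventually_prod_snd[OF vb] eventually_prod_snd[OF Bb]
    show ?thesis
    proof eventually_elim
      case (elim z)
      define \<epsilon> where "\<epsilon> = fst z" define t where "t = \<theta> + snd z"
      have v: "v t > 0" using elim(2) by (simp add: t_def)
      have "((1 - \<epsilon>) * u t + \<epsilon> * g t) / v t = r t + \<epsilon> * q t"
        using v by (simp add: r_def q_def field_simps)
      moreover have "M t = v t * (q t * deriv \<phi> (r t))" using v by (simp add: M_def q_def)
      ultimately have "R \<epsilon> t = v t * (\<phi> (r t + \<epsilon> * q t) - \<phi> (r t) - \<epsilon> * q t * deriv \<phi> (r t) - \<kappa> / 2 * (\<epsilon> * q t)\<^sup>2)"
        by (simp add: R_def S_def N_def r_def power_mult_distrib algebra_simps)
      also have "\<bar>\<dots>\<bar> \<le> v t * (e2 * (\<epsilon> * q t)\<^sup>2)"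
        unfolding abs_mult using v elim(1) \<kappa> by (intro mult_mono) (auto simp: \<epsilon>_def t_def)
      also have "\<dots> = e2 * (v t * (q t)\<^sup>2) * \<epsilon>\<^sup>2" by (simp add: power_mult_distrib)
      also have "\<dots> \<le> e2 * B * \<epsilon>\<^sup>2"
        using elim(3) e2 by (intro mult_right_mono mult_left_mono) (auto simp: t_def)
      also have "e2 * B = e / 8" using B by (simp add: e2_def)
      finally show ?case by (simp add: \<epsilon>_def t_def)
    qed
  qed
  have R0: "\<forall>\<^sub>F z in ?L. \<bar>R (fst z) \<theta>\<bar> \<le> e / 8 * (fst z)\<^sup>2"
  proof -
    have "filterlim (\<lambda>z. (fst z, 0)) ?L ?L"
      by (intro filterlim_Pair filterlim_fst tendsto_const)
    from eventually_compose_filterlim[OF R this] show ?thesis by simp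
  qed
  have "e / 4 > 0" using e by simp
  note inc = has_derivative_increment[OF DM this] and quad' = quad[OF this]
  have Nb: "\<forall>\<^sub>F h in nhds 0. dist (N (\<theta> + h)) (N \<theta>) < e / 4"
    by (intro tendstoD shift contq) (use e in simp)
  have pos: "\<forall>\<^sub>F z in ?L. 0 < fst z"
    by (rule eventually_prod_fst) (simp add: eventually_at_right_less)
  from R R0 eventually_prod_snd[OF inc] eventually_prod_snd[OF quad']
    eventually_prod_snd[OF Nb] pos eventually_prod_snd[OF change]
  show ?thesis
  proof eventually_elim
    case (elim z)
    obtain \<epsilon> h where z: "z = (\<epsilon>, h)" by (cases z)
    note elim = elim[unfolded z fst_conv snd_conv]
    \<comment> \<open>the sources of error: generator, quadratic part, mixed term, \<open>\<epsilon>\<^sup>2\<close>-term, Taylor remainders\<close>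
    have id: "S \<phi> \<epsilon> (\<theta> + h) - S \<phi> \<epsilon> \<theta> - h \<bullet> (H *v h) / 2 - \<epsilon> * (b \<bullet> h)
       = (S \<phi> 0 (\<theta> + h) - S \<psi> 0 (\<theta> + h)) + (S \<psi> 0 (\<theta> + h) - S \<psi> 0 \<theta> - h \<bullet> (H *v h) / 2)
         + \<epsilon> * (M (\<theta> + h) - M \<theta> - b \<bullet> h) + \<epsilon>\<^sup>2 * (N (\<theta> + h) - N \<theta>) + R \<epsilon> (\<theta> + h) - R \<epsilon> \<theta>"
      by (simp add: R_def S\<theta> algebra_simps)
    have a1: "\<bar>\<epsilon> * (M (\<theta> + h) - M \<theta> - b \<bullet> h)\<bar> \<le> e / 8 * ((norm h)\<^sup>2 + \<epsilon>\<^sup>2)"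
    proof -
      have "\<bar>\<epsilon> * (M (\<theta> + h) - M \<theta> - b \<bullet> h)\<bar> \<le> \<epsilon> * (e / 4 * norm h)"
        unfolding abs_mult using elim by (intro mult_mono) auto
      also have "\<dots> = e / 8 * (2 * norm h * \<epsilon>)" by simp
      also have "\<dots> \<le> e / 8 * ((norm h)\<^sup>2 + \<epsilon>\<^sup>2)"
        using e sum_squares_bound by (intro mult_left_mono) auto
      finally show ?thesis .
    qed
    have a2: "\<bar>\<epsilon>\<^sup>2 * (N (\<theta> + h) - N \<theta>)\<bar> \<le> \<epsilon>\<^sup>2 * (e / 4)"
      unfolding abs_mult using elim(5) by (intro mult_mono) (auto simp: dist_real_def)
    have "e / 8 * (norm h)\<^sup>2 \<ge> 0" "e / 8 * \<epsilon>\<^sup>2 \<ge> 0" using e by auto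
    moreover have "e / 8 * ((norm h)\<^sup>2 + \<epsilon>\<^sup>2) = e / 8 * (norm h)\<^sup>2 + e / 8 * \<epsilon>\<^sup>2"
      "e * ((norm h)\<^sup>2 + \<epsilon>\<^sup>2) = 8 * (e / 8 * (norm h)\<^sup>2) + 8 * (e / 8 * \<epsilon>\<^sup>2)"
      "e / 4 * (norm h)\<^sup>2 = 2 * (e / 8 * (norm h)\<^sup>2)" "\<epsilon>\<^sup>2 * (e / 4) = 2 * (e / 8 * \<epsilon>\<^sup>2)"
      by (auto simp: algebra_simps)
    ultimately show ?case
      unfolding z prod.case id using elim(1,2,4,7) a1 a2 by linarith
  qed
qed

section \<open>The influence function of a regular model\<close>

text \<open>
  Young's inequality with exponents \<open>1 + \<gamma>\<close> and \<open>(1 + \<gamma>) / \<gamma>\<close>; equivalently, \<open>f\<^sup>1\<^sup>+\<^sup>\<gamma>\<close> lies above its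
  tangent at \<open>g\<close>.
\<close>

lemma young_power:
  fixes f g \<gamma> :: real
  assumes "\<gamma> > 0" "f > 0" "g > 0"
  shows "(1 + \<gamma>) * (f * g powr \<gamma>) \<le> f powr (1 + \<gamma>) + \<gamma> * g powr (1 + \<gamma>)"
proof -
  define a where "a = 1 / (1 + \<gamma>)"
  have a: "(1 + \<gamma>) * a = 1" "(1 + \<gamma>) * (\<gamma> * a) = \<gamma>" using assms by (auto simp: a_def)
  have "(f powr (1 + \<gamma>)) powr a * (g powr (1 + \<gamma>)) powr (\<gamma> * a)
      \<le> a * f powr (1 + \<gamma>) + (\<gamma> * a) * g powr (1 + \<gamma>)"
    using assms by (intro Youngs_inequality_0) (auto simp: a_def field_simps)
  then have "f * g powr \<gamma> \<le> a * f powr (1 + \<gamma>) + (\<gamma> * a) * g powr (1 + \<gamma>)"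
    using assms by (simp add: powr_powr a)
  then have "(1 + \<gamma>) * (f * g powr \<gamma>) \<le> (1 + \<gamma>) * (a * f powr (1 + \<gamma>) + (\<gamma> * a) * g powr (1 + \<gamma>))"
    using assms by (intro mult_left_mono) auto
  also have "\<dots> = ((1 + \<gamma>) * a) * f powr (1 + \<gamma>) + ((1 + \<gamma>) * (\<gamma> * a)) * g powr (1 + \<gamma>)"
    by (simp only: distrib_left mult.assoc)
  finally show ?thesis by (simp add: a)
qed

locale holder_model =
  fixes \<gamma> :: real and \<psi> :: "real \<Rightarrow> real" and \<Theta> :: "(real ^ 'k) set"
    and p :: "real ^ 'k \<Rightarrow> real ^ 'd \<Rightarrow> real"
  assumes \<gamma>: "\<gamma> > 0"
    and generator: "holder_generator \<gamma> \<psi>"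
    and model: "statistical_model \<Theta> p"
    and conditions: "model_conditions \<psi> \<gamma> \<Theta> p"
begin

text \<open>
  \<open>V\<close>, \<open>U\<close> and \<open>w\<close> are the functionals \<open>\<langle>p\<^sub>t\<^sup>1\<^sup>+\<^sup>\<gamma>\<rangle>\<close>, \<open>\<langle>p\<^sub>\<theta> p\<^sub>t\<^sup>\<gamma>\<rangle>\<close> and \<open>\<langle>p\<^sub>\<theta>\<^sup>1\<^sup>+\<^sup>\<gamma> s\<^sub>\<theta>\<rangle>\<close> through which the model
  enters the score and its first derivatives.
\<close>

definition V :: "real ^ 'k \<Rightarrow> real" where
  "V t = (\<integral>x. p t x powr (1 + \<gamma>) \<partial>lborel)"

definition U :: "real ^ 'k \<Rightarrow> real ^ 'k \<Rightarrow> real" where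
  "U \<theta> t = (\<integral>x. p \<theta> x * p t x powr \<gamma> \<partial>lborel)"

definition w :: "real ^ 'k \<Rightarrow> real ^ 'k" where
  "w \<theta> = (\<integral>x. (p \<theta> x powr (1 + \<gamma>)) *\<^sub>R score_function p \<theta> x \<partial>lborel)"

lemma open_parameters: "open \<Theta>"
  using model by (simp add: statistical_model_def)

lemma density:
  assumes "\<theta> \<in> \<Theta>"
  shows "p \<theta> \<in> borel_measurable borel" "0 < p \<theta> x"
    "prob_space (density lborel (\<lambda>x. ennreal (p \<theta> x)))" "(\<lambda>t. p t x) differentiable (at \<theta>)"
  using model assms by (auto simp: statistical_model_def)

lemma integrable_power:
  assumes "t \<in> \<Theta>"
  shows "integrable lborel (\<lambda>x. p t x powr (1 + \<gamma>))"
  using conditions assms by (auto simp: model_conditions_def L_plus_def)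

lemma V_pos:
  assumes "t \<in> \<Theta>"
  shows "V t > 0"
proof -
  have "V t \<noteq> 0"
  proof
    assume "V t = 0"
    then have "AE x in lborel. p t x powr (1 + \<gamma>) = 0"
      using integral_nonneg_eq_0_iff_AE[OF integrable_power[OF assms]] by (simp add: V_def)
    then have "AE x in lborel. p t x = 0" by (auto elim!: eventually_mono)
    then show False using conditions assms by (auto simp: model_conditions_def L_plus_def)
  qed
  moreover have "V t \<ge> 0" unfolding V_def by (intro integral_nonneg_AE) simp
  ultimately show ?thesis by simp
qed

lemma integrable_cross:
  assumes "\<theta> \<in> \<Theta>" "t \<in> \<Theta>"
  shows "integrable lborel (\<lambda>x. p \<theta> x * p t x powr \<gamma>)"
proof (rule Bochner_Integration.integrable_bound)
  show "integrable lborel (\<lambda>x. p \<theta> x powr (1 + \<gamma>) + \<gamma> * p t x powr (1 + \<gamma>))"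
    using assms by (intro Bochner_Integration.integrable_add integrable_mult_right integrable_power)
  show "(\<lambda>x. p \<theta> x * p t x powr \<gamma>) \<in> borel_measurable lborel"
    using density(1)[OF assms(1)] density(1)[OF assms(2)] by simp
  show "AE x in lborel. norm (p \<theta> x * p t x powr \<gamma>) \<le> norm (p \<theta> x powr (1 + \<gamma>) + \<gamma> * p t x powr (1 + \<gamma>))"
  proof (rule AE_I2)
    fix x
    have pos: "p \<theta> x > 0" "p t x > 0" using density(2) assms by auto
    then have "1 * (p \<theta> x * p t x powr \<gamma>) \<le> (1 + \<gamma>) * (p \<theta> x * p t x powr \<gamma>)"
      using \<gamma> by (intro mult_right_mono) auto
    also have "\<dots> \<le> p \<theta> x powr (1 + \<gamma>) + \<gamma> * p t x powr (1 + \<gamma>)"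
      by (rule young_power[OF \<gamma> pos])
    finally show "norm (p \<theta> x * p t x powr \<gamma>) \<le> norm (p \<theta> x powr (1 + \<gamma>) + \<gamma> * p t x powr (1 + \<gamma>))"
      using pos by simp
  qed
qed

lemma U_nonneg:
  assumes "\<theta> \<in> \<Theta>" "t \<in> \<Theta>"
  shows "U \<theta> t \<ge> 0"
  unfolding U_def using density(2)[OF assms(1)] by (intro integral_nonneg_AE) (auto simp: less_imp_le)

lemma U_diag:
  assumes "\<theta> \<in> \<Theta>"
  shows "U \<theta> \<theta> = V \<theta>"
  unfolding U_def V_def using density(2)[OF assms] by (simp add: powr_add less_imp_le)

lemma holder_score_eq: "holder_score \<zeta> \<gamma> (p \<theta>) (p t) = \<zeta> (U \<theta> t / V t) * V t"
  by (simp add: holder_score_def U_def V_def)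

text \<open>
  Integrating the tangent inequality at \<open>c p\<^sub>t\<close> with \<open>c = r = U \<theta> t / V t\<close> gives \<open>r\<^sup>1\<^sup>+\<^sup>\<gamma> V t \<le> V \<theta>\<close>, a form
  of Hoelder's inequality; the lower bound on the generator turns this into minimality.
\<close>

lemma holder_score_minimal:
  assumes "\<theta> \<in> \<Theta>" "t \<in> \<Theta>"
  shows "holder_score \<psi> \<gamma> (p \<theta>) (p \<theta>) \<le> holder_score \<psi> \<gamma> (p \<theta>) (p t)"
proof -
  have V: "V \<theta> > 0" "V t > 0" using V_pos assms by auto
  have tangent: "(1 + \<gamma>) * c powr \<gamma> * U \<theta> t \<le> V \<theta> + \<gamma> * c powr (1 + \<gamma>) * V t" if "c > 0" for c
  proof -
    have "(\<integral>x. (1 + \<gamma>) * c powr \<gamma> * (p \<theta> x * p t x powr \<gamma>) \<partial>lborel)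
        \<le> (\<integral>x. p \<theta> x powr (1 + \<gamma>) + \<gamma> * c powr (1 + \<gamma>) * p t x powr (1 + \<gamma>) \<partial>lborel)"
    proof (rule integral_mono)
      fix x
      have pos: "p \<theta> x > 0" "p t x > 0" using density(2) assms by auto
      then show "(1 + \<gamma>) * c powr \<gamma> * (p \<theta> x * p t x powr \<gamma>)
          \<le> p \<theta> x powr (1 + \<gamma>) + \<gamma> * c powr (1 + \<gamma>) * p t x powr (1 + \<gamma>)"
        using young_power[OF \<gamma> pos(1), of "c * p t x"] \<open>c > 0\<close> by (simp add: powr_mult mult_ac)
    qed (use assms in \<open>auto intro!: integrable_mult_right integrable_cross integrable_power\<close>)
    then show ?thesis
      using assms by (simp add: U_def V_def integrable_cross integrable_power)
  qed
  define r where "r = U \<theta> t / V t"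
  have r: "r \<ge> 0" using U_nonneg[OF assms] V by (simp add: r_def)
  have "r powr (1 + \<gamma>) * V t \<le> V \<theta>"
  proof (cases "r = 0")
    case False
    with r have "r > 0" by simp
    have "(1 + \<gamma>) * r powr \<gamma> * (r * V t) \<le> V \<theta> + \<gamma> * r powr (1 + \<gamma>) * V t"
      using tangent[OF \<open>r > 0\<close>] V by (simp add: r_def)
    then show ?thesis using \<open>r > 0\<close> by (simp add: powr_add algebra_simps)
  qed (use V in simp)
  moreover have "- (r powr (1 + \<gamma>)) * V t \<le> \<psi> r * V t"
    using generator r V by (intro mult_right_mono) (auto simp: holder_generator_def)
  moreover have "\<psi> 1 = - 1" using generator by (simp add: holder_generator_def)
  ultimately show ?thesis
    using V by (simp add: holder_score_eq U_diag[OF assms(1)] r_def)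
qed

lemma contaminated_score_eq:
  assumes "\<theta> \<in> \<Theta>" "t \<in> \<Theta>" "0 \<le> \<epsilon>" "\<epsilon> \<le> 1"
  shows "contaminated_score \<zeta> \<gamma> p \<theta> z \<epsilon> t
    = \<zeta> (((1 - \<epsilon>) * U \<theta> t + \<epsilon> * p t z powr \<gamma>) / V t) * V t"
proof -
  let ?P = "density lborel (\<lambda>x. ennreal (p \<theta> x))"
  note [measurable] = density(1)[OF assms(1)] density(1)[OF assms(2)]
  have pos: "p \<theta> x \<ge> 0" for x using density(2)[OF assms(1)] by (simp add: less_imp_le)
  have int: "integrable ?P (\<lambda>x. p t x powr \<gamma>)"
    using integrable_cross[OF assms(1,2)] pos by (subst integrable_density) (auto simp: mult.commute)
  have "(\<integral>x. p t x powr \<gamma> \<partial>contaminate \<epsilon> z ?P) = (1 - \<epsilon>) * (\<integral>x. p t x powr \<gamma> \<partial>?P) + \<epsilon> * p t z powr \<gamma>"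
    using density(3)[OF assms(1)] assms(3,4) int by (intro integral_contaminate) auto
  also have "(\<integral>x. p t x powr \<gamma> \<partial>?P) = U \<theta> t"
    unfolding U_def using pos by (subst integral_density) auto
  finally show ?thesis
    by (simp add: contaminated_score_def holder_score_distr_def V_def)
qed

lemma density_has_derivative:
  assumes "\<theta> \<in> \<Theta>"
  shows "((\<lambda>t. p t x) has_derivative (\<lambda>h. p \<theta> x * (score_function p \<theta> x \<bullet> h))) (at \<theta>)"
proof -
  obtain D where D: "((\<lambda>t. p t x) has_derivative D) (at \<theta>)"
    using density(4)[OF assms] by (auto simp: differentiable_def)
  have pos: "p \<theta> x > 0" using density(2)[OF assms] .
  have "((\<lambda>t. ln (p t x)) has_derivative (\<lambda>h. D h / p \<theta> x)) (at \<theta>)"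
    using D pos by (auto intro!: derivative_eq_intros simp: divide_inverse)
  from inner_gradient[OF this] have "score_function p \<theta> x \<bullet> h = D h / p \<theta> x" for h
    by (simp add: gradient_def score_function_def)
  then have "D = (\<lambda>h. p \<theta> x * (score_function p \<theta> x \<bullet> h))" using pos by (auto simp: fun_eq_iff)
  with D show ?thesis by simp
qed

lemma power_has_derivative:
  assumes "\<theta> \<in> \<Theta>"
  shows "((\<lambda>t. p t x powr c) has_derivative (\<lambda>h. c * (p \<theta> x powr c * (score_function p \<theta> x \<bullet> h)))) (at \<theta>)"
proof -
  have pos: "p \<theta> x > 0" using density(2)[OF assms] .
  show ?thesis
    using pos by (auto intro!: derivative_eq_intros density_has_derivative[OF assms]
        simp: fun_eq_iff powr_diff)
qed

lemma under_integral:
  assumes "\<theta> \<in> \<Theta>"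
  shows "differentiable_under_integral_at (\<lambda>t x. p t x powr (1 + \<gamma>)) \<theta>"
    "differentiable_under_integral_at (\<lambda>t x. p \<theta> x * p t x powr \<gamma>) \<theta>"
  using conditions assms by (auto simp: model_conditions_def dest: eventually_nhds_x_imp_x)

lemma integrable_weighted_score:
  assumes "\<theta> \<in> \<Theta>"
  shows "integrable lborel (\<lambda>x. (p \<theta> x powr (1 + \<gamma>)) *\<^sub>R score_function p \<theta> x)"
proof -
  have *: "frechet_derivative (\<lambda>t. p t x powr (1 + \<gamma>)) (at \<theta>)
      = (\<lambda>h. (1 + \<gamma>) * (p \<theta> x powr (1 + \<gamma>) * (score_function p \<theta> x \<bullet> h)))" for x
    using frechet_derivative_at[OF power_has_derivative[OF assms]] by metis
  have "integrable lborel (\<lambda>x. (1 + \<gamma>) * (p \<theta> x powr (1 + \<gamma>) * (score_function p \<theta> x \<bullet> h)))" for h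
    using under_integral(1)[OF assms] unfolding differentiable_under_integral_at_def * by blast
  then have "integrable lborel (\<lambda>x. p \<theta> x powr (1 + \<gamma>) * (score_function p \<theta> x \<bullet> h))" for h
    using \<gamma> by (simp add: integrable_mult_right_iff)
  then have "integrable lborel (\<lambda>x. \<Sum>e\<in>Basis. (p \<theta> x powr (1 + \<gamma>) * (score_function p \<theta> x \<bullet> e)) *\<^sub>R e)"
    by (intro Bochner_Integration.integrable_sum integrable_scaleR_left)
  moreover have "(\<Sum>e\<in>Basis. (p \<theta> x powr (1 + \<gamma>) * (score_function p \<theta> x \<bullet> e)) *\<^sub>R e)
      = (p \<theta> x powr (1 + \<gamma>)) *\<^sub>R score_function p \<theta> x" for x
    using euclidean_representation[of "(p \<theta> x powr (1 + \<gamma>)) *\<^sub>R score_function p \<theta> x"] by simp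
  ultimately show ?thesis by simp
qed

lemma inner_w:
  assumes "\<theta> \<in> \<Theta>"
  shows "(\<integral>x. p \<theta> x powr (1 + \<gamma>) * (score_function p \<theta> x \<bullet> h) \<partial>lborel) = w \<theta> \<bullet> h"
  unfolding w_def using integral_inner_left[OF integrable_weighted_score[OF assms], of h] by simp

text \<open>
  Differentiation under the integral replaces \<open>p\<^sub>t\<^sup>1\<^sup>+\<^sup>\<gamma>\<close> by its derivative \<open>(1 + \<gamma>) p\<^sub>\<theta>\<^sup>1\<^sup>+\<^sup>\<gamma> (s\<^sub>\<theta> \<bullet> h)\<close>. At the
  diagonal the same weight \<open>p\<^sub>\<theta>\<^sup>1\<^sup>+\<^sup>\<gamma>\<close> appears in the derivative of \<open>U \<theta>\<close>, so that both derivatives are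
  multiples of the single vector \<open>w \<theta>\<close>.
\<close>

lemma V_has_derivative:
  assumes "\<theta> \<in> \<Theta>"
  shows "(V has_derivative (\<lambda>h. (1 + \<gamma>) * (w \<theta> \<bullet> h))) (at \<theta>)"
proof -
  have *: "frechet_derivative (\<lambda>t. p t x powr (1 + \<gamma>)) (at \<theta>)
      = (\<lambda>h. (1 + \<gamma>) * (p \<theta> x powr (1 + \<gamma>) * (score_function p \<theta> x \<bullet> h)))" for x
    using frechet_derivative_at[OF power_has_derivative[OF assms]] by metis
  show ?thesis
    using under_integral(1)[OF assms]
    unfolding differentiable_under_integral_at_def * V_def[symmetric, abs_def]
    by (simp add: inner_w[OF assms])
qed

lemma U_has_derivative:
  assumes "\<theta> \<in> \<Theta>"
  shows "(U \<theta> has_derivative (\<lambda>h. \<gamma> * (w \<theta> \<bullet> h))) (at \<theta>)"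
proof -
  have pos: "p \<theta> x > 0" for x using density(2)[OF assms] .
  have "((\<lambda>t. p \<theta> x * p t x powr \<gamma>) has_derivative
      (\<lambda>h. \<gamma> * (p \<theta> x powr (1 + \<gamma>) * (score_function p \<theta> x \<bullet> h)))) (at \<theta>)" for x
    by (rule has_derivative_eq_rhs[OF has_derivative_mult_right[OF power_has_derivative[OF assms]]])
       (use pos[of x] in \<open>auto simp: powr_add fun_eq_iff\<close>)
  then have *: "frechet_derivative (\<lambda>t. p \<theta> x * p t x powr \<gamma>) (at \<theta>)
      = (\<lambda>h. \<gamma> * (p \<theta> x powr (1 + \<gamma>) * (score_function p \<theta> x \<bullet> h)))" for x
    using frechet_derivative_at by metis
  show ?thesis
    using under_integral(2)[OF assms]
    unfolding differentiable_under_integral_at_def * U_def[symmetric, abs_def]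
    by (simp add: inner_w[OF assms])
qed

definition Hess :: "real ^ 'k \<Rightarrow> real ^ 'k ^ 'k" where
  "Hess \<theta> = hessian (\<lambda>t. holder_score \<psi> \<gamma> (p \<theta>) (p t)) \<theta>"

lemma twice_differentiable_score:
  assumes "\<theta> \<in> \<Theta>"
  shows "twice_differentiable_at (\<lambda>t. holder_score \<psi> \<gamma> (p \<theta>) (p t)) \<theta>" "invertible (Hess \<theta>)"
  using conditions assms by (auto simp: model_conditions_def Hess_def)

lemma Hess_symmetric:
  assumes "\<theta> \<in> \<Theta>"
  shows "x \<bullet> (Hess \<theta> *v y) = y \<bullet> (Hess \<theta> *v x)"
  unfolding Hess_def by (rule hessian_symmetric[OF twice_differentiable_score(1)[OF assms]])

lemma score_gradient_zero:
  assumes "\<theta> \<in> \<Theta>"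
  shows "gradient (\<lambda>t. holder_score \<psi> \<gamma> (p \<theta>) (p t)) \<theta> = 0"
proof -
  let ?F = "\<lambda>t. holder_score \<psi> \<gamma> (p \<theta>) (p t)"
  have "?F differentiable (at \<theta>)"
    using twice_differentiable_score(1)[OF assms]
    by (auto simp: twice_differentiable_at_def dest: eventually_nhds_x_imp_x)
  then obtain D where D: "(?F has_derivative D) (at \<theta>)" by (auto simp: differentiable_def)
  have "D = (\<lambda>v. 0)"
    using differential_zero_maxmin[OF assms open_parameters D] holder_score_minimal[OF assms] by auto
  then have "gradient ?F \<theta> \<bullet> k = 0" for k using inner_gradient[OF D] by simp
  then show ?thesis by (metis inner_eq_zero_iff)
qed

lemma score_quadratic_expansion:
  assumes \<theta>: "\<theta> \<in> \<Theta>" and e: "e > 0"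
  shows "\<forall>\<^sub>F h in nhds 0. \<bar>holder_score \<psi> \<gamma> (p \<theta>) (p (\<theta> + h)) - holder_score \<psi> \<gamma> (p \<theta>) (p \<theta>)
      - h \<bullet> (Hess \<theta> *v h) / 2\<bar> \<le> e * (norm h)\<^sup>2"
proof -
  let ?F = "\<lambda>t. holder_score \<psi> \<gamma> (p \<theta>) (p t)"
  obtain d where "d > 0" and d: "\<And>x k. norm x + norm k < d \<Longrightarrow>
       \<bar>?F (\<theta> + x + k) - ?F (\<theta> + x) - gradient ?F \<theta> \<bullet> k - x \<bullet> (hessian ?F \<theta> *v k)
         - k \<bullet> (hessian ?F \<theta> *v k) / 2\<bar> \<le> e * norm k * (norm x + norm k)"
    using twice_differentiable_increment[OF twice_differentiable_score(1)[OF \<theta>] e] by metis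
  show ?thesis
    unfolding eventually_nhds_metric
  proof (intro exI conjI allI impI)
    fix h :: "real ^ 'k" assume "dist h 0 < d"
    then show "\<bar>?F (\<theta> + h) - ?F \<theta> - h \<bullet> (Hess \<theta> *v h) / 2\<bar> \<le> e * (norm h)\<^sup>2"
      using d[of 0 h] by (simp add: score_gradient_zero[OF \<theta>] Hess_def power2_eq_square mult.assoc)
  qed fact
qed

text \<open>
  The score is minimal at \<open>\<theta>\<close> and its gradient vanishes there, so the quadratic term dominates along
  every ray.
\<close>

lemma Hess_pos_semidef:
  assumes \<theta>: "\<theta> \<in> \<Theta>"
  shows "0 \<le> x \<bullet> (Hess \<theta> *v x)"
proof -
  let ?F = "\<lambda>t. holder_score \<psi> \<gamma> (p \<theta>) (p t)"
  let ?q = "x \<bullet> (Hess \<theta> *v x)"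
  have "- ?q \<le> 2 * e * (norm x)\<^sup>2" if e: "e > 0" for e
  proof -
    have "((\<lambda>s. s *\<^sub>R x) \<longlongrightarrow> 0 *\<^sub>R x) (at_right 0)" by (intro tendsto_intros)
    then have lim: "((\<lambda>s. s *\<^sub>R x) \<longlongrightarrow> 0) (at_right 0)" by simp
    have "((\<lambda>s. \<theta> + s *\<^sub>R x) \<longlongrightarrow> \<theta> + 0) (at_right 0)" by (intro tendsto_intros lim)
    then have mem: "\<forall>\<^sub>F s in at_right 0. \<theta> + s *\<^sub>R x \<in> \<Theta>"
      using topological_tendstoD[OF _ open_parameters] \<theta> by force
    from eventually_happens'[OF trivial_limit_at_right_real
        eventually_conj[OF eventually_compose_filterlim[OF score_quadratic_expansion[OF \<theta> e] lim]
          eventually_conj[OF mem eventually_at_right_less[of 0]]]]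
    obtain s where s: "s > 0" "\<theta> + s *\<^sub>R x \<in> \<Theta>"
      "\<bar>?F (\<theta> + s *\<^sub>R x) - ?F \<theta> - (s *\<^sub>R x) \<bullet> (Hess \<theta> *v (s *\<^sub>R x)) / 2\<bar> \<le> e * (norm (s *\<^sub>R x))\<^sup>2"
      by blast
    have "?F \<theta> \<le> ?F (\<theta> + s *\<^sub>R x)" by (rule holder_score_minimal[OF \<theta> s(2)])
    then have "- ((s *\<^sub>R x) \<bullet> (Hess \<theta> *v (s *\<^sub>R x)) / 2) \<le> e * (norm (s *\<^sub>R x))\<^sup>2"
      using s(3) by linarith
    then have "s\<^sup>2 * (- ?q) \<le> s\<^sup>2 * (2 * e * (norm x)\<^sup>2)"
      by (simp add: matrix_vector_mult_scaleR power_mult_distrib power2_eq_square algebra_simps)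
    then show ?thesis using s(1) by (simp only: mult_le_cancel_left_pos zero_less_power)
  qed
  then have "\<forall>\<^sub>F e in at_right 0. - ?q \<le> 2 * e * (norm x)\<^sup>2"
    by (auto simp: eventually_at_filter)
  moreover have "((\<lambda>e. 2 * e * (norm x)\<^sup>2) \<longlongrightarrow> 2 * 0 * (norm x)\<^sup>2) (at_right 0)"
    by (intro tendsto_intros)
  ultimately have "- ?q \<le> 2 * 0 * (norm x)\<^sup>2"
    by (intro tendsto_lowerbound[OF _ _ trivial_limit_at_right_real])
  then show ?thesis by simp
qed

lemma Hess_injective:
  assumes "\<theta> \<in> \<Theta>" "Hess \<theta> *v x = Hess \<theta> *v y"
  shows "x = y"
  using inj_matrix_vector_mult[OF twice_differentiable_score(2)[OF assms(1)]] assms(2) by (auto dest: injD)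

lemma Hess_pos_def:
  assumes \<theta>: "\<theta> \<in> \<Theta>" and x: "x \<noteq> 0"
  shows "0 < x \<bullet> (Hess \<theta> *v x)"
proof -
  have "x \<bullet> (Hess \<theta> *v x) \<noteq> 0"
    using psd_inner_zero_imp_kernel[of "Hess \<theta>" x, OF Hess_symmetric[OF \<theta>] Hess_pos_semidef[OF \<theta>]]
      Hess_injective[OF \<theta>, of x 0] x by auto
  then show ?thesis using Hess_pos_semidef[OF \<theta>, of x] by simp
qed

text \<open>
  The coefficient of \<open>\<epsilon>\<close> in the gradient of the contaminated score at \<open>\<theta>\<close>: the influence function is
  \<open>- I\<^sup>-\<^sup>1\<close> applied to it, where \<open>I\<close> is \<open>Hess \<theta>\<close>.
\<close>

definition drift :: "real ^ 'k \<Rightarrow> real ^ 'd \<Rightarrow> real ^ 'k" where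
  "drift \<theta> z = - (\<gamma> * (1 + \<gamma>)) *\<^sub>R ((p \<theta> z powr \<gamma>) *\<^sub>R score_function p \<theta> z - w \<theta>)
     - (deriv (deriv \<psi>) 1 * (p \<theta> z powr \<gamma> - V \<theta>) / V \<theta>) *\<^sub>R w \<theta>"

text \<open>
  The generator \<open>\<phi>\<close> of the estimator and the generator \<open>\<psi>\<close> whose Hessian describes it are kept apart,
  so that one Hessian serves all generators with the same second derivative at 1.
\<close>

lemma influence_limit:
  assumes \<phi>: "holder_generator \<gamma> \<phi>" "deriv (deriv \<phi>) 1 = deriv (deriv \<psi>) 1"
    and wd: "perturbation_well_defined \<phi> \<gamma> \<Theta> p" and \<theta>: "\<theta> \<in> \<Theta>"
    and x: "Hess \<theta> *v x = - drift \<theta> z"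
  shows "((\<lambda>\<epsilon>. (perturbed_parameter \<phi> \<gamma> \<Theta> p \<theta> z \<epsilon> - \<theta>) /\<^sub>R \<epsilon>) \<longlongrightarrow> x) (at_right 0)"
proof -
  let ?T = "perturbed_parameter \<phi> \<gamma> \<Theta> p \<theta> z"
  let ?S = "\<lambda>\<zeta> \<epsilon> t. \<zeta> (((1 - \<epsilon>) * U \<theta> t + \<epsilon> * p t z powr \<gamma>) / V t) * V t"
  have wd1: "\<forall>\<^sub>F \<epsilon> in at_right 0. \<exists>!t. is_arg_min (contaminated_score \<phi> \<gamma> p \<theta> z \<epsilon>) (\<lambda>t. t \<in> \<Theta>) t"
    and wd2: "(?T \<longlongrightarrow> \<theta>) (at_right 0)"
    using wd \<theta> unfolding perturbation_well_defined_def by blast+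
  show ?thesis
  proof (rule perturbed_minimizer_derivative[where F = "?S \<phi>", OF Hess_symmetric[OF \<theta>] Hess_pos_def[OF \<theta>] _ wd2 _ x])
    fix e :: real assume e: "e > 0"
    show "\<forall>\<^sub>F (\<epsilon>, h) in at_right 0 \<times>\<^sub>F nhds 0.
        \<bar>?S \<phi> \<epsilon> (\<theta> + h) - ?S \<phi> \<epsilon> \<theta> - h \<bullet> (Hess \<theta> *v h) / 2 - \<epsilon> * (drift \<theta> z \<bullet> h)\<bar> \<le> e * ((norm h)\<^sup>2 + \<epsilon>\<^sup>2)"
    proof (rule contaminated_score_expansion[OF \<phi>(1) generator \<phi>(2) refl U_has_derivative[OF \<theta>]
          V_has_derivative[OF \<theta>] power_has_derivative[OF \<theta>] U_diag[OF \<theta>] V_pos[OF \<theta>] _ _ e])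
      fix h
      show "drift \<theta> z \<bullet> h = - (1 + \<gamma>) * (\<gamma> * (p \<theta> z powr \<gamma> * (score_function p \<theta> z \<bullet> h)) - \<gamma> * (w \<theta> \<bullet> h)) +
          deriv (deriv \<psi>) 1 * (p \<theta> z powr \<gamma> - V \<theta>) * ((\<gamma> * (w \<theta> \<bullet> h) - (1 + \<gamma>) * (w \<theta> \<bullet> h)) / V \<theta>)"
        using V_pos[OF \<theta>] unfolding drift_def inner_diff_left inner_scaleR_left by (simp add: field_simps)
    next
      fix e :: real assume "e > 0"
      from score_quadratic_expansion[OF \<theta> this]
      show "\<forall>\<^sub>F h in nhds 0. \<bar>?S \<psi> 0 (\<theta> + h) - ?S \<psi> 0 \<theta> - h \<bullet> (Hess \<theta> *v h) / 2\<bar> \<le> e * (norm h)\<^sup>2"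
        by (simp add: holder_score_eq)
    qed
  next
    have "filterlim (\<lambda>h. \<theta> + h) (nhds (\<theta> + 0)) (nhds 0)"
      by (intro tendsto_intros filterlim_ident)
    then have mem: "\<forall>\<^sub>F h in nhds 0. \<theta> + h \<in> \<Theta>"
      using topological_tendstoD[OF _ open_parameters] \<theta> by force
    have "\<forall>\<^sub>F \<epsilon> in at_right (0::real). \<epsilon> < 1" by (rule eventually_at_right_real[THEN eventually_mono]) auto
    with wd1 eventually_at_right_less[of 0]
    have "\<forall>\<^sub>F \<epsilon> in at_right 0. 0 < \<epsilon> \<and> \<epsilon> < 1 \<and>
        is_arg_min (contaminated_score \<phi> \<gamma> p \<theta> z \<epsilon>) (\<lambda>t. t \<in> \<Theta>) (?T \<epsilon>)"
    proof eventually_elim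
      case (elim \<epsilon>)
      then show ?case
        unfolding perturbed_parameter_def arg_min_on_def arg_min_def by (metis someI_ex)
    qed
    from eventually_prodI[OF this mem]
    show "\<forall>\<^sub>F (\<epsilon>, h) in at_right 0 \<times>\<^sub>F nhds 0. ?S \<phi> \<epsilon> (?T \<epsilon>) \<le> ?S \<phi> \<epsilon> (\<theta> + h)"
    proof (rule eventually_mono)
      fix y :: "real \<times> (real ^ 'k)" obtain \<epsilon> h where y: "y = (\<epsilon>, h)" by (cases y)
      assume *: "(0 < fst y \<and> fst y < 1 \<and>
        is_arg_min (contaminated_score \<phi> \<gamma> p \<theta> z (fst y)) (\<lambda>t. t \<in> \<Theta>) (?T (fst y))) \<and> \<theta> + snd y \<in> \<Theta>"
      then have "?T \<epsilon> \<in> \<Theta>" "\<theta> + h \<in> \<Theta>" "0 \<le> \<epsilon>" "\<epsilon> \<le> 1"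
        "contaminated_score \<phi> \<gamma> p \<theta> z \<epsilon> (?T \<epsilon>) \<le> contaminated_score \<phi> \<gamma> p \<theta> z \<epsilon> (\<theta> + h)"
        by (auto simp: y is_arg_min_def not_less)
      then show "case y of (\<epsilon>, h) \<Rightarrow> ?S \<phi> \<epsilon> (?T \<epsilon>) \<le> ?S \<phi> \<epsilon> (\<theta> + h)"
        by (simp add: y contaminated_score_eq[OF \<theta>])
    qed
  qed
qed

lemma influence_function_iff:
  assumes \<phi>: "holder_generator \<gamma> \<phi>" "deriv (deriv \<phi>) 1 = deriv (deriv \<psi>) 1"
    and wd: "perturbation_well_defined \<phi> \<gamma> \<Theta> p" and \<theta>: "\<theta> \<in> \<Theta>"
  shows "has_influence_function \<phi> \<gamma> \<Theta> p \<theta> IF \<longleftrightarrow> (\<forall>z. Hess \<theta> *v IF z = - drift \<theta> z)"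
proof -
  have "((\<lambda>\<epsilon>. (perturbed_parameter \<phi> \<gamma> \<Theta> p \<theta> z \<epsilon> - \<theta>) /\<^sub>R \<epsilon>) \<longlongrightarrow> IF z) (at_right 0)
      \<longleftrightarrow> Hess \<theta> *v IF z = - drift \<theta> z" for z
  proof -
    obtain B where B: "Hess \<theta> ** B = mat 1"
      using twice_differentiable_score(2)[OF \<theta>] unfolding invertible_def by blast
    define x where "x = B *v (- drift \<theta> z)"
    have x: "Hess \<theta> *v x = - drift \<theta> z"
      by (simp only: x_def matrix_vector_mul_assoc B matrix_vector_mul_lid)
    note lim = influence_limit[OF \<phi> wd \<theta> x]
    show ?thesis
    proof
      assume "((\<lambda>\<epsilon>. (perturbed_parameter \<phi> \<gamma> \<Theta> p \<theta> z \<epsilon> - \<theta>) /\<^sub>R \<epsilon>) \<longlongrightarrow> IF z) (at_right 0)"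
      then have "IF z = x" by (rule tendsto_unique[OF trivial_limit_at_right_real _ lim])
      then show "Hess \<theta> *v IF z = - drift \<theta> z" by (simp add: x)
    next
      assume "Hess \<theta> *v IF z = - drift \<theta> z"
      then show "((\<lambda>\<epsilon>. (perturbed_parameter \<phi> \<gamma> \<Theta> p \<theta> z \<epsilon> - \<theta>) /\<^sub>R \<epsilon>) \<longlongrightarrow> IF z) (at_right 0)"
        by (rule influence_limit[OF \<phi> wd \<theta>])
    qed
  qed
  then show ?thesis unfolding has_influence_function_def by simp
qed

lemma weights_tendsto_0:
  assumes "\<theta> \<in> \<Theta>"
  shows "((\<lambda>z. p \<theta> z powr \<gamma>) \<longlongrightarrow> 0) at_infinity"
    "((\<lambda>z. (p \<theta> z powr \<gamma>) *\<^sub>R score_function p \<theta> z) \<longlongrightarrow> 0) at_infinity"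
proof -
  have "(p \<theta> \<longlongrightarrow> 0) at_infinity" using conditions assms by (simp add: model_conditions_def)
  from tendsto_powr'[OF this tendsto_const, of \<gamma>] show "((\<lambda>z. p \<theta> z powr \<gamma>) \<longlongrightarrow> 0) at_infinity"
    using \<gamma> density(2)[OF assms] by (auto simp: less_imp_le)
  show "((\<lambda>z. (p \<theta> z powr \<gamma>) *\<^sub>R score_function p \<theta> z) \<longlongrightarrow> 0) at_infinity"
    using conditions assms by (simp add: model_conditions_def)
qed

text \<open>
  Far away the point \<open>z\<close> carries no weight: \<open>p\<^sub>\<theta>(z)\<^sup>\<gamma>\<close> and \<open>p\<^sub>\<theta>(z)\<^sup>\<gamma> s\<^sub>\<theta>(z)\<close> tend to zero, which leaves the
  contributions of \<open>w\<close>.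
\<close>

lemma drift_limit:
  assumes \<theta>: "\<theta> \<in> \<Theta>"
  shows "(drift \<theta> \<longlongrightarrow> (deriv (deriv \<psi>) 1 + \<gamma> * (1 + \<gamma>)) *\<^sub>R w \<theta>) at_infinity"
proof -
  have "(drift \<theta> \<longlongrightarrow> - (\<gamma> * (1 + \<gamma>)) *\<^sub>R (0 - w \<theta>)
     - (deriv (deriv \<psi>) 1 * (0 - V \<theta>) / V \<theta>) *\<^sub>R w \<theta>) at_infinity"
    unfolding drift_def using V_pos[OF \<theta>] by (intro tendsto_intros weights_tendsto_0[OF \<theta>]) auto
  also have "- (\<gamma> * (1 + \<gamma>)) *\<^sub>R (0 - w \<theta>) - (deriv (deriv \<psi>) 1 * (0 - V \<theta>) / V \<theta>) *\<^sub>R w \<theta>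
      = (deriv (deriv \<psi>) 1 + \<gamma> * (1 + \<gamma>)) *\<^sub>R w \<theta>"
    using V_pos[OF \<theta>] by (simp add: scaleR_left_distrib)
  finally show ?thesis .
qed

text \<open>
  The matrices \<open>Hess \<theta>\<close> are invertible, so the influence function vanishes at infinity exactly when the
  drift does, and \<open>w \<theta>\<close> is non-zero for some \<open>\<theta>\<close>.
\<close>

lemma redescending_iff:
  assumes wd: "perturbation_well_defined \<psi> \<gamma> \<Theta> p"
  shows "redescending \<psi> \<gamma> \<Theta> p \<longleftrightarrow> deriv (deriv \<psi>) 1 = - \<gamma> * (1 + \<gamma>)"
proof
  assume R: "redescending \<psi> \<gamma> \<Theta> p"
  obtain \<theta> where \<theta>: "\<theta> \<in> \<Theta>" and w: "w \<theta> \<noteq> 0"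
    using conditions unfolding model_conditions_def w_def by blast
  obtain IF where IF: "has_influence_function \<psi> \<gamma> \<Theta> p \<theta> IF" "((\<lambda>z. norm (IF z)) \<longlongrightarrow> 0) at_infinity"
    using R \<theta> unfolding redescending_def by blast
  have "drift \<theta> = (\<lambda>z. - (Hess \<theta> *v IF z))"
    using influence_function_iff[OF generator refl wd \<theta>] IF(1) by auto
  moreover have "((\<lambda>z. - (Hess \<theta> *v IF z)) \<longlongrightarrow> - (Hess \<theta> *v 0)) at_infinity"
    by (intro tendsto_minus bounded_linear.tendsto[OF matrix_vector_mul_bounded_linear]
        tendsto_norm_zero_cancel[OF IF(2)])
  ultimately have "(drift \<theta> \<longlongrightarrow> 0) at_infinity" by simp
  from tendsto_unique[OF trivial_limit_at_infinity drift_limit[OF \<theta>] this]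
  have "deriv (deriv \<psi>) 1 + \<gamma> * (1 + \<gamma>) = 0" using w by simp
  then have "deriv (deriv \<psi>) 1 = - (\<gamma> * (1 + \<gamma>))" by (rule eq_neg_iff_add_eq_0[THEN iffD2])
  then show "deriv (deriv \<psi>) 1 = - \<gamma> * (1 + \<gamma>)" by (simp only: minus_mult_left)
next
  assume \<kappa>: "deriv (deriv \<psi>) 1 = - \<gamma> * (1 + \<gamma>)"
  show "redescending \<psi> \<gamma> \<Theta> p"
    unfolding redescending_def
  proof
    fix \<theta> assume \<theta>: "\<theta> \<in> \<Theta>"
    obtain B where B: "Hess \<theta> ** B = mat 1"
      using twice_differentiable_score(2)[OF \<theta>] unfolding invertible_def by blast
    define IF where "IF z = B *v (- drift \<theta> z)" for z
    have "Hess \<theta> *v IF z = - drift \<theta> z" for z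
      by (simp only: IF_def matrix_vector_mul_assoc B matrix_vector_mul_lid)
    then have "has_influence_function \<psi> \<gamma> \<Theta> p \<theta> IF"
      using influence_function_iff[OF generator refl wd \<theta>] by simp
    moreover have "(drift \<theta> \<longlongrightarrow> 0) at_infinity" using drift_limit[OF \<theta>] \<kappa> by simp
    then have "(IF \<longlongrightarrow> B *v (- 0)) at_infinity"
      unfolding IF_def by (intro bounded_linear.tendsto[OF matrix_vector_mul_bounded_linear] tendsto_minus)
    then have "((\<lambda>z. norm (IF z)) \<longlongrightarrow> 0) at_infinity" by (simp add: tendsto_norm_zero)
    ultimately show "\<exists>IF. has_influence_function \<psi> \<gamma> \<Theta> p \<theta> IF \<and> ((\<lambda>z. norm (IF z)) \<longlongrightarrow> 0) at_infinity"
      by (intro exI[of _ IF] conjI)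
  qed
qed

end

text \<open>
  Both influence functions solve the same linear equation \<open>Hess \<theta> *v IF z = - drift \<theta> z\<close>.
\<close>

lemma asymptotic_variance_cong:
  assumes "\<gamma> > 0" and \<phi>: "holder_generator \<gamma> \<phi>" and \<psi>: "holder_generator \<gamma> \<psi>"
    and eq: "deriv (deriv \<phi>) 1 = deriv (deriv \<psi>) 1"
    and "statistical_model \<Theta> p" "model_conditions \<psi> \<gamma> \<Theta> p"
    and wd: "perturbation_well_defined \<phi> \<gamma> \<Theta> p" "perturbation_well_defined \<psi> \<gamma> \<Theta> p"
    and \<theta>: "\<theta> \<in> \<Theta>"
  shows "has_asymptotic_variance \<phi> \<gamma> \<Theta> p \<theta> V \<longleftrightarrow> has_asymptotic_variance \<psi> \<gamma> \<Theta> p \<theta> V"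
proof -
  interpret holder_model \<gamma> \<psi> \<Theta> p using assms by unfold_locales
  show ?thesis
    unfolding has_asymptotic_variance_def influence_function_iff[OF \<phi> eq wd(1) \<theta>]
      influence_function_iff[OF \<psi> refl wd(2) \<theta>] ..
qed

section \<open>Stability of strict minima\<close>

lemma eventually_nhds_ball_compact:
  assumes K: "compact K"
    and P: "\<And>k. k \<in> K \<Longrightarrow> \<forall>\<^sub>F (x, y) in nhds x0 \<times>\<^sub>F nhds k. P x y"
  shows "\<forall>\<^sub>F x in nhds x0. \<forall>k\<in>K. P x k"
proof -
  have "\<exists>A B. eventually A (nhds x0) \<and> open B \<and> k \<in> B \<and> (\<forall>x y. A x \<longrightarrow> y \<in> B \<longrightarrow> P x y)"
    if k: "k \<in> K" for k
  proof -
    obtain A B where "eventually A (nhds x0)" "eventually B (nhds k)" "\<forall>x y. A x \<longrightarrow> B y \<longrightarrow> P x y"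
      using P[OF k] unfolding eventually_prod_filter by auto
    moreover from this(2) obtain S where "open S" "k \<in> S" "\<forall>y\<in>S. B y"
      unfolding eventually_nhds by blast
    ultimately show ?thesis by blast
  qed
  then obtain A B where AB: "\<And>k. k \<in> K \<Longrightarrow> eventually (A k) (nhds x0)" "\<And>k. k \<in> K \<Longrightarrow> open (B k)"
    "\<And>k. k \<in> K \<Longrightarrow> k \<in> B k" "\<And>k x y. k \<in> K \<Longrightarrow> A k x \<Longrightarrow> y \<in> B k \<Longrightarrow> P x y"
    by metis
  obtain C where C: "C \<subseteq> K" "finite C" "K \<subseteq> (\<Union>k\<in>C. B k)"
  proof (rule compactE_image[OF K, of K B])
    show "K \<subseteq> (\<Union>k\<in>K. B k)" using AB(3) by blast
  qed (use AB(2) in auto)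
  have "\<forall>\<^sub>F x in nhds x0. \<forall>k\<in>C. A k x"
    using C AB by (intro eventually_ball_finite) auto
  then show ?thesis
    by (rule eventually_mono) (use C AB in blast)
qed

text \<open>
  On a small sphere around \<open>\<theta>\<close> the function \<open>G f0\<close> exceeds \<open>G f0 \<theta>\<close>, and by compactness so does \<open>G f\<close>
  for \<open>f\<close> near \<open>f0\<close>. Hence \<open>G f\<close> has a minimum over the closed ball inside the sphere; it is local, and
  by hypothesis local minima are strict global ones.
\<close>

lemma strict_minimum_stable:
  fixes G :: "'f::topological_space \<Rightarrow> 'a::euclidean_space \<Rightarrow> real"
  assumes \<Theta>: "open \<Theta>" "\<theta> \<in> \<Theta>"
    and strict: "\<forall>\<^sub>F f in nhds f0. \<forall>x\<in>\<Theta>. (\<forall>\<^sub>F y in nhds x. G f x \<le> G f y) \<longrightarrow> (\<forall>y\<in>\<Theta>. y \<noteq> x \<longrightarrow> G f x < G f y)"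
    and min0: "\<And>y. y \<in> \<Theta> \<Longrightarrow> y \<noteq> \<theta> \<Longrightarrow> G f0 \<theta> < G f0 y"
    and cont: "\<And>y. y \<in> \<Theta> \<Longrightarrow> ((\<lambda>z. G (fst z) (snd z)) \<longlongrightarrow> G f0 y) (nhds f0 \<times>\<^sub>F nhds y)"
    and cont_on: "\<forall>\<^sub>F f in nhds f0. continuous_on \<Theta> (G f)"
    and \<rho>: "\<rho> > 0"
  shows "\<forall>\<^sub>F f in nhds f0. \<exists>x\<in>\<Theta>. dist x \<theta> < \<rho> \<and> (\<forall>y\<in>\<Theta>. y \<noteq> x \<longrightarrow> G f x < G f y)"
proof -
  obtain \<rho>' where \<rho>': "\<rho>' > 0" "cball \<theta> \<rho>' \<subseteq> \<Theta>"
    using \<Theta> by (auto simp: open_contains_cball)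
  define r where "r = min \<rho>' (\<rho> / 2)"
  have r: "r > 0" "r < \<rho>" "cball \<theta> r \<subseteq> \<Theta>" using \<rho> \<rho>' by (auto simp: r_def)
  have "\<forall>\<^sub>F f in nhds f0. \<forall>y\<in>sphere \<theta> r. G f \<theta> < G f y"
  proof (rule eventually_nhds_ball_compact[OF compact_sphere])
    fix y assume y: "y \<in> sphere \<theta> r"
    then have y': "y \<in> \<Theta>" "y \<noteq> \<theta>" using r by auto
    \<comment> \<open>continuity of \<open>G\<close> at \<open>(f0, \<theta>)\<close>, with the second argument frozen at \<open>\<theta>\<close>\<close>
    have "filterlim (\<lambda>z. (fst z, \<theta>)) (nhds f0 \<times>\<^sub>F nhds \<theta>) (nhds f0 \<times>\<^sub>F nhds y)"
      by (intro filterlim_Pair filterlim_fst tendsto_const)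
    from filterlim_compose[OF cont[OF \<Theta>(2)] this]
    have "((\<lambda>z. G (fst z) \<theta>) \<longlongrightarrow> G f0 \<theta>) (nhds f0 \<times>\<^sub>F nhds y)" by simp
    with cont[OF y'(1)] have "((\<lambda>z. G (fst z) (snd z) - G (fst z) \<theta>) \<longlongrightarrow> G f0 y - G f0 \<theta>) (nhds f0 \<times>\<^sub>F nhds y)"
      by (rule tendsto_diff)
    from order_tendstoD(1)[OF this, of 0] min0[OF y']
    show "\<forall>\<^sub>F (f, y) in nhds f0 \<times>\<^sub>F nhds y. G f \<theta> < G f y" by (simp add: case_prod_unfold)
  qed
  with strict cont_on show ?thesis
  proof eventually_elim
    case (elim f)
    obtain x where x: "x \<in> cball \<theta> r" and xmin: "\<And>y. y \<in> cball \<theta> r \<Longrightarrow> G f x \<le> G f y"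
      using continuous_attains_inf[OF compact_cball, of \<theta> r "G f"] continuous_on_subset[OF elim(2) r(3)] r by force
    have "G f x \<le> G f \<theta>" using xmin[of \<theta>] r by simp
    then have "x \<notin> sphere \<theta> r" using elim(3) by (meson not_le)
    then have xb: "x \<in> ball \<theta> r" using x by auto
    then have "\<forall>\<^sub>F y in nhds x. y \<in> ball \<theta> r" by (intro eventually_nhds_in_open) auto
    then have "\<forall>\<^sub>F y in nhds x. G f x \<le> G f y" by (rule eventually_mono) (auto intro: xmin)
    moreover have "x \<in> \<Theta>" using x r by auto
    moreover have "dist x \<theta> < \<rho>" using xb r by (simp add: dist_commute)
    ultimately show ?case using elim(1) by blast
  qed
qed

lemma critical_point_strict_minimum_1D:
  fixes g g' g'' :: "real \<Rightarrow> real"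
  assumes L: "L > 0"
    and g: "\<And>s. 0 \<le> s \<Longrightarrow> s \<le> L \<Longrightarrow> (g has_real_derivative g' s) (at s)"
    and g': "\<And>s. 0 \<le> s \<Longrightarrow> s \<le> L \<Longrightarrow> (g' has_real_derivative g'' s) (at s)"
    and pos: "\<And>s. 0 \<le> s \<Longrightarrow> s \<le> L \<Longrightarrow> g'' s > 0"
    and crit: "g' 0 = 0"
  shows "g 0 < g L"
proof -
  have g'pos: "g' s > 0" if "0 < s" "s \<le> L" for s
  proof -
    have "g' 0 < g' s"
    proof (rule DERIV_pos_imp_increasing[OF that(1)])
      fix u assume "0 \<le> u" "u \<le> s"
      then show "\<exists>y. (g' has_real_derivative y) (at u) \<and> 0 < y"
        using g'[of u] pos[of u] that by auto
    qed
    then show ?thesis using crit by simp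
  qed
  obtain z where z: "0 < z" "z < L" "g L - g 0 = (L - 0) * g' z"
    using MVT2[OF L, of g g'] g by blast
  then have "(L - 0) * g' z > 0" using g'pos[of z] L by simp
  then show ?thesis using z(3) by linarith
qed

text \<open>
  Restricted to the segment from \<open>x\<close> to \<open>y\<close>, the function has positive second derivative and derivative
  zero at \<open>x\<close>. Only unit directions are considered, so that positivity can later be obtained from the
  compactness of the unit sphere.
\<close>

lemma critical_point_strict_minimum:
  fixes G :: "'a::euclidean_space \<Rightarrow> real"
  assumes \<Theta>: "convex \<Theta>"
    and G: "\<And>x. x \<in> \<Theta> \<Longrightarrow> (G has_derivative G1 x) (at x)"
    and G1: "\<And>x h. x \<in> \<Theta> \<Longrightarrow> ((\<lambda>x. G1 x h) has_derivative G2 x h) (at x)"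
    and pos: "\<And>x h. x \<in> \<Theta> \<Longrightarrow> norm h = 1 \<Longrightarrow> 0 < G2 x h h"
    and x: "x \<in> \<Theta>" "\<And>h. G1 x h = 0" and y: "y \<in> \<Theta>" "y \<noteq> x"
  shows "G x < G y"
proof -
  define L where "L = norm (y - x)"
  define h where "h = (y - x) /\<^sub>R L"
  have L: "L > 0" and h: "norm h = 1" using y by (auto simp: L_def h_def)
  have mem: "x + s *\<^sub>R h \<in> \<Theta>" if "0 \<le> s" "s \<le> L" for s
  proof -
    have "x + s *\<^sub>R h = (1 - s / L) *\<^sub>R x + (s / L) *\<^sub>R y"
      using L by (simp add: h_def algebra_simps divide_inverse)
    then show ?thesis using \<Theta> x(1) y(1) that L by (auto simp: convex_alt)
  qed
  have "G (x + 0 *\<^sub>R h) < G (x + L *\<^sub>R h)"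
  proof (rule critical_point_strict_minimum_1D[OF L, where g' = "\<lambda>s. G1 (x + s *\<^sub>R h) h"
        and g'' = "\<lambda>s. G2 (x + s *\<^sub>R h) h h"])
    fix s assume s: "0 \<le> s" "s \<le> L"
    show "((\<lambda>s. G (x + s *\<^sub>R h)) has_real_derivative G1 (x + s *\<^sub>R h) h) (at s)"
      by (rule has_derivative_imp_line_derivative[OF G[OF mem[OF s]]])
    show "((\<lambda>s. G1 (x + s *\<^sub>R h) h) has_real_derivative G2 (x + s *\<^sub>R h) h h) (at s)"
      by (rule has_derivative_imp_line_derivative[OF G1[OF mem[OF s]]])
    show "0 < G2 (x + s *\<^sub>R h) h h" by (rule pos[OF mem[OF s] h])
  qed (simp add: x)
  then show ?thesis using L by (simp add: h_def)
qed

section \<open>The score of densities with finitely many cells\<close>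

text \<open>
  The parameter lists the masses of the cells \<open>Some i\<close>; the cell \<open>None\<close> takes the remaining mass. Thus
  \<open>mass\<close> is an affine parametrization of the vectors of total mass one, and \<open>tilt\<close> is its linear part.
\<close>

definition mass :: "real ^ 'k \<Rightarrow> real ^ 'k option" where
  "mass t = (\<chi> j. case j of None \<Rightarrow> 1 - (\<Sum>i\<in>UNIV. t $ i) | Some i \<Rightarrow> t $ i)"

definition tilt :: "real ^ 'k \<Rightarrow> real ^ 'k option" where
  "tilt h = (\<chi> j. case j of None \<Rightarrow> - (\<Sum>i\<in>UNIV. h $ i) | Some i \<Rightarrow> h $ i)"

lemma sum_UNIV_option: "(\<Sum>j\<in>UNIV. f j) = f None + (\<Sum>i\<in>UNIV. f (Some i))" for f :: "'k::finite option \<Rightarrow> real"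
  by (simp add: UNIV_option_conv sum.reindex)

lemma sum_mass: "(\<Sum>j\<in>UNIV. mass t $ j) = 1"
  by (simp add: sum_UNIV_option mass_def)

lemma sum_tilt: "(\<Sum>j\<in>UNIV. tilt h $ j) = 0"
  by (simp add: sum_UNIV_option tilt_def)

lemma tilt_eq_0:
  assumes "\<And>j. tilt h $ j = 0"
  shows "h = 0"
proof -
  have "h $ i = 0" for i using assms[of "Some i"] by (simp add: tilt_def)
  then show ?thesis by (simp add: vec_eq_iff)
qed

lemma bounded_linear_tilt: "bounded_linear (\<lambda>h. tilt h $ j)"
proof (cases j)
  case None
  then show ?thesis
    by (auto simp: tilt_def intro!: bounded_linear_minus bounded_linear_sum bounded_linear_vec_nth)
next
  case (Some i)
  then show ?thesis by (simp add: tilt_def bounded_linear_vec_nth)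
qed

lemma mass_nth: "mass t $ j = mass 0 $ j + tilt t $ j"
  by (cases j) (auto simp: mass_def tilt_def)

lemma mass_has_derivative: "((\<lambda>t. mass t $ j) has_derivative (\<lambda>h. tilt h $ j)) (at t)"
proof -
  have "((\<lambda>t. mass 0 $ j + tilt t $ j) has_derivative (\<lambda>h. tilt h $ j)) (at t)"
    by (auto intro!: derivative_eq_intros bounded_linear_imp_has_derivative[OF bounded_linear_tilt])
  then show ?thesis by (simp only: mass_nth[symmetric])
qed

text \<open>
  One family, closed under differentiation in \<open>t\<close>, covers both functionals of the score together with
  their first and second derivatives.
\<close>

definition powsum :: "real \<Rightarrow> ('k::finite option \<Rightarrow> real) \<Rightarrow> real ^ 'k \<Rightarrow> real" where
  "powsum c a t = (\<Sum>j\<in>UNIV. a j * mass t $ j powr c)"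

lemma powsum_has_derivative:
  assumes "\<And>j. mass t $ j > 0"
  shows "(powsum c a has_derivative (\<lambda>h. powsum (c - 1) (\<lambda>j. c * a j * tilt h $ j) t)) (at t)"
proof -
  have "((\<lambda>t. a j * mass t $ j powr c) has_derivative (\<lambda>h. c * a j * tilt h $ j * mass t $ j powr (c - 1))) (at t)" for j
    using assms[of j]
    by (auto intro!: derivative_eq_intros mass_has_derivative simp: fun_eq_iff powr_diff)
  then show ?thesis unfolding powsum_def[abs_def] by (auto intro!: has_derivative_sum)
qed

lemma tendsto_mass:
  assumes "(f \<longlongrightarrow> t) F"
  shows "((\<lambda>x. mass (f x) $ j) \<longlongrightarrow> mass t $ j) F"
proof -
  have "isCont (\<lambda>t. mass t $ j) t" using has_derivative_continuous[OF mass_has_derivative] .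
  then show ?thesis using assms by (rule isCont_tendsto_compose)
qed

lemma tendsto_tilt:
  assumes "(f \<longlongrightarrow> t) F"
  shows "((\<lambda>x. tilt (f x) $ j) \<longlongrightarrow> tilt t $ j) F"
  by (rule bounded_linear.tendsto[OF bounded_linear_tilt assms])

lemma tendsto_powsum:
  assumes "\<And>j. ((\<lambda>x. a x j) \<longlongrightarrow> b j) F" "(f \<longlongrightarrow> t) F" "\<And>j. mass t $ j > 0"
  shows "((\<lambda>x. powsum c (a x) (f x)) \<longlongrightarrow> powsum c b t) F"
proof -
  have "mass t $ j \<noteq> 0" for j using assms(3)[of j] by simp
  then show ?thesis
    unfolding powsum_def
    by (intro tendsto_sum tendsto_mult tendsto_powr tendsto_const tendsto_mass assms)
qed

text \<open>
  Here \<open>n j\<close> is the integral of the \<open>(1 + \<gamma>)\<close>-th power of the fixed density shape on the cell \<open>j\<close>. The first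
  argument of the score is an arbitrary vector \<open>f\<close> of cell masses, not necessarily of total mass one,
  since contamination takes it off the model.
\<close>

locale finite_cell_score =
  fixes \<gamma> :: real and \<phi> :: "real \<Rightarrow> real" and n :: "'k::finite option \<Rightarrow> real"
  assumes \<gamma>: "\<gamma> > 0" and generator: "holder_generator \<gamma> \<phi>" and n: "\<And>j. n j > 0"
begin

definition cross :: "real ^ 'k option \<Rightarrow> real ^ 'k \<Rightarrow> real" where
  "cross f = powsum \<gamma> (\<lambda>j. n j * f $ j)"

definition norming :: "real ^ 'k \<Rightarrow> real" where
  "norming = powsum (1 + \<gamma>) n"

definition ratio :: "real ^ 'k option \<Rightarrow> real ^ 'k \<Rightarrow> real" where
  "ratio f t = cross f t / norming t"

definition score :: "real ^ 'k option \<Rightarrow> real ^ 'k \<Rightarrow> real" where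
  "score f t = \<phi> (ratio f t) * norming t"

text \<open>
  First and second directional derivatives of the two functionals, in directions \<open>h\<close> and \<open>k\<close>. The exponents
  and factors are left in the form in which \<open>powsum_has_derivative\<close> produces them.
\<close>

definition cross1 where
  "cross1 f t h = powsum (\<gamma> - 1) (\<lambda>j. \<gamma> * (n j * f $ j) * tilt h $ j) t"
definition cross2 where
  "cross2 f t h k = powsum (\<gamma> - 1 - 1) (\<lambda>j. (\<gamma> - 1) * (\<gamma> * (n j * f $ j) * tilt h $ j) * tilt k $ j) t"
definition norming1 where
  "norming1 t h = powsum (1 + \<gamma> - 1) (\<lambda>j. (1 + \<gamma>) * n j * tilt h $ j) t"
definition norming2 where
  "norming2 t h k = powsum (1 + \<gamma> - 1 - 1) (\<lambda>j. (1 + \<gamma> - 1) * ((1 + \<gamma>) * n j * tilt h $ j) * tilt k $ j) t"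

definition score1 :: "real ^ 'k option \<Rightarrow> real ^ 'k \<Rightarrow> real ^ 'k \<Rightarrow> real" where
  "score1 f t h = deriv \<phi> (ratio f t) * (cross1 f t h - ratio f t * norming1 t h)
     + \<phi> (ratio f t) * norming1 t h"

definition score2 :: "real ^ 'k option \<Rightarrow> real ^ 'k \<Rightarrow> real ^ 'k \<Rightarrow> real ^ 'k \<Rightarrow> real" where
  "score2 f t h k = deriv (deriv \<phi>) (ratio f t) * (cross1 f t h - ratio f t * norming1 t h)
       * ((cross1 f t k - ratio f t * norming1 t k) / norming t)
     + deriv \<phi> (ratio f t) * (cross2 f t h k - ratio f t * norming2 t h k)
     + \<phi> (ratio f t) * norming2 t h k"

definition regular :: "real ^ 'k option \<Rightarrow> real ^ 'k \<Rightarrow> bool" where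
  "regular f t \<longleftrightarrow> (\<forall>j. mass t $ j > 0) \<and>
     (\<phi> has_real_derivative deriv \<phi> (ratio f t)) (at (ratio f t)) \<and>
     (deriv \<phi> has_real_derivative deriv (deriv \<phi>) (ratio f t)) (at (ratio f t))"

lemma powsum_pos:
  assumes "\<And>j. a j > 0" "\<And>j. mass t $ j > 0"
  shows "powsum c a t > 0"
proof -
  have "mass t $ j powr c > 0" for j using assms(2)[of j] by simp
  then show ?thesis unfolding powsum_def using assms(1) by (intro sum_pos) auto
qed

lemma norming_pos: "(\<And>j. mass t $ j > 0) \<Longrightarrow> norming t > 0"
  unfolding norming_def using n by (intro powsum_pos) auto

lemma ratio_diag:
  assumes "\<And>j. mass t $ j > 0"
  shows "ratio (mass t) t = 1"
proof -
  have "cross (mass t) t = norming t"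
    using assms unfolding cross_def norming_def powsum_def
    by (intro sum.cong) (auto simp: powr_add less_imp_le)
  then show ?thesis using norming_pos[of t] assms by (simp add: ratio_def)
qed

lemma cross_has_derivative:
  assumes "\<And>j. mass t $ j > 0"
  shows "(cross f has_derivative cross1 f t) (at t)"
    "((\<lambda>t. cross1 f t h) has_derivative cross2 f t h) (at t)"
  unfolding cross_def cross1_def[abs_def] cross2_def[abs_def] by (rule powsum_has_derivative[OF assms])+

lemma norming_has_derivative:
  assumes "\<And>j. mass t $ j > 0"
  shows "(norming has_derivative norming1 t) (at t)"
    "((\<lambda>t. norming1 t h) has_derivative norming2 t h) (at t)"
  unfolding norming_def norming1_def[abs_def] norming2_def[abs_def]
  by (rule powsum_has_derivative[OF assms])+

lemma ratio_has_derivative: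
  assumes "\<And>j. mass t $ j > 0"
  shows "(ratio f has_derivative (\<lambda>h. (cross1 f t h - ratio f t * norming1 t h) / norming t)) (at t)"
proof -
  have "norming t \<noteq> 0" using norming_pos[of t] assms by fastforce
  then show ?thesis
    unfolding ratio_def[abs_def]
    by (auto intro!: derivative_eq_intros cross_has_derivative(1) norming_has_derivative(1) assms
        simp: fun_eq_iff field_simps)
qed

lemma score_has_derivative:
  assumes "regular f t"
  shows "(score f has_derivative score1 f t) (at t)"
    "((\<lambda>t. score1 f t h) has_derivative score2 f t h) (at t)"
proof -
  have m: "mass t $ j > 0" for j using assms by (simp add: regular_def)
  have N: "norming t \<noteq> 0" using norming_pos[of t] m by fastforce
  note R = ratio_has_derivative[of t f, OF m]
  have 1: "((\<lambda>t. \<phi> (ratio f t)) has_derivative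
      (\<lambda>h. deriv \<phi> (ratio f t) * ((cross1 f t h - ratio f t * norming1 t h) / norming t))) (at t)"
    using assms unfolding regular_def has_field_derivative_def by (intro has_derivative_compose[OF R]) simp
  have 2: "((\<lambda>t. deriv \<phi> (ratio f t)) has_derivative
      (\<lambda>h. deriv (deriv \<phi>) (ratio f t) * ((cross1 f t h - ratio f t * norming1 t h) / norming t))) (at t)"
    using assms unfolding regular_def has_field_derivative_def by (intro has_derivative_compose[OF R]) simp
  show "(score f has_derivative score1 f t) (at t)"
    unfolding score_def[abs_def]
    by (rule has_derivative_eq_rhs[OF has_derivative_mult[OF 1 norming_has_derivative(1)[of t, OF m]]])
       (use N in \<open>auto simp: fun_eq_iff score1_def\<close>)
  show "((\<lambda>t. score1 f t h) has_derivative score2 f t h) (at t)"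
    unfolding score1_def
    by (rule has_derivative_eq_rhs[OF has_derivative_add[OF has_derivative_mult[OF 2
            has_derivative_diff[OF cross_has_derivative(2)[of t f h, OF m]
              has_derivative_mult[OF R norming_has_derivative(2)[of t h, OF m]]]]
          has_derivative_mult[OF 1 norming_has_derivative(2)[of t h, OF m]]]])
       (use N in \<open>auto simp: fun_eq_iff score2_def field_simps\<close>)
qed

lemma score2_symmetric: "score2 f t h k = score2 f t k h"
  by (simp add: score2_def cross2_def norming2_def mult_ac)

lemma score1_diag:
  assumes "\<And>j. mass t $ j > 0"
  shows "score1 (mass t) t h = 0"
proof -
  have "cross1 (mass t) t h = \<gamma> * powsum \<gamma> (\<lambda>j. n j * tilt h $ j) t"
    using assms unfolding cross1_def powsum_def sum_distrib_left
    by (intro sum.cong) (auto simp: powr_diff less_imp_neq[symmetric] abs_of_pos)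
  moreover have "norming1 t h = (1 + \<gamma>) * powsum \<gamma> (\<lambda>j. n j * tilt h $ j) t"
    unfolding norming1_def powsum_def sum_distrib_left by (intro sum.cong) auto
  moreover have "\<phi> 1 = - 1" using generator by (simp add: holder_generator_def)
  ultimately show ?thesis
    by (simp add: score1_def ratio_diag[of t, OF assms] holder_generator_deriv_1[OF generator] algebra_simps)
qed

text \<open>
  Let \<open>N\<close>, \<open>W\<close> and \<open>Q\<close> be the sums of \<open>n\<^sub>j m\<^sub>j\<^sup>1\<^sup>+\<^sup>\<gamma>\<close>, \<open>n\<^sub>j m\<^sub>j\<^sup>\<gamma> d\<^sub>j\<close> and \<open>n\<^sub>j m\<^sub>j\<^sup>\<gamma>\<^sup>-\<^sup>1 d\<^sub>j\<^sup>2\<close> with masses \<open>m\<close> and tilt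
  \<open>d\<close>. The second derivative is
  \<open>(\<phi>'' 1 + \<gamma> (1 + \<gamma>)) W\<^sup>2 / N + \<gamma> (1 + \<gamma>) (Q - W\<^sup>2 / N)\<close>. The first term is non-negative. The second is a
  weighted sum of the squares \<open>(d\<^sub>j - (W / N) m\<^sub>j)\<^sup>2\<close>, which all vanish only for \<open>d = 0\<close>, because the masses
  add up to one and the tilts to zero.
\<close>

lemma score2_diag_pos:
  assumes m: "\<And>j. mass t $ j > 0" and h: "h \<noteq> 0"
    and \<kappa>: "deriv (deriv \<phi>) 1 \<ge> - \<gamma> * (1 + \<gamma>)"
  shows "score2 (mass t) t h h > 0"
proof -
  define W where "W = powsum \<gamma> (\<lambda>j. n j * tilt h $ j) t"
  define Q where "Q = powsum (\<gamma> - 1) (\<lambda>j. n j * (tilt h $ j)\<^sup>2) t"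
  define N where "N = norming t"
  have N: "N > 0" using norming_pos[of t] m by (simp add: N_def)
  have m0: "mass t $ j \<noteq> 0" for j using m[of j] by simp
  have m2: "mass t $ j powr 2 = mass t $ j * mass t $ j" for j
    using m[of j] by (simp add: powr_numeral power2_eq_square)
  have c1: "cross1 (mass t) t h = \<gamma> * W"
    using m0 m unfolding cross1_def powsum_def sum_distrib_left W_def
    by (intro sum.cong) (auto simp: powr_diff abs_of_pos)
  have n1: "norming1 t h = (1 + \<gamma>) * W"
    unfolding norming1_def powsum_def sum_distrib_left W_def by (intro sum.cong) auto
  have c2: "cross2 (mass t) t h h = \<gamma> * (\<gamma> - 1) * Q"
    using m0 m unfolding cross2_def powsum_def sum_distrib_left Q_def
    by (intro sum.cong) (auto simp: powr_diff power2_eq_square m2 field_simps abs_of_pos)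
  have n2: "norming2 t h h = \<gamma> * (1 + \<gamma>) * Q"
    unfolding norming2_def powsum_def sum_distrib_left Q_def
    by (intro sum.cong) (auto simp: power2_eq_square)
  have \<phi>1: "\<phi> 1 = - 1" using generator by (simp add: holder_generator_def)
  have eq: "score2 (mass t) t h h = (deriv (deriv \<phi>) 1 + \<gamma> * (1 + \<gamma>)) * (W\<^sup>2 / N) + \<gamma> * (1 + \<gamma>) * (Q - W\<^sup>2 / N)"
    using N by (simp add: score2_def ratio_diag[of t, OF m] c1 n1 c2 n2 \<phi>1 N_def[symmetric]
        holder_generator_deriv_1[OF generator] field_simps power2_eq_square)
  \<comment> \<open>the multiple of the masses closest to the tilt in the weighted norm\<close>
  define l where "l = W / N"
  define sq where "sq j = n j * (tilt h $ j - l * mass t $ j)\<^sup>2 * mass t $ j powr (\<gamma> - 1)" for j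
  have "(\<Sum>j\<in>UNIV. sq j) = Q - 2 * l * W + l\<^sup>2 * N"
    unfolding Q_def W_def N_def norming_def powsum_def sum_distrib_left
      sum_subtractf[symmetric] sum.distrib[symmetric] sq_def
    using m0 m by (intro sum.cong) (auto simp: powr_diff powr_add power2_eq_square field_simps abs_of_pos)
  also have "\<dots> = Q - W\<^sup>2 / N" using N by (simp add: l_def power2_eq_square field_simps)
  finally have sum_sq: "(\<Sum>j\<in>UNIV. sq j) = Q - W\<^sup>2 / N" .
  have sq0: "sq j \<ge> 0" for j using n[of j] by (simp add: sq_def)
  have "(\<Sum>j\<in>UNIV. sq j) \<noteq> 0"
  proof
    assume "(\<Sum>j\<in>UNIV. sq j) = 0"
    then have sqz: "sq j = 0" for j using sq0 by (simp add: sum_nonneg_eq_0_iff)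
    have t: "tilt h $ j = l * mass t $ j" for j using n[of j] m0[of j] sqz[of j] by (auto simp: sq_def)
    then have "(\<Sum>j\<in>UNIV. tilt h $ j) = l * (\<Sum>j\<in>UNIV. mass t $ j)" by (simp add: sum_distrib_left)
    then have "l = 0" by (simp add: sum_mass sum_tilt)
    then show False using t tilt_eq_0[of h] h by simp
  qed
  then have "Q - W\<^sup>2 / N > 0" using sum_nonneg[of UNIV sq] sq0 sum_sq by (metis order_le_neq_trans)
  then show ?thesis
    unfolding eq using \<gamma> \<kappa> N by (intro add_nonneg_pos mult_nonneg_nonneg mult_pos_pos) auto
qed

lemma tendsto_parts:
  assumes f: "(f \<longlongrightarrow> f0) F" and t: "(t \<longlongrightarrow> t0) F" and m: "\<And>j. mass t0 $ j > 0"
  shows tendsto_cross: "((\<lambda>x. cross (f x) (t x)) \<longlongrightarrow> cross f0 t0) F"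
    and tendsto_norming: "((\<lambda>x. norming (t x)) \<longlongrightarrow> norming t0) F"
    and tendsto_ratio: "((\<lambda>x. ratio (f x) (t x)) \<longlongrightarrow> ratio f0 t0) F"
proof -
  have fj: "((\<lambda>x. f x $ j) \<longlongrightarrow> f0 $ j) F" for j by (rule tendsto_vec_nth[OF f])
  show 1: "((\<lambda>x. cross (f x) (t x)) \<longlongrightarrow> cross f0 t0) F"
    unfolding cross_def by (intro tendsto_powsum t m tendsto_mult tendsto_const fj)
  show 2: "((\<lambda>x. norming (t x)) \<longlongrightarrow> norming t0) F"
    unfolding norming_def by (intro tendsto_powsum t m tendsto_const)
  have "norming t0 \<noteq> 0" using norming_pos[of t0] m by fastforce
  with 1 2 show "((\<lambda>x. ratio (f x) (t x)) \<longlongrightarrow> ratio f0 t0) F"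
    unfolding ratio_def by (intro tendsto_divide)
qed

lemma tendsto_score:
  assumes "(f \<longlongrightarrow> f0) F" "(t \<longlongrightarrow> t0) F" and r: "regular f0 t0"
  shows "((\<lambda>x. score (f x) (t x)) \<longlongrightarrow> score f0 t0) F"
proof -
  have m: "mass t0 $ j > 0" for j using r by (simp add: regular_def)
  have "isCont \<phi> (ratio f0 t0)" using r by (auto simp: regular_def intro: DERIV_isCont)
  then show ?thesis
    unfolding score_def
    by (intro tendsto_mult tendsto_norming[OF assms(1,2) m] isCont_tendsto_compose[OF _ tendsto_ratio[OF assms(1,2) m]])
qed

lemma tendsto_score2_diag:
  assumes f: "(f \<longlongrightarrow> mass a) F" and t: "(t \<longlongrightarrow> a) F" and h: "(h \<longlongrightarrow> h0) F"
    and m: "\<And>j. mass a $ j > 0"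
  shows "((\<lambda>x. score2 (f x) (t x) (h x) (h x)) \<longlongrightarrow> score2 (mass a) a h0 h0) F"
proof -
  have fj: "((\<lambda>x. f x $ j) \<longlongrightarrow> mass a $ j) F" for j by (rule tendsto_vec_nth[OF f])
  have "isCont \<phi> (ratio (mass a) a)" "isCont (deriv \<phi>) (ratio (mass a) a)"
    "isCont (deriv (deriv \<phi>)) (ratio (mass a) a)"
    using holder_generator_at_1[OF generator] by (auto simp: ratio_diag[of a, OF m] intro: DERIV_isCont)
  note c = this[THEN isCont_tendsto_compose, OF tendsto_ratio[OF f t m]]
  have "norming a \<noteq> 0" using norming_pos[of a] m by fastforce
  then show ?thesis
    unfolding score2_def cross1_def cross2_def norming1_def norming2_def
    by (intro tendsto_add tendsto_mult tendsto_diff tendsto_divide tendsto_const tendsto_powsum tendsto_tilt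
        c tendsto_ratio[OF f t m] tendsto_norming[OF f t m] fj t h m)
qed

lemma eventually_regular:
  assumes m: "\<And>j. mass a $ j > 0"
  shows "\<forall>\<^sub>F z in nhds (mass a) \<times>\<^sub>F nhds a. regular (fst z) (snd z)"
proof -
  let ?F = "nhds (mass a) \<times>\<^sub>F nhds a"
  have "((\<lambda>z. ratio (fst z) (snd z)) \<longlongrightarrow> ratio (mass a) a) ?F"
    by (intro tendsto_ratio filterlim_fst filterlim_snd m)
  then have "((\<lambda>z. ratio (fst z) (snd z)) \<longlongrightarrow> 1) ?F" by (simp add: ratio_diag[of a, OF m])
  from eventually_compose_filterlim[OF holder_generator_near_1[OF generator] this]
  have "\<forall>\<^sub>F z in ?F. (\<phi> has_real_derivative deriv \<phi> (ratio (fst z) (snd z))) (at (ratio (fst z) (snd z))) \<and>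
     (deriv \<phi> has_real_derivative deriv (deriv \<phi>) (ratio (fst z) (snd z))) (at (ratio (fst z) (snd z)))"
    by (rule eventually_mono) auto
  moreover have "\<forall>\<^sub>F z in ?F. \<forall>j. mass (snd z) $ j > 0"
    by (intro eventually_all_finite order_tendstoD(1)[OF tendsto_mass[OF filterlim_snd]] m)
  ultimately show ?thesis by eventually_elim (auto simp: regular_def)
qed

text \<open>
  Positivity at the diagonal persists in a neighbourhood for each direction by continuity, and for all
  directions simultaneously by compactness of the unit sphere.
\<close>

lemma uniformly_convex_near_diagonal:
  assumes m: "\<And>j. mass a $ j > 0"
  obtains \<rho> where "\<rho> > 0" "\<And>f t. dist f (mass a) < \<rho> \<Longrightarrow> dist t a < \<rho> \<Longrightarrow>
    regular f t \<and> (\<forall>h. norm h = 1 \<longrightarrow> score2 f t h h > 0)"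
proof -
  have "\<forall>\<^sub>F z in nhds (mass a, a). \<forall>h\<in>sphere 0 1. score2 (fst z) (snd z) h h > 0"
  proof (rule eventually_nhds_ball_compact[OF compact_sphere])
    fix h0 :: "real ^ 'k" assume "h0 \<in> sphere 0 1"
    then have h0: "h0 \<noteq> 0" by auto
    let ?F = "nhds (mass a, a) \<times>\<^sub>F nhds h0"
    have f: "((\<lambda>y. fst (fst y)) \<longlongrightarrow> mass a) ?F" and t: "((\<lambda>y. snd (fst y)) \<longlongrightarrow> a) ?F"
      using tendsto_fst[OF filterlim_fst] tendsto_snd[OF filterlim_fst] by fastforce+
    show "\<forall>\<^sub>F (z, h) in ?F. score2 (fst z) (snd z) h h > 0"
      unfolding case_prod_unfold
      by (rule order_tendstoD(1)[OF tendsto_score2_diag[OF f t filterlim_snd m]])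
        (rule score2_diag_pos[of a, OF m h0 holder_generator_second_deriv_ge[OF \<gamma> generator]])
  qed
  then have "\<forall>\<^sub>F z in nhds (mass a) \<times>\<^sub>F nhds a. regular (fst z) (snd z) \<and>
      (\<forall>h\<in>sphere 0 1. score2 (fst z) (snd z) h h > 0)"
    using eventually_regular[of a, OF m] by (simp add: nhds_prod eventually_conj_iff)
  then obtain A B where AB: "eventually A (nhds (mass a))" "eventually B (nhds a)"
    "\<And>f t. A f \<Longrightarrow> B t \<Longrightarrow> regular f t \<and> (\<forall>h\<in>sphere 0 1. score2 f t h h > 0)"
    unfolding eventually_prod_filter by auto
  obtain d1 where d1: "d1 > 0" "\<And>f. dist f (mass a) < d1 \<Longrightarrow> A f"
    using AB(1) unfolding eventually_nhds_metric by blast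
  obtain d2 where d2: "d2 > 0" "\<And>t. dist t a < d2 \<Longrightarrow> B t"
    using AB(2) unfolding eventually_nhds_metric by blast
  show thesis
  proof (rule that[of "min d1 d2"])
    fix f t assume "dist f (mass a) < min d1 d2" "dist t a < min d1 d2"
    then have "A f" "B t" using d1 d2 by auto
    from AB(3)[OF this] show "regular f t \<and> (\<forall>h. norm h = 1 \<longrightarrow> score2 f t h h > 0)" by auto
  qed (use d1 d2 in auto)
qed

text \<open>
  The function \<open>F\<close> stands for the score as it is defined by integrals, which agrees with the explicit
  formula only where all cell masses are positive.
\<close>

lemma score_locally:
  assumes \<Theta>: "open \<Theta>" "\<theta> \<in> \<Theta>" and reg: "\<And>t. t \<in> \<Theta> \<Longrightarrow> regular f t"
    and F: "\<And>t. t \<in> \<Theta> \<Longrightarrow> F t = score f t"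
  shows "twice_differentiable_at F \<theta>"
    and "x \<bullet> (hessian F \<theta> *v k) = score2 f \<theta> x k"
proof -
  have D1: "(F has_derivative score1 f t) (at t)" if "t \<in> \<Theta>" for t
    by (rule has_derivative_transform_within_open[OF score_has_derivative(1)[OF reg[OF that]] \<Theta>(1) that])
      (simp add: F)
  have D2: "(partial_deriv j F has_derivative score2 f \<theta> (axis j 1)) (at \<theta>)" for j
    by (rule has_derivative_transform_within_open[OF score_has_derivative(2)[OF reg[OF \<Theta>(2)]] \<Theta>])
      (simp add: partial_deriv_eq[OF D1])
  have "\<forall>\<^sub>F t in nhds \<theta>. t \<in> \<Theta>" by (rule eventually_nhds_in_open[OF \<Theta>])
  then have "\<forall>\<^sub>F t in nhds \<theta>. F differentiable (at t)"
    by (rule eventually_mono) (use D1 in \<open>auto simp: differentiable_def\<close>)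
  then show "twice_differentiable_at F \<theta>"
    using D2 by (auto simp: twice_differentiable_at_def differentiable_def)
  have lin: "linear (score2 f \<theta> x)"
    using has_derivative_linear[OF score_has_derivative(2)[OF reg[OF \<Theta>(2)]]] .
  have "x \<bullet> (hessian F \<theta> *v k) = (\<Sum>j\<in>UNIV. k $ j * score2 f \<theta> x (axis j 1))"
    by (simp add: hessian_bilinear[OF D2] score2_symmetric[of f \<theta> x])
  also have "\<dots> = score2 f \<theta> x (\<Sum>j\<in>UNIV. k $ j *\<^sub>R axis j 1)"
    using lin by (simp add: linear_sum linear_scale)
  also have "(\<Sum>j\<in>UNIV. k $ j *\<^sub>R axis j 1) = k"
    using basis_expansion[of k] by (simp add: scalar_mult_eq_scaleR)
  finally show "x \<bullet> (hessian F \<theta> *v k) = score2 f \<theta> x k" .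
qed

lemma hessian_invertible:
  assumes \<Theta>: "open \<Theta>" "\<theta> \<in> \<Theta>" and reg: "\<And>t. t \<in> \<Theta> \<Longrightarrow> regular (mass \<theta>) t"
    and F: "\<And>t. t \<in> \<Theta> \<Longrightarrow> F t = score (mass \<theta>) t"
  shows "invertible (hessian F \<theta>)"
proof -
  have m: "mass \<theta> $ j > 0" for j using reg[OF \<Theta>(2)] by (simp add: regular_def)
  have "x = 0" if "hessian F \<theta> *v x = 0" for x
  proof (rule ccontr)
    assume "x \<noteq> 0"
    then have "score2 (mass \<theta>) \<theta> x x > 0"
      by (rule score2_diag_pos[of \<theta>, OF m _ holder_generator_second_deriv_ge[OF \<gamma> generator]])
    then show False using score_locally(2)[OF \<Theta> reg F, of x x] that by simp
  qed
  then show ?thesis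
    by (simp add: invertible_left_inverse matrix_left_invertible_ker)
qed

text \<open>
  On a ball where the second derivatives are positive every critical point is a strict global minimum. At
  \<open>f = mass \<theta>\<close> the point \<open>\<theta>\<close> is critical, so the minimizer exists and stays close to \<open>\<theta>\<close> for nearby \<open>f\<close>.
\<close>

lemma minimizer_stable:
  assumes convex: "\<And>f t. dist f (mass a) < \<rho> \<Longrightarrow> dist t a < r \<Longrightarrow>
      regular f t \<and> (\<forall>h. norm h = 1 \<longrightarrow> score2 f t h h > 0)"
    and near: "\<And>t. dist t a < r \<Longrightarrow> dist (mass t) (mass a) < \<rho>"
    and \<theta>: "\<theta> \<in> ball a r" and \<rho>': "\<rho>' > 0"
  shows "\<forall>\<^sub>F f in nhds (mass \<theta>). \<exists>x\<in>ball a r. dist x \<theta> < \<rho>' \<and>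
      (\<forall>y\<in>ball a r. y \<noteq> x \<longrightarrow> score f x < score f y)"
proof -
  have mem: "dist (mass \<theta>) (mass a) < \<rho>" using \<theta> near by (simp add: dist_commute)
  have near_f: "\<forall>\<^sub>F f in nhds (mass \<theta>). dist f (mass a) < \<rho>"
    using eventually_nhds_in_open[of "ball (mass a) \<rho>" "mass \<theta>"] mem by (simp add: dist_commute)
  have crit: "score f x < score f y"
    if f: "dist f (mass a) < \<rho>" and x: "x \<in> ball a r" "\<And>h. score1 f x h = 0"
      and y: "y \<in> ball a r" "y \<noteq> x" for f x y
  proof (rule critical_point_strict_minimum[where G = "score f" and ?G1.0 = "score1 f"
        and ?G2.0 = "score2 f", OF convex_ball _ _ _ x y])
    fix u h :: "real ^ 'k" assume "u \<in> ball a r"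
    then have u: "regular f u" "norm h = 1 \<Longrightarrow> score2 f u h h > 0"
      using convex[OF f, of u] by (auto simp: dist_commute)
    show "(score f has_derivative score1 f u) (at u)"
      "((\<lambda>u. score1 f u h) has_derivative score2 f u h) (at u)"
      by (rule score_has_derivative[OF u(1)])+
    show "norm h = 1 \<Longrightarrow> score2 f u h h > 0" by (rule u(2))
  qed
  show ?thesis
  proof (rule strict_minimum_stable[OF open_ball \<theta> _ _ _ _ \<rho>'])
    show "\<forall>\<^sub>F f in nhds (mass \<theta>). \<forall>x\<in>ball a r. (\<forall>\<^sub>F y in nhds x. score f x \<le> score f y) \<longrightarrow>
        (\<forall>y\<in>ball a r. y \<noteq> x \<longrightarrow> score f x < score f y)"
      using near_f
    proof (rule eventually_mono, intro ballI impI)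
      fix f x y assume f: "dist f (mass a) < \<rho>" and x: "x \<in> ball a r"
        and min: "\<forall>\<^sub>F y in nhds x. score f x \<le> score f y" and y: "y \<in> ball a r" "y \<noteq> x"
      obtain S where S: "open S" "x \<in> S" "\<forall>y\<in>S. score f x \<le> score f y"
        using min unfolding eventually_nhds by blast
      have "regular f x" using convex[OF f, of x] x by (simp add: dist_commute)
      from differential_zero_maxmin[OF S(2,1) score_has_derivative(1)[OF this]] S(3)
      have "score1 f x = (\<lambda>v. 0)" by blast
      then show "score f x < score f y" by (intro crit[OF f x _ y]) simp
    qed
    show "\<And>y. y \<in> ball a r \<Longrightarrow> y \<noteq> \<theta> \<Longrightarrow> score (mass \<theta>) \<theta> < score (mass \<theta>) y"
    proof (rule crit[OF mem \<theta>])
      fix h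
      have "mass \<theta> $ j > 0" for j
        using convex[OF mem, of \<theta>] \<theta> by (auto simp: dist_commute regular_def)
      then show "score1 (mass \<theta>) \<theta> h = 0" by (rule score1_diag)
    qed
    fix y assume "y \<in> ball a r"
    then have "regular (mass \<theta>) y" using convex[OF mem] by (simp add: dist_commute)
    then show "((\<lambda>z. score (fst z) (snd z)) \<longlongrightarrow> score (mass \<theta>) y) (nhds (mass \<theta>) \<times>\<^sub>F nhds y)"
      by (intro tendsto_score filterlim_fst filterlim_snd)
  next
    show "\<forall>\<^sub>F f in nhds (mass \<theta>). continuous_on (ball a r) (score f)"
      using near_f
    proof (rule eventually_mono)
      fix f assume f: "dist f (mass a) < \<rho>"
      show "continuous_on (ball a r) (score f)"
      proof (rule continuous_at_imp_continuous_on, rule ballI)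
        fix x assume "x \<in> ball a r"
        then have "regular f x" using convex[OF f, of x] by (simp add: dist_commute)
        then show "isCont (score f) x" by (rule has_derivative_continuous[OF score_has_derivative(1)])
      qed
    qed
  qed
qed

end

section \<open>Densities with prescribed cell masses\<close>

lemma integral_pos_on_open:
  fixes f :: "'a::euclidean_space \<Rightarrow> real"
  assumes f: "integrable lborel f" "\<And>x. f x \<ge> 0" and S: "open S" "S \<noteq> {}" "\<And>x. x \<in> S \<Longrightarrow> f x > 0"
  shows "(\<integral>x. f x \<partial>lborel) > 0"
proof -
  have "(\<integral>x. f x \<partial>lborel) \<noteq> 0"
  proof
    assume "(\<integral>x. f x \<partial>lborel) = 0"
    then have "AE x in lborel. f x = 0"
      using integral_nonneg_eq_0_iff_AE[OF f(1)] f(2) by simp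
    moreover have [measurable]: "f \<in> borel_measurable borel" using f(1) by auto
    ultimately have "{x. f x \<noteq> 0} \<in> null_sets lborel"
      by (subst (asm) AE_iff_null) auto
    then have "negligible {x. f x \<noteq> 0}"
      by (simp add: negligible_iff_null_sets null_sets_completionI)
    moreover have "S \<subseteq> {x. f x \<noteq> 0}" using S(3) by force
    ultimately have "negligible S" by (rule negligible_subset)
    then show False using open_not_negligible S by blast
  qed
  moreover have "(\<integral>x. f x \<partial>lborel) \<ge> 0" using f by simp
  ultimately show ?thesis by simp
qed

text \<open>
  Each cell contains a non-empty open set, hence has positive measure.
\<close>

locale cell_partition =
  fixes \<kappa> :: "'a::euclidean_space \<Rightarrow> 'i::finite"
  assumes measurable_cell: "\<kappa> \<in> measurable borel (count_space UNIV)"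
    and cell_open: "\<And>j. \<exists>S. open S \<and> S \<noteq> {} \<and> (\<forall>x\<in>S. \<kappa> x = j)"
begin

definition cell_integral :: "('a \<Rightarrow> real) \<Rightarrow> 'i \<Rightarrow> real" where
  "cell_integral g j = (\<integral>x. g x * indicator (\<kappa> -` {j}) x \<partial>lborel)"

lemma cell_sets [measurable]: "\<kappa> -` {j} \<in> sets borel"
  using measurable_sets[OF measurable_cell, of "{j}"] by simp

lemma measurable_cell_function [measurable]: "(\<lambda>x. c (\<kappa> x) :: real) \<in> borel_measurable borel"
  by (rule measurable_compose[OF measurable_cell]) simp

lemma integrable_cell:
  fixes g :: "'a \<Rightarrow> real"
  assumes "integrable lborel g"
  shows "integrable lborel (\<lambda>x. g x * indicator (\<kappa> -` {j}) x)"
  using assms by (intro integrable_real_mult_indicator) auto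

text \<open>
  A function that is constant on cells, weighted by \<open>g\<close>, integrates to a finite sum. Vector values are
  included for the integral of the weighted score function.
\<close>

lemma has_integral_cell_function:
  fixes g :: "'a \<Rightarrow> real" and c :: "'i \<Rightarrow> 'b::{banach, second_countable_topology}"
  assumes "integrable lborel g"
  shows "has_bochner_integral lborel (\<lambda>x. g x *\<^sub>R c (\<kappa> x)) (\<Sum>j\<in>UNIV. cell_integral g j *\<^sub>R c j)"
proof -
  have eq: "g x *\<^sub>R c (\<kappa> x) = (\<Sum>j\<in>UNIV. (g x * indicator (\<kappa> -` {j}) x) *\<^sub>R c j)" for x
  proof -
    have "(\<Sum>j\<in>UNIV. (g x * indicator (\<kappa> -` {j}) x) *\<^sub>R c j) = (\<Sum>j\<in>UNIV. if j = \<kappa> x then g x *\<^sub>R c j else 0)"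
      by (intro sum.cong) (auto simp: indicator_def)
    then show ?thesis by simp
  qed
  show ?thesis
    unfolding eq cell_integral_def
    by (intro has_bochner_integral_sum has_bochner_integral_scaleR_left has_bochner_integral_integrable
        integrable_cell assms)
qed

lemma cell_integral_pos:
  assumes "integrable lborel g" "\<And>x. g x > 0"
  shows "cell_integral g j > 0"
proof -
  obtain S where "open S" "S \<noteq> {}" "\<forall>x\<in>S. \<kappa> x = j" using cell_open by blast
  then show ?thesis
    unfolding cell_integral_def using assms(2)
    by (intro integral_pos_on_open[of _ S] integrable_cell assms(1)) (auto simp: less_imp_le)
qed

end

text \<open>
  Spherical shells between integer radii, numbered by the finitely many cells; the shells beyond the last
  number go to whatever value the enumeration takes there.
\<close>

lemma cell_partition_exists: "\<exists>\<kappa> :: 'a::euclidean_space \<Rightarrow> 'i::finite. cell_partition \<kappa>"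
proof -
  obtain e :: "nat \<Rightarrow> 'i" where e: "bij_betw e {0..<CARD('i)} UNIV"
    using ex_bij_betw_nat_finite[of "UNIV :: 'i set"] by auto
  define \<kappa> :: "'a \<Rightarrow> 'i" where "\<kappa> x = e (nat \<lfloor>norm x\<rfloor>)" for x
  have "cell_partition \<kappa>"
  proof
    have "(\<lambda>x :: 'a. nat \<lfloor>norm x\<rfloor>) \<in> measurable borel (count_space UNIV)" by measurable
    then show "\<kappa> \<in> measurable borel (count_space UNIV)"
      unfolding \<kappa>_def by (rule measurable_compose) simp
    fix j
    obtain m where m: "e m = j" using e unfolding bij_betw_def by (metis UNIV_I imageE)
    let ?S = "{x :: 'a. real m < norm x} \<inter> {x. norm x < real m + 1}"
    obtain x :: 'a where "norm x = real m + 1/2" using vector_choose_size[of "real m + 1/2"] by auto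
    then have "x \<in> ?S" by simp
    moreover have "open ?S" by (intro open_Int open_Collect_less continuous_intros)
    moreover have "\<kappa> y = j" if "y \<in> ?S" for y
    proof -
      have "\<lfloor>norm y\<rfloor> = int m" using that by (intro floor_unique) auto
      then show ?thesis by (simp add: \<kappa>_def m)
    qed
    ultimately show "\<exists>S. open S \<and> S \<noteq> {} \<and> (\<forall>x\<in>S. \<kappa> x = j)" by blast
  qed
  then show ?thesis by blast
qed

text \<open>
  Sigma-finiteness provides a positive integrable function; its minimum with \<open>exp (- norm x)\<close> is bounded and
  vanishes at infinity.
\<close>

lemma decaying_integrable_exists:
  obtains \<eta> :: "'a::euclidean_space \<Rightarrow> real" where "\<And>x. \<eta> x > 0" "\<And>x. \<eta> x \<le> 1" "integrable lborel \<eta>"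
    "(\<eta> \<longlongrightarrow> 0) at_infinity"
proof -
  obtain h :: "'a \<Rightarrow> ennreal" where h: "h \<in> borel_measurable lborel" "integral\<^sup>N lborel h \<noteq> \<infinity>"
    "\<And>x. 0 < h x" "\<And>x. h x < \<infinity>"
    using sigma_finite_measure.Ex_finite_integrable_function[OF sigma_finite_lborel] by auto
  define \<eta> where "\<eta> x = min (enn2real (h x)) (exp (- norm x))" for x
  have hr: "enn2real (h x) > 0" for x using h(3,4)[of x] by (simp add: enn2real_positive_iff)
  show thesis
  proof (rule that[of \<eta>])
    show pos: "\<eta> x > 0" for x using hr by (simp add: \<eta>_def)
    have e1: "\<eta> x \<le> exp (- norm x)" for x by (simp add: \<eta>_def)
    then show "\<eta> x \<le> 1" for x by (rule order.trans) simp
    have [measurable]: "h \<in> borel_measurable borel" using h(1) by simp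
    have [measurable]: "\<eta> \<in> borel_measurable borel" unfolding \<eta>_def[abs_def] by measurable
    have "integrable lborel (\<lambda>x. enn2real (h x))"
    proof (rule integrableI_nonneg)
      have "(\<integral>\<^sup>+ x. ennreal (enn2real (h x)) \<partial>lborel) = integral\<^sup>N lborel h"
        using h(4) by (intro nn_integral_cong) simp
      then show "(\<integral>\<^sup>+ x. ennreal (enn2real (h x)) \<partial>lborel) < \<infinity>" using h(2) by (simp add: less_top)
    qed auto
    then show "integrable lborel \<eta>"
      by (rule Bochner_Integration.integrable_bound)
        (use hr in \<open>auto simp: \<eta>_def[of "_"] less_imp_le abs_of_pos\<close>)
    have "filterlim (\<lambda>x :: 'a. - norm x) at_bot at_infinity"
      using filterlim_norm_at_top by (simp add: filterlim_uminus_at_bot)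
    then have "((\<lambda>x :: 'a. exp (- norm x)) \<longlongrightarrow> 0) at_infinity"
      by (rule filterlim_compose[OF exp_at_bot])
    then show "(\<eta> \<longlongrightarrow> 0) at_infinity"
      by (rule Lim_null_comparison[rotated]) (use e1 pos in \<open>auto simp: less_imp_le\<close>)
  qed
qed

text \<open>
  The shape \<open>\<eta>\<close> is normalized on each cell, so that multiplying it by cell masses adding up to one gives a
  probability density.
\<close>

locale cell_density = cell_partition \<kappa> for \<kappa> :: "real ^ 'd \<Rightarrow> 'k::finite option" +
  fixes \<eta> :: "real ^ 'd \<Rightarrow> real"
  assumes \<eta>_pos: "\<And>x. \<eta> x > 0" and \<eta>_integrable: "integrable lborel \<eta>"
    and \<eta>_lim: "(\<eta> \<longlongrightarrow> 0) at_infinity" and \<eta>_bounded: "\<exists>B. \<forall>x. \<eta> x \<le> B"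
    and \<eta>_cell: "\<And>j. cell_integral \<eta> j = 1"

lemma cell_density_exists: "\<exists>(\<kappa> :: real ^ 'd \<Rightarrow> 'k::finite option) \<eta>. cell_density \<kappa> \<eta>"
proof -
  obtain \<kappa> :: "real ^ 'd \<Rightarrow> 'k option" where "cell_partition \<kappa>" using cell_partition_exists by blast
  then interpret cell_partition \<kappa> .
  obtain \<eta> :: "real ^ 'd \<Rightarrow> real" where \<eta>: "\<And>x. \<eta> x > 0" "\<And>x. \<eta> x \<le> 1" "integrable lborel \<eta>"
    "(\<eta> \<longlongrightarrow> 0) at_infinity" by (rule decaying_integrable_exists) blast
  define c where "c j = 1 / cell_integral \<eta> j" for j
  have c: "c j > 0" for j using cell_integral_pos[of \<eta>] \<eta> by (simp add: c_def)
  define C where "C = (\<Sum>j\<in>UNIV. c j)"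
  have cC: "c j \<le> C" for j unfolding C_def using c by (intro member_le_sum) (auto simp: less_imp_le)
  define \<eta>' where "\<eta>' x = \<eta> x * c (\<kappa> x)" for x
  have le: "\<eta>' x \<le> \<eta> x * C" for x unfolding \<eta>'_def using cC \<eta>(1) by (intro mult_left_mono) (auto simp: less_imp_le)
  have pos: "\<eta>' x > 0" for x unfolding \<eta>'_def using c \<eta>(1) by simp
  have "cell_density \<kappa> \<eta>'"
  proof
    show "\<eta>' x > 0" for x by (rule pos)
    show "integrable lborel \<eta>'"
      using has_integral_cell_function[OF \<eta>(3), of c] unfolding \<eta>'_def has_bochner_integral_iff by simp
    have "((\<lambda>x. \<eta> x * C) \<longlongrightarrow> 0 * C) at_infinity" by (intro tendsto_intros \<eta>)
    then have "((\<lambda>x. \<eta> x * C) \<longlongrightarrow> 0) at_infinity" by simp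
    then show "(\<eta>' \<longlongrightarrow> 0) at_infinity"
      by (rule Lim_null_comparison[rotated]) (use le pos in \<open>auto simp: less_imp_le\<close>)
    have "C \<ge> 0" unfolding C_def using c by (intro sum_nonneg) (auto simp: less_imp_le)
    then have "\<eta>' x \<le> C" for x
      using le[of x] mult_right_mono[OF \<eta>(2)[of x], of C] by simp
    then show "\<exists>B. \<forall>x. \<eta>' x \<le> B" by blast
    fix j
    have "cell_integral \<eta>' j = (\<integral>x. c j * (\<eta> x * indicator (\<kappa> -` {j}) x) \<partial>lborel)"
      unfolding cell_integral_def by (intro Bochner_Integration.integral_cong) (auto simp: \<eta>'_def indicator_def)
    also have "\<dots> = c j * cell_integral \<eta> j" by (simp add: cell_integral_def)
    also have "\<dots> = 1" using cell_integral_pos[OF \<eta>(3) \<eta>(1), of j] by (simp add: c_def)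
    finally show "cell_integral \<eta>' j = 1" .
  qed
  then show ?thesis by blast
qed

section \<open>A regular model\<close>

context cell_density begin

definition p :: "real ^ 'k \<Rightarrow> real ^ 'd \<Rightarrow> real" where
  "p t x = \<eta> x * mass t $ \<kappa> x"

text \<open>
  The weights with which the cells enter the scores of the densities \<open>p t\<close>.
\<close>

definition n :: "real \<Rightarrow> 'k option \<Rightarrow> real" where
  "n \<gamma> = cell_integral (\<lambda>x. \<eta> x powr (1 + \<gamma>))"

lemma \<eta>_measurable [measurable]: "\<eta> \<in> borel_measurable borel"
  using \<eta>_integrable by auto

lemma \<eta>_power_integrable:
  assumes \<gamma>: "\<gamma> > 0"
  shows "integrable lborel (\<lambda>x. \<eta> x powr (1 + \<gamma>))"
proof -
  obtain B where B: "\<And>x. \<eta> x \<le> B" using \<eta>_bounded by blast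
  show ?thesis
  proof (rule Bochner_Integration.integrable_bound[OF integrable_mult_left[OF \<eta>_integrable, of "B powr \<gamma>"]])
    show "AE x in lborel. norm (\<eta> x powr (1 + \<gamma>)) \<le> norm (\<eta> x * B powr \<gamma>)"
    proof (rule AE_I2)
      fix x
      have "\<eta> x * \<eta> x powr \<gamma> \<le> \<eta> x * B powr \<gamma>"
        using \<eta>_pos[of x] B[of x] \<gamma> by (intro mult_left_mono powr_mono2) auto
      then show "norm (\<eta> x powr (1 + \<gamma>)) \<le> norm (\<eta> x * B powr \<gamma>)"
        using \<eta>_pos[of x] by (simp add: powr_add abs_mult)
    qed
  qed simp
qed

lemma n_pos: "\<gamma> > 0 \<Longrightarrow> n \<gamma> j > 0"
  unfolding n_def
  by (intro cell_integral_pos \<eta>_power_integrable) (simp_all add: less_imp_neq[OF \<eta>_pos, symmetric])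

lemma p_measurable [measurable]: "p t \<in> borel_measurable borel"
  unfolding p_def[abs_def] by measurable

lemma p_pos: "(\<And>j. mass t $ j > 0) \<Longrightarrow> p t x > 0"
  unfolding p_def using \<eta>_pos by simp

lemma p_powr: "(\<And>j. mass t $ j > 0) \<Longrightarrow> p t x powr c = \<eta> x powr c * mass t $ \<kappa> x powr c"
  unfolding p_def using \<eta>_pos[of x] by (simp add: powr_mult less_imp_le)

lemma mass_le_1:
  assumes "\<And>j. mass t $ j > 0"
  shows "mass t $ j \<le> 1"
  using member_le_sum[of j UNIV "\<lambda>j. mass t $ j"] assms by (simp add: sum_mass less_imp_le)

lemma p_has_derivative: "((\<lambda>t. p t x) has_derivative (\<lambda>h. \<eta> x * tilt h $ \<kappa> x)) (at t)"
  unfolding p_def by (rule has_derivative_mult_right[OF mass_has_derivative])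

lemma p_integral: "has_bochner_integral lborel (p t) 1"
  using has_integral_cell_function[OF \<eta>_integrable, of "\<lambda>j. mass t $ j"]
  by (simp add: p_def[abs_def] \<eta>_cell sum_mass)

lemma p_prob_space:
  assumes "\<And>j. mass t $ j > 0"
  shows "prob_space (density lborel (\<lambda>x. ennreal (p t x)))"
proof
  note p_integral[of t]
  then have "(\<integral>\<^sup>+x. ennreal (p t x) \<partial>lborel) = ennreal 1"
    using p_pos[of t] assms by (subst nn_integral_eq_integral) (auto simp: has_bochner_integral_iff less_imp_le)
  then show "emeasure (density lborel (\<lambda>x. ennreal (p t x))) (space (density lborel (\<lambda>x. ennreal (p t x)))) = 1"
    by (simp add: emeasure_density)
qed

lemma p_statistical_model:
  assumes "open \<Theta>" "\<And>t j. t \<in> \<Theta> \<Longrightarrow> mass t $ j > 0"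
  shows "statistical_model \<Theta> p"
  unfolding statistical_model_def using assms p_pos p_prob_space
  by (auto simp: differentiable_def intro: p_has_derivative)

lemma p_lim:
  assumes "\<And>j. mass t $ j > 0"
  shows "(p t \<longlongrightarrow> 0) at_infinity"
proof (rule Lim_null_comparison[OF _ \<eta>_lim], rule always_eventually, rule allI)
  fix x
  show "norm (p t x) \<le> \<eta> x"
    using mult_left_mono[OF mass_le_1[of t, OF assms], of "\<eta> x"] \<eta>_pos[of x] p_pos[of t x, OF assms]
    by (simp add: p_def abs_of_pos)
qed

lemma p_score_function:
  assumes "\<And>j. mass t $ j > 0"
  shows "score_function p t x = (\<chi> i. tilt (axis i 1) $ \<kappa> x / mass t $ \<kappa> x)"
proof -
  have "((\<lambda>t. ln (p t x)) has_derivative (\<lambda>h. (\<eta> x * tilt h $ \<kappa> x) / p t x)) (at t)"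
    using p_pos[of t x, OF assms] p_has_derivative[of x t]
    by (auto intro!: derivative_eq_intros simp: divide_inverse)
  then have "((\<lambda>t. ln (p t x)) has_derivative (\<lambda>h. tilt h $ \<kappa> x / mass t $ \<kappa> x)) (at t)"
    using \<eta>_pos[of x] by (simp add: p_def)
  from partial_deriv_eq[OF this] show ?thesis
    by (simp add: score_function_def)
qed

lemma p_weighted_score_lim:
  assumes m: "\<And>j. mass t $ j > 0" and \<gamma>: "\<gamma> > 0"
  shows "((\<lambda>z. (p t z powr \<gamma>) *\<^sub>R score_function p t z) \<longlongrightarrow> 0) at_infinity"
proof -
  define \<sigma> :: "'k option \<Rightarrow> real ^ 'k" where "\<sigma> j = (\<chi> i. tilt (axis i 1) $ j / mass t $ j)" for j
  have le: "norm (\<sigma> j) \<le> (\<Sum>j\<in>UNIV. norm (\<sigma> j))" for j by (intro member_le_sum) auto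
  have "((\<lambda>z. p t z powr \<gamma>) \<longlongrightarrow> 0) at_infinity"
    using tendsto_powr'[OF p_lim[of t, OF m] tendsto_const, of \<gamma>] \<gamma> p_pos[of t, OF m]
    by (auto simp: less_imp_le)
  then have "((\<lambda>z. p t z powr \<gamma> * (\<Sum>j\<in>UNIV. norm (\<sigma> j))) \<longlongrightarrow> 0 * (\<Sum>j\<in>UNIV. norm (\<sigma> j))) at_infinity"
    by (intro tendsto_intros)
  then have lim: "((\<lambda>z. p t z powr \<gamma> * (\<Sum>j\<in>UNIV. norm (\<sigma> j))) \<longlongrightarrow> 0) at_infinity" by simp
  show ?thesis
  proof (rule Lim_null_comparison[OF _ lim], rule always_eventually, rule allI)
    fix z
    show "norm ((p t z powr \<gamma>) *\<^sub>R score_function p t z) \<le> p t z powr \<gamma> * (\<Sum>j\<in>UNIV. norm (\<sigma> j))"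
      using mult_left_mono[OF le[of "\<kappa> z"], of "p t z powr \<gamma>"]
      by (simp add: p_score_function[of t, OF m] \<sigma>_def[symmetric])
  qed
qed

lemma p_L_plus:
  assumes m: "\<And>j. mass t $ j > 0" and \<gamma>: "\<gamma> > 0"
  shows "p t \<in> L_plus \<gamma>"
proof -
  have "integrable lborel (\<lambda>x. p t x powr (1 + \<gamma>))"
    using has_integral_cell_function[OF \<eta>_power_integrable[OF \<gamma>], of "\<lambda>j. mass t $ j powr (1 + \<gamma>)"]
    by (simp add: p_powr[of t, OF m] has_bochner_integral_iff)
  moreover have "\<not> (AE x in lborel. p t x = 0)"
  proof
    assume "AE x in lborel. p t x = 0"
    then have "integral\<^sup>L lborel (p t) = 0" by (rule integral_eq_zero_AE)
    then show False using p_integral[of t] by (simp add: has_bochner_integral_iff)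
  qed
  ultimately show ?thesis
    using p_pos[of t, OF m] by (auto simp: L_plus_def less_imp_le)
qed

text \<open>
  The integrand depends on \<open>t\<close> only through finitely many functions, one for each cell, so integration and
  differentiation reduce to finite sums.
\<close>

lemma cell_power_under_integral:
  assumes g: "integrable lborel g" and \<Theta>: "open \<Theta>" "\<theta> \<in> \<Theta>" "\<And>t j. t \<in> \<Theta> \<Longrightarrow> mass t $ j > 0"
    and F: "\<And>t x. t \<in> \<Theta> \<Longrightarrow> F t x = g x * (c (\<kappa> x) * mass t $ \<kappa> x powr q)"
  shows "(\<integral>x. F \<theta> x \<partial>lborel) = powsum q (\<lambda>j. cell_integral g j * c j) \<theta>"
    and "differentiable_under_integral_at F \<theta>"
proof -
  have int: "(\<integral>x. F t x \<partial>lborel) = powsum q (\<lambda>j. cell_integral g j * c j) t" if "t \<in> \<Theta>" for t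
    using has_integral_cell_function[OF g, of "\<lambda>j. c j * mass t $ j powr q"]
    by (simp add: F[OF that] powsum_def has_bochner_integral_iff mult.assoc)
  then show "(\<integral>x. F \<theta> x \<partial>lborel) = powsum q (\<lambda>j. cell_integral g j * c j) \<theta>" using \<Theta> by simp
  have D: "((\<lambda>t. F t x) has_derivative (\<lambda>h. g x * (c (\<kappa> x) * (q * tilt h $ \<kappa> x * mass \<theta> $ \<kappa> x powr (q - 1))))) (at \<theta>)" for x
  proof (rule has_derivative_transform_within_open[OF _ \<Theta>(1,2)])
    show "((\<lambda>t. g x * (c (\<kappa> x) * mass t $ \<kappa> x powr q)) has_derivative
        (\<lambda>h. g x * (c (\<kappa> x) * (q * tilt h $ \<kappa> x * mass \<theta> $ \<kappa> x powr (q - 1))))) (at \<theta>)"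
      using \<Theta>(3)[OF \<Theta>(2), of "\<kappa> x"]
      by (auto intro!: derivative_eq_intros mass_has_derivative simp: fun_eq_iff powr_diff)
  qed (simp add: F)
  then have fd: "frechet_derivative (\<lambda>t. F t x) (at \<theta>)
      = (\<lambda>h. g x * (c (\<kappa> x) * (q * tilt h $ \<kappa> x * mass \<theta> $ \<kappa> x powr (q - 1))))" for x
    using frechet_derivative_at by metis
  have hb: "has_bochner_integral lborel (\<lambda>x. g x * (c (\<kappa> x) * (q * tilt h $ \<kappa> x * mass \<theta> $ \<kappa> x powr (q - 1))))
      (powsum (q - 1) (\<lambda>j. q * (cell_integral g j * c j) * tilt h $ j) \<theta>)" for h
    using has_integral_cell_function[OF g, of "\<lambda>j. c j * (q * tilt h $ j * mass \<theta> $ j powr (q - 1))"]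
    by (simp add: powsum_def mult_ac)
  have "(powsum q (\<lambda>j. cell_integral g j * c j) has_derivative
      (\<lambda>h. powsum (q - 1) (\<lambda>j. q * (cell_integral g j * c j) * tilt h $ j) \<theta>)) (at \<theta>)"
    by (rule powsum_has_derivative) (use \<Theta> in auto)
  then have "((\<lambda>t. \<integral>x. F t x \<partial>lborel) has_derivative
      (\<lambda>h. powsum (q - 1) (\<lambda>j. q * (cell_integral g j * c j) * tilt h $ j) \<theta>)) (at \<theta>)"
    by (rule has_derivative_transform_within_open[OF _ \<Theta>(1,2)]) (simp add: int)
  then show "differentiable_under_integral_at F \<theta>"
    unfolding differentiable_under_integral_at_def fd
    using D hb by (auto simp: differentiable_def has_bochner_integral_iff)
qed

lemma p_powers_under_integral:
  assumes \<gamma>: "\<gamma> > 0" and \<Theta>: "open \<Theta>" "t \<in> \<Theta>" "\<And>t j. t \<in> \<Theta> \<Longrightarrow> mass t $ j > 0" and \<theta>: "\<theta> \<in> \<Theta>"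
  shows "(\<integral>x. p t x powr (1 + \<gamma>) \<partial>lborel) = powsum (1 + \<gamma>) (n \<gamma>) t"
    and "differentiable_under_integral_at (\<lambda>t x. p t x powr (1 + \<gamma>)) t"
    and "(\<integral>x. p \<theta> x * p t x powr \<gamma> \<partial>lborel) = powsum \<gamma> (\<lambda>j. n \<gamma> j * mass \<theta> $ j) t"
    and "differentiable_under_integral_at (\<lambda>t x. p \<theta> x * p t x powr \<gamma>) t"
proof -
  note g = \<eta>_power_integrable[OF \<gamma>]
  have 1: "p t x powr (1 + \<gamma>) = \<eta> x powr (1 + \<gamma>) * (1 * mass t $ \<kappa> x powr (1 + \<gamma>))" if "t \<in> \<Theta>" for t x
    by (simp add: p_powr \<Theta>(3)[OF that])
  have 2: "p \<theta> x * p t x powr \<gamma> = \<eta> x powr (1 + \<gamma>) * (mass \<theta> $ \<kappa> x * mass t $ \<kappa> x powr \<gamma>)" if "t \<in> \<Theta>" for t x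
    using \<eta>_pos[of x] by (simp add: p_powr \<Theta>(3)[OF that]) (simp add: p_def powr_add)
  have "(\<integral>x. p t x powr (1 + \<gamma>) \<partial>lborel) = powsum (1 + \<gamma>) (\<lambda>j. cell_integral (\<lambda>x. \<eta> x powr (1 + \<gamma>)) j * 1) t"
    "differentiable_under_integral_at (\<lambda>t x. p t x powr (1 + \<gamma>)) t"
    by (rule cell_power_under_integral[OF g \<Theta>(1,2)]; (rule 1 | rule \<Theta>(3)); assumption)+
  then show "(\<integral>x. p t x powr (1 + \<gamma>) \<partial>lborel) = powsum (1 + \<gamma>) (n \<gamma>) t"
    "differentiable_under_integral_at (\<lambda>t x. p t x powr (1 + \<gamma>)) t"
    by (simp_all add: n_def)
  have "(\<integral>x. p \<theta> x * p t x powr \<gamma> \<partial>lborel) = powsum \<gamma> (\<lambda>j. cell_integral (\<lambda>x. \<eta> x powr (1 + \<gamma>)) j * mass \<theta> $ j) t"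
    "differentiable_under_integral_at (\<lambda>t x. p \<theta> x * p t x powr \<gamma>) t"
    by (rule cell_power_under_integral[OF g \<Theta>(1,2), where c = "\<lambda>j. mass \<theta> $ j"]; (rule 2 | rule \<Theta>(3)); assumption)+
  then show "(\<integral>x. p \<theta> x * p t x powr \<gamma> \<partial>lborel) = powsum \<gamma> (\<lambda>j. n \<gamma> j * mass \<theta> $ j) t"
    "differentiable_under_integral_at (\<lambda>t x. p \<theta> x * p t x powr \<gamma>) t"
    by (simp_all add: n_def)
qed

lemma p_mean_weighted_score:
  assumes \<gamma>: "\<gamma> > 0" and m: "\<And>j. mass t $ j > 0"
  shows "(\<integral>x. (p t x powr (1 + \<gamma>)) *\<^sub>R score_function p t x \<partial>lborel) $ i
    = n \<gamma> (Some i) * t $ i powr \<gamma> - n \<gamma> None * mass t $ None powr \<gamma>"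
proof -
  define \<sigma> :: "'k option \<Rightarrow> real ^ 'k" where "\<sigma> j = (mass t $ j powr (1 + \<gamma>)) *\<^sub>R (\<chi> i. tilt (axis i 1) $ j / mass t $ j)" for j
  have "(p t x powr (1 + \<gamma>)) *\<^sub>R score_function p t x = (\<eta> x powr (1 + \<gamma>)) *\<^sub>R \<sigma> (\<kappa> x)" for x
    by (simp add: p_powr[of t, OF m] p_score_function[of t, OF m] \<sigma>_def)
  then have "(\<integral>x. (p t x powr (1 + \<gamma>)) *\<^sub>R score_function p t x \<partial>lborel) = (\<Sum>j\<in>UNIV. n \<gamma> j *\<^sub>R \<sigma> j)"
    using has_integral_cell_function[OF \<eta>_power_integrable[OF \<gamma>], of \<sigma>]
    by (simp add: n_def has_bochner_integral_iff)
  moreover have "\<sigma> j $ i = mass t $ j powr \<gamma> * tilt (axis i 1) $ j" for j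
    using m[of j] by (simp add: \<sigma>_def powr_add)
  ultimately have "(\<integral>x. (p t x powr (1 + \<gamma>)) *\<^sub>R score_function p t x \<partial>lborel) $ i
      = (\<Sum>j\<in>UNIV. n \<gamma> j * (mass t $ j powr \<gamma> * tilt (axis i 1) $ j))" by simp
  also have "\<dots> = n \<gamma> (Some i) * t $ i powr \<gamma> - n \<gamma> None * mass t $ None powr \<gamma>"
    by (simp add: sum_UNIV_option tilt_def mass_def axis_def if_distrib cong: if_cong)
  finally show ?thesis .
qed

text \<open>
  As all masses \<open>s\<close> of the cells \<open>Some i\<close> decrease together, \<open>s\<^sup>\<gamma>\<close> decreases while the power of the remaining mass
  increases. Hence equality can hold for at most one of two values of \<open>s\<close>. By \<open>p_mean_weighted_score\<close> the
  inequality says that \<open>\<langle>p\<^sub>a\<^sup>1\<^sup>+\<^sup>\<gamma> s\<^sub>a\<rangle>\<close> is non-zero.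
\<close>

lemma nondegenerate_center_exists:
  assumes \<gamma>: "\<gamma> > 0"
  obtains a :: "real ^ 'k" and i where "\<And>j. mass a $ j > 0"
    "n \<gamma> (Some i) * a $ i powr \<gamma> \<noteq> n \<gamma> None * mass a $ None powr \<gamma>"
proof -
  define a :: "real \<Rightarrow> real ^ 'k" where "a s = (\<chi> i. s)" for s
  define K where "K = real CARD('k)"
  have K: "K > 0" by (simp add: K_def)
  have mass_a: "mass (a s) $ None = 1 - K * s" "mass (a s) $ Some i = s" "a s $ i = s" for s i
    by (auto simp: mass_def a_def K_def)
  \<comment> \<open>any two values below \<open>1 / K\<close>, which keep the remaining mass positive\<close>
  define s1 where "s1 = 1 / (K + 1)" define s2 where "s2 = 1 / (K + 2)"
  have s: "0 < s1" "K * s1 < 1" "0 < s2" "K * s2 < 1" "s2 < s1" using K by (auto simp: s1_def s2_def field_simps)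
  have pos: "mass (a s) $ j > 0" if "0 < s" "K * s < 1" for s j
    using that by (cases j) (auto simp: mass_a)
  have "s2 powr \<gamma> < s1 powr \<gamma>" using s \<gamma> by (intro powr_less_mono2) auto
  moreover have "(1 - K * s1) powr \<gamma> < (1 - K * s2) powr \<gamma>" using s K \<gamma> by (intro powr_less_mono2) auto
  ultimately have "n \<gamma> (Some undefined) * s2 powr \<gamma> < n \<gamma> (Some undefined) * s1 powr \<gamma>"
    "n \<gamma> None * (1 - K * s1) powr \<gamma> < n \<gamma> None * (1 - K * s2) powr \<gamma>"
    using n_pos[OF \<gamma>] by simp_all
  then consider "n \<gamma> (Some undefined) * s1 powr \<gamma> \<noteq> n \<gamma> None * (1 - K * s1) powr \<gamma>"
    | "n \<gamma> (Some undefined) * s2 powr \<gamma> \<noteq> n \<gamma> None * (1 - K * s2) powr \<gamma>" by linarith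
  then show thesis
  proof cases
    case 1
    show thesis by (rule that[of "a s1" undefined]) (use pos s 1 in \<open>auto simp: mass_a\<close>)
  next
    case 2
    show thesis by (rule that[of "a s2" undefined]) (use pos s 2 in \<open>auto simp: mass_a\<close>)
  qed
qed

end

lemma mass_continuous:
  assumes "\<rho> > 0"
  obtains r where "r > 0" "r \<le> \<rho>" "\<And>t. dist t a < r \<Longrightarrow> dist (mass t) (mass a) < \<rho>"
proof -
  have "(mass \<longlongrightarrow> mass a) (nhds a)"
    by (intro vec_tendstoI tendsto_mass filterlim_ident)
  from tendstoD[OF this assms] obtain r where "r > 0" "\<And>t. dist t a < r \<Longrightarrow> dist (mass t) (mass a) < \<rho>"
    unfolding eventually_nhds_metric by blast
  then show thesis using that[of "min r \<rho>"] assms by auto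
qed

lemma unique_arg_minI:
  assumes "x \<in> \<Theta>" "\<And>y. y \<in> \<Theta> \<Longrightarrow> y \<noteq> x \<Longrightarrow> (f x :: real) < f y"
  shows "\<exists>!t. is_arg_min f (\<lambda>t. t \<in> \<Theta>) t" and "arg_min_on f \<Theta> = x"
proof -
  have iff: "is_arg_min f (\<lambda>t. t \<in> \<Theta>) t \<longleftrightarrow> t = x" for t
    unfolding is_arg_min_def using assms by (metis less_asym less_irrefl)
  show "\<exists>!t. is_arg_min f (\<lambda>t. t \<in> \<Theta>) t" by (simp add: iff)
  show "arg_min_on f \<Theta> = x" by (simp add: arg_min_on_def arg_min_def iff)
qed

context cell_density begin

text \<open>
  Near the diagonal the scores of the model are \<open>score (mass \<theta>) t\<close>. Contamination by a point mass at \<open>z\<close>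
  replaces \<open>mass \<theta>\<close> by a vector \<open>f \<epsilon>\<close> that tends to \<open>mass \<theta>\<close>, so \<open>minimizer_stable\<close> applies.
\<close>

lemma cell_model_conditions:
  assumes \<gamma>: "\<gamma> > 0" and \<phi>: "holder_generator \<gamma> \<phi>"
    and conv: "\<And>f t. dist f (mass a) < \<rho> \<Longrightarrow> dist t a < \<rho> \<Longrightarrow>
      finite_cell_score.regular \<gamma> \<phi> (n \<gamma>) f t \<and> (\<forall>h. norm h = 1 \<longrightarrow> finite_cell_score.score2 \<gamma> \<phi> (n \<gamma>) f t h h > 0)"
    and r: "r > 0" "r \<le> \<rho>" "\<And>t. dist t a < r \<Longrightarrow> dist (mass t) (mass a) < \<rho>"
    and i: "n \<gamma> (Some i) * a $ i powr \<gamma> \<noteq> n \<gamma> None * mass a $ None powr \<gamma>"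
  shows "statistical_model (ball a r) p" "model_conditions \<phi> \<gamma> (ball a r) p"
    "perturbation_well_defined \<phi> \<gamma> (ball a r) p"
proof -
  interpret S: finite_cell_score \<gamma> \<phi> "n \<gamma>"
    by unfold_locales (use \<gamma> \<phi> n_pos in auto)
  let ?\<Theta> = "ball a r"
  have reg: "S.regular (mass \<theta>) t" if "\<theta> \<in> ?\<Theta>" "t \<in> ?\<Theta>" for \<theta> t
    using conv[OF r(3), of \<theta> t] that r(2) by (auto simp: dist_commute)
  have m: "mass t $ j > 0" if "t \<in> ?\<Theta>" for t j
    using reg[OF that that] by (simp add: S.regular_def)
  have norming: "(\<integral>x. p t x powr (1 + \<gamma>) \<partial>lborel) = S.norming t"
    and dui1: "differentiable_under_integral_at (\<lambda>t x. p t x powr (1 + \<gamma>)) t" if "t \<in> ?\<Theta>" for t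
    unfolding S.norming_def
    by (rule p_powers_under_integral[OF \<gamma> open_ball that _ that]; rule m; assumption)+
  have cross: "(\<integral>x. p \<theta> x * p t x powr \<gamma> \<partial>lborel) = S.cross (mass \<theta>) t"
    and dui2: "differentiable_under_integral_at (\<lambda>t x. p \<theta> x * p t x powr \<gamma>) t"
    if "\<theta> \<in> ?\<Theta>" "t \<in> ?\<Theta>" for \<theta> t
    unfolding S.cross_def
    by (rule p_powers_under_integral[OF \<gamma> open_ball that(2) _ that(1)]; rule m; assumption)+
  have score: "holder_score \<phi> \<gamma> (p \<theta>) (p t) = S.score (mass \<theta>) t" if "\<theta> \<in> ?\<Theta>" "t \<in> ?\<Theta>" for \<theta> t
    using that by (simp add: holder_score_def S.score_def S.ratio_def norming cross)
  show model: "statistical_model ?\<Theta> p"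
    by (rule p_statistical_model) (use m in auto)
  show conditions: "model_conditions \<phi> \<gamma> ?\<Theta> p"
    unfolding model_conditions_def
  proof (intro conjI ballI)
    fix \<theta> assume \<theta>: "\<theta> \<in> ?\<Theta>"
    note m\<theta> = m[OF \<theta>]
    show "(p \<theta> \<longlongrightarrow> 0) at_infinity" by (rule p_lim[OF m\<theta>])
    show "p \<theta> \<in> L_plus \<gamma>" by (rule p_L_plus[OF m\<theta> \<gamma>])
    show "((\<lambda>z. (p \<theta> z powr \<gamma>) *\<^sub>R score_function p \<theta> z) \<longlongrightarrow> 0) at_infinity"
      by (rule p_weighted_score_lim[OF m\<theta> \<gamma>])
    show "twice_differentiable_at (\<lambda>t. holder_score \<phi> \<gamma> (p \<theta>) (p t)) \<theta>"
      by (rule S.score_locally(1)[OF open_ball \<theta> reg[OF \<theta>] score[OF \<theta>]])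
    show "invertible (hessian (\<lambda>t. holder_score \<phi> \<gamma> (p \<theta>) (p t)) \<theta>)"
      by (rule S.hessian_invertible[OF open_ball \<theta> reg[OF \<theta>] score[OF \<theta>]])
    have "\<forall>\<^sub>F t in nhds \<theta>. t \<in> ?\<Theta>" by (rule eventually_nhds_in_open[OF open_ball \<theta>])
    then show "\<forall>\<^sub>F t in nhds \<theta>. differentiable_under_integral_at (\<lambda>t x. p t x powr (1 + \<gamma>)) t \<and>
        differentiable_under_integral_at (\<lambda>t x. p \<theta> x * p t x powr \<gamma>) t"
      by (rule eventually_mono) (use dui1 dui2[OF \<theta>] in blast)
  next
    have a: "a \<in> ?\<Theta>" using r by simp
    have "(\<integral>x. (p a x powr (1 + \<gamma>)) *\<^sub>R score_function p a x \<partial>lborel) $ i \<noteq> 0"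
      using i by (simp add: p_mean_weighted_score[OF \<gamma> m[OF a]])
    then have "(\<integral>x. (p a x powr (1 + \<gamma>)) *\<^sub>R score_function p a x \<partial>lborel) \<noteq> 0"
      by (metis zero_index)
    then show "\<exists>\<theta>\<in>?\<Theta>. (\<integral>x. (p \<theta> x powr (1 + \<gamma>)) *\<^sub>R score_function p \<theta> x \<partial>lborel) \<noteq> 0"
      using a by blast
  qed
  interpret M: holder_model \<gamma> \<phi> ?\<Theta> p
    by unfold_locales (fact \<gamma> \<phi> model conditions)+
  show "perturbation_well_defined \<phi> \<gamma> ?\<Theta> p"
    unfolding perturbation_well_defined_def
  proof (intro ballI allI conjI)
    fix \<theta> z assume \<theta>: "\<theta> \<in> ?\<Theta>"
    \<comment> \<open>a point mass at \<open>z\<close> acts on powers of the model like extra mass in the cell of \<open>z\<close>, scaled by the ratio of \<open>\<eta> z powr \<gamma>\<close> to the cell weight\<close>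
    define f where "f \<epsilon> = (1 - \<epsilon>) *\<^sub>R mass \<theta> + (\<epsilon> * (\<eta> z powr \<gamma> / n \<gamma> (\<kappa> z))) *\<^sub>R axis (\<kappa> z) 1" for \<epsilon> :: real
    have contaminated: "contaminated_score \<phi> \<gamma> p \<theta> z \<epsilon> t = S.score (f \<epsilon>) t"
      if t: "t \<in> ?\<Theta>" and \<epsilon>: "0 \<le> \<epsilon>" "\<epsilon> \<le> 1" for \<epsilon> t
    proof -
      have "S.cross (f \<epsilon>) t = (1 - \<epsilon>) * S.cross (mass \<theta>) t
          + (\<Sum>j\<in>UNIV. if j = \<kappa> z then \<epsilon> * (\<eta> z powr \<gamma> * mass t $ j powr \<gamma>) else 0)"
        unfolding S.cross_def powsum_def sum_distrib_left sum.distrib[symmetric]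
        using n_pos[OF \<gamma>, of "\<kappa> z"]
        by (intro sum.cong) (auto simp: f_def axis_def field_simps)
      also have "\<dots> = (1 - \<epsilon>) * S.cross (mass \<theta>) t + \<epsilon> * p t z powr \<gamma>"
        by (simp add: p_powr[OF m[OF t]])
      finally show ?thesis
        by (simp add: M.contaminated_score_eq[OF \<theta> t \<epsilon>] S.score_def S.ratio_def M.U_def M.V_def
            norming[OF t] cross[OF \<theta> t])
    qed
    have "(f \<longlongrightarrow> (1 - 0) *\<^sub>R mass \<theta> + (0 * (\<eta> z powr \<gamma> / n \<gamma> (\<kappa> z))) *\<^sub>R axis (\<kappa> z) 1) (at_right 0)"
      unfolding f_def by (intro tendsto_intros)
    then have f: "filterlim f (nhds (mass \<theta>)) (at_right 0)" by simp
    have small: "\<forall>\<^sub>F \<epsilon> in at_right (0::real). 0 < \<epsilon> \<and> \<epsilon> < 1"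
      using eventually_at_right_real[of 0 1] by (simp add: greaterThanLessThan_iff)
    have conv': "S.regular f t \<and> (\<forall>h. norm h = 1 \<longrightarrow> S.score2 f t h h > 0)"
      if "dist f (mass a) < \<rho>" "dist t a < r" for f t
      using conv[of f t] that r(2) by auto
    have stable: "\<forall>\<^sub>F f in nhds (mass \<theta>). \<exists>x\<in>?\<Theta>. dist x \<theta> < \<rho>' \<and>
        (\<forall>y\<in>?\<Theta>. y \<noteq> x \<longrightarrow> S.score f x < S.score f y)" if "\<rho>' > 0" for \<rho>'
      by (rule S.minimizer_stable[OF _ _ \<theta> that]; (rule conv' | rule r(3)); assumption)
    have ev: "\<forall>\<^sub>F \<epsilon> in at_right 0. (\<exists>!t. is_arg_min (contaminated_score \<phi> \<gamma> p \<theta> z \<epsilon>) (\<lambda>t. t \<in> ?\<Theta>) t) \<and>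
        dist (perturbed_parameter \<phi> \<gamma> ?\<Theta> p \<theta> z \<epsilon>) \<theta> < \<rho>'" if \<rho>': "\<rho>' > 0" for \<rho>'
      using small eventually_compose_filterlim[OF stable[OF \<rho>'] f]
    proof eventually_elim
      case (elim \<epsilon>)
      then obtain x where x: "x \<in> ?\<Theta>" "dist x \<theta> < \<rho>'" "\<And>y. y \<in> ?\<Theta> \<Longrightarrow> y \<noteq> x \<Longrightarrow> S.score (f \<epsilon>) x < S.score (f \<epsilon>) y"
        by blast
      have less: "contaminated_score \<phi> \<gamma> p \<theta> z \<epsilon> x < contaminated_score \<phi> \<gamma> p \<theta> z \<epsilon> y"
        if "y \<in> ?\<Theta>" "y \<noteq> x" for y
        using x(3)[OF that] contaminated[OF x(1)] contaminated[OF that(1)] elim by simp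
      have unique: "\<exists>!t. is_arg_min (contaminated_score \<phi> \<gamma> p \<theta> z \<epsilon>) (\<lambda>t. t \<in> ?\<Theta>) t"
        "arg_min_on (contaminated_score \<phi> \<gamma> p \<theta> z \<epsilon>) ?\<Theta> = x"
        by (rule unique_arg_minI[OF x(1)]; rule less; assumption)+
      show ?case using unique x(2)
        by (simp add: perturbed_parameter_def)
    qed
    show "\<forall>\<^sub>F \<epsilon> in at_right 0. \<exists>!t. is_arg_min (contaminated_score \<phi> \<gamma> p \<theta> z \<epsilon>) (\<lambda>t. t \<in> ?\<Theta>) t"
      using ev[OF zero_less_one] by (rule eventually_mono) blast
    show "(perturbed_parameter \<phi> \<gamma> ?\<Theta> p \<theta> z \<longlongrightarrow> \<theta>) (at_right 0)"
      by (rule tendstoI) (rule eventually_mono[OF ev], auto)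
  qed
qed

end

lemma regular_model_exists:
  assumes \<gamma>: "\<gamma> > 0" and \<phi>: "holder_generator \<gamma> \<phi>"
  obtains \<Theta> :: "(real ^ 'k) set" and p :: "real ^ 'k \<Rightarrow> real ^ 'd \<Rightarrow> real"
  where "statistical_model \<Theta> p" "model_conditions \<phi> \<gamma> \<Theta> p" "perturbation_well_defined \<phi> \<gamma> \<Theta> p"
proof -
  obtain \<kappa> :: "real ^ 'd \<Rightarrow> 'k option" and \<eta> where "cell_density \<kappa> \<eta>"
    using cell_density_exists by blast
  then interpret cell_density \<kappa> \<eta> .
  interpret S: finite_cell_score \<gamma> \<phi> "n \<gamma>"
    by unfold_locales (use \<gamma> \<phi> n_pos in auto)
  obtain a :: "real ^ 'k" and i where a: "\<And>j. mass a $ j > 0"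
    and i: "n \<gamma> (Some i) * a $ i powr \<gamma> \<noteq> n \<gamma> None * mass a $ None powr \<gamma>"
    by (rule nondegenerate_center_exists[OF \<gamma>]) blast
  obtain \<rho> where \<rho>: "\<rho> > 0" "\<And>f t. dist f (mass a) < \<rho> \<Longrightarrow> dist t a < \<rho> \<Longrightarrow>
      S.regular f t \<and> (\<forall>h. norm h = 1 \<longrightarrow> S.score2 f t h h > 0)"
    by (rule S.uniformly_convex_near_diagonal[of a, OF a]) blast
  obtain r where r: "r > 0" "r \<le> \<rho>" "\<And>t. dist t a < r \<Longrightarrow> dist (mass t) (mass a) < \<rho>"
    by (rule mass_continuous[OF \<rho>(1), of a]) blast
  from cell_model_conditions[OF \<gamma> \<phi> \<rho>(2) r i] show thesis by (rule that)
qed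

section \<open>Redescending estimators and their asymptotic variance\<close>

theorem theorem5:
  fixes \<gamma> :: real and \<phi> :: "real \<Rightarrow> real"
  assumes "\<gamma> > 0" and "holder_generator \<gamma> \<phi>"
  shows "((\<forall>(\<Theta> :: (real ^ 'k) set) (p :: real ^ 'k \<Rightarrow> real ^ 'd \<Rightarrow> real).
             statistical_model \<Theta> p \<and> model_conditions \<phi> \<gamma> \<Theta> p \<and>
             perturbation_well_defined \<phi> \<gamma> \<Theta> p
             \<longrightarrow> redescending \<phi> \<gamma> \<Theta> p)
          \<longleftrightarrow> deriv (deriv \<phi>) 1 = - \<gamma> * (1 + \<gamma>))
       \<and> (\<forall>\<psi> (\<Theta> :: (real ^ 'k) set) (p :: real ^ 'k \<Rightarrow> real ^ 'd \<Rightarrow> real).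
             holder_generator \<gamma> \<psi> \<and>
             deriv (deriv \<phi>) 1 = - \<gamma> * (1 + \<gamma>) \<and> deriv (deriv \<psi>) 1 = - \<gamma> * (1 + \<gamma>) \<and>
             statistical_model \<Theta> p \<and>
             model_conditions \<phi> \<gamma> \<Theta> p \<and> perturbation_well_defined \<phi> \<gamma> \<Theta> p \<and>
             model_conditions \<psi> \<gamma> \<Theta> p \<and> perturbation_well_defined \<psi> \<gamma> \<Theta> p
             \<longrightarrow> (\<forall>\<theta>\<in>\<Theta>. \<forall>V. has_asymptotic_variance \<phi> \<gamma> \<Theta> p \<theta> V \<longleftrightarrow>
                               has_asymptotic_variance \<psi> \<gamma> \<Theta> p \<theta> V))"
proof (intro conjI)
  have redescending: "redescending \<phi> \<gamma> \<Theta> p \<longleftrightarrow> deriv (deriv \<phi>) 1 = - \<gamma> * (1 + \<gamma>)"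
    if "statistical_model \<Theta> p" "model_conditions \<phi> \<gamma> \<Theta> p" "perturbation_well_defined \<phi> \<gamma> \<Theta> p"
    for \<Theta> :: "(real ^ 'k) set" and p :: "real ^ 'k \<Rightarrow> real ^ 'd \<Rightarrow> real"
  proof -
    interpret holder_model \<gamma> \<phi> \<Theta> p using assms that by unfold_locales
    show ?thesis by (rule redescending_iff[OF that(3)])
  qed
  obtain \<Theta>0 :: "(real ^ 'k) set" and p0 :: "real ^ 'k \<Rightarrow> real ^ 'd \<Rightarrow> real" where
    "statistical_model \<Theta>0 p0" "model_conditions \<phi> \<gamma> \<Theta>0 p0" "perturbation_well_defined \<phi> \<gamma> \<Theta>0 p0"
    by (rule regular_model_exists[OF assms])
  with redescending show "(\<forall>(\<Theta> :: (real ^ 'k) set) (p :: real ^ 'k \<Rightarrow> real ^ 'd \<Rightarrow> real).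
             statistical_model \<Theta> p \<and> model_conditions \<phi> \<gamma> \<Theta> p \<and>
             perturbation_well_defined \<phi> \<gamma> \<Theta> p
             \<longrightarrow> redescending \<phi> \<gamma> \<Theta> p)
          \<longleftrightarrow> deriv (deriv \<phi>) 1 = - \<gamma> * (1 + \<gamma>)"
    by meson
qed (intro allI impI ballI, elim conjE, rule asymptotic_variance_cong[OF assms], simp_all)

end
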